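(* Let linear maps $U_i:E_0\to E_i$, $1\le i\le k$, and $V_j:E_0\to E^j$, $1\le j\le m$, satisfy $U_iU_i^*=\mathrm{id}_{E_i}$ and $V_jV_j^*=\mathrm{id}_{E^j}$ for all $i,j$. Assume further that the map $x\in E_0\mapsto\sum_{i=1}^kU_ix\in E_0$ is a bijection, and that $$\sum_{i=1}^kc_iU_i^*U_i=\sum_{j=1}^md_jV_j^*V_j.$$ If measurable functions $f_i:E_i\to[0,\infty)$, $1\le i\le k$, and $g_j:E^j\to[0,\infty)$, $1\le j\le m$, satisfy $$\prod_{i=1}^kf_i^{c_i}(U_ix)\le\prod_{j=1}^mg_j^{d_j}(V_jx)\qquad\forall x\in E_0,$$ then $$\prod_{i=1}^k\Big(\int_{E_i}f_i\Big)^{c_i}\le\prod_{j=1}^m\Big(\int_{E^j}g_j\Big)^{d_j}.$$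
   Context: $E_1,\dots,E_k$ and $E^1,\dots,E^m$ are Euclidean spaces (finite-dimensional real Hilbert spaces with Lebesgue measure), $E_0=\bigoplus_{i=1}^kE_i$ is the orthogonal direct sum (each $E_i$ is regarded as a subspace of $E_0$, so that $\sum_iU_ix$ is the vector $(U_1x,\dots,U_kx)$), and $(c_i)_{1\le i\le k}$, $(d_j)_{1\le j\le m}$ are positive real numbers. *)

theory Defs
  imports "HOL-Analysis.Analysis"
begin

text \<open>
  A Euclidean space is represented as a linear subspace of some type of class
  \<open>euclidean_space\<close>, so that finite families of spaces of arbitrary, varying dimensions
  (including dimension 0, which no such type has) can be quantified over.
  A linear map between two such spaces is a function whose values outside its domain are
  irrelevant.
\<close>

definition linear_map ::
    "'a::real_vector set \<Rightarrow> 'b::real_vector set \<Rightarrow> ('a \<Rightarrow> 'b) \<Rightarrow> bool" where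
  "linear_map S T f \<longleftrightarrow>
     f \<in> S \<rightarrow> T \<and>
     (\<forall>x\<in>S. \<forall>y\<in>S. f (x + y) = f x + f y) \<and>
     (\<forall>r. \<forall>x\<in>S. f (r *\<^sub>R x) = r *\<^sub>R f x)"

text \<open>
  The library constant \<open>adjoint\<close> is the adjoint of a map on a whole type; here the domain is
  the subspace \<open>S\<close>. The vector is unique because \<open>S\<close> is a subspace, and it exists by
  \<open>adjoint_on_works\<close>.
\<close>

definition adjoint_on ::
    "'a::euclidean_space set \<Rightarrow> ('a \<Rightarrow> 'b::euclidean_space) \<Rightarrow> 'b \<Rightarrow> 'a" where
  "adjoint_on S f y = (THE x. x \<in> S \<and> (\<forall>z\<in>S. f z \<bullet> y = z \<bullet> x))"

definition orthonormal_basis :: "'a::euclidean_space set \<Rightarrow> 'a set \<Rightarrow> bool" where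
  "orthonormal_basis S B \<longleftrightarrow>
     B \<subseteq> S \<and> pairwise orthogonal B \<and> (\<forall>b\<in>B. norm b = 1) \<and> span B = S"

text \<open>
  Lebesgue measure on the subspace \<open>S\<close> itself (not the restriction of the measure of the
  ambient space): the image of product Lebesgue measure under orthonormal coordinates, exactly as
  \<open>lborel\<close> is defined from \<open>Basis\<close>. By rotation invariance the
  choice of basis does not matter. On \<open>{0}\<close> it is the unit point mass.
\<close>

definition subspace_lborel :: "'a::euclidean_space set \<Rightarrow> 'a measure" where
  "subspace_lborel S =
     (let B = (SOME B. orthonormal_basis S B)
      in distr (\<Pi>\<^sub>M b\<in>B. (lborel :: real measure)) (restrict_space borel S)
           (\<lambda>c. \<Sum>b\<in>B. c b *\<^sub>R b))"

definition subspace_lebesgue :: "'a::euclidean_space set \<Rightarrow> 'a measure" where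
  "subspace_lebesgue S = completion (subspace_lborel S)"

text \<open>Powers of \<open>[0, \<infinity>]\<close>-valued integrals, for exponents \<open>c > 0\<close>.\<close>

definition ennreal_powr :: "ennreal \<Rightarrow> real \<Rightarrow> ennreal" where
  "ennreal_powr a c = (if a = \<infinity> then \<infinity> else ennreal (enn2real a powr c))"

lemma orthonormal_basis_exists:
  fixes S :: "'a::euclidean_space set"
  assumes "subspace S"
  shows "\<exists>B. orthonormal_basis S B"
  using orthonormal_basis_subspace[OF assms] unfolding orthonormal_basis_def by metis

lemma linear_map_sum:
  assumes "linear_map S T f" "subspace S" "finite B" "B \<subseteq> S"
  shows "f (\<Sum>b\<in>B. c b *\<^sub>R b) = (\<Sum>b\<in>B. c b *\<^sub>R f b)"
  using assms(3,4)
proof (induction B rule: finite_induct)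
  case empty
  have "f (0 *\<^sub>R 0) = 0 *\<^sub>R f 0"
    using assms(1,2) subspace_0 unfolding linear_map_def by blast
  then show ?case by simp
next
  case (insert b B)
  have "(\<Sum>b\<in>B. c b *\<^sub>R b) \<in> S" "c b *\<^sub>R b \<in> S"
    using insert.prems assms(2) by (auto intro!: subspace_sum subspace_scale)
  then show ?case
    using insert assms(1) unfolding linear_map_def by simp
qed

lemma adjoint_on_works:
  fixes f :: "'a::euclidean_space \<Rightarrow> 'b::euclidean_space"
  assumes f: "linear_map S T f" and S: "subspace S"
  shows "adjoint_on S f y \<in> S \<and> (\<forall>z\<in>S. f z \<bullet> y = z \<bullet> adjoint_on S f y)"
proof -
  obtain B where B: "B \<subseteq> S" "pairwise orthogonal B" "\<And>b. b \<in> B \<Longrightarrow> norm b = 1"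
    "independent B" "span B = S"
    using orthonormal_basis_subspace[OF S] by metis
  have fin: "finite B" using B(4) by (simp add: independent_imp_finite)
  define x where "x = (\<Sum>b\<in>B. (f b \<bullet> y) *\<^sub>R b)"
  have x: "x \<in> S" unfolding x_def using B(1) S by (auto intro!: subspace_sum subspace_scale)
  have eq: "f z \<bullet> y = z \<bullet> x" if z: "z \<in> S" for z
  proof -
    obtain c where c: "z = (\<Sum>b\<in>B. c b *\<^sub>R b)"
      using z B(5) span_finite[OF fin] by auto
    have zb: "z \<bullet> b = c b" if b: "b \<in> B" for b
    proof -
      have "z \<bullet> b = (\<Sum>a\<in>B. if a = b then c b else 0)"
        unfolding c inner_sum_left
      proof (rule sum.cong)
        fix a assume "a \<in> B"
        then show "c a *\<^sub>R a \<bullet> b = (if a = b then c b else 0)"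
          using B(2,3) b unfolding pairwise_def orthogonal_def
          by (auto simp: norm_eq_1)
      qed simp
      then show ?thesis using fin b by simp
    qed
    have "f z \<bullet> y = (\<Sum>b\<in>B. c b * (f b \<bullet> y))"
      unfolding c linear_map_sum[OF f S fin B(1)] by (simp add: inner_sum_left)
    also have "\<dots> = z \<bullet> x"
      unfolding x_def inner_sum_right by (intro sum.cong) (simp_all add: zb)
    finally show ?thesis .
  qed
  have "\<exists>!x. x \<in> S \<and> (\<forall>z\<in>S. f z \<bullet> y = z \<bullet> x)"
  proof (rule ex1I[of _ x])
    show "x \<in> S \<and> (\<forall>z\<in>S. f z \<bullet> y = z \<bullet> x)" using x eq by blast
    fix w assume w: "w \<in> S \<and> (\<forall>z\<in>S. f z \<bullet> y = z \<bullet> w)"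
    have "w - x \<in> S" using w x S by (simp add: subspace_diff)
    then have "(w - x) \<bullet> (w - x) = 0" using w eq by (simp add: inner_diff_right)
    then show "w = x" by simp
  qed
  from theI'[OF this] show ?thesis unfolding adjoint_on_def .
qed

end

theory Submission
  imports Defs "HOL-Probability.Probability"
begin

text \<open>
  Multiplying \<open>f\<^sub>i\<close> and \<open>g\<^sub>j\<close> by \<open>exp (pi |x|\<^sup>2)\<close> replaces Lebesgue measure by the Gaussian
  probability measure with density \<open>exp (- pi |x|\<^sup>2)\<close>; the frame identity keeps the pointwise
  hypothesis intact, and as a coisometry maps a Gaussian to a Gaussian, all functions can be
  pulled back to one space. There the pointwise inequality is preserved by the heat flow, and
  time \<open>1\<close> at the origin gives the integrals. To see this, take a small step. On the side of
  the \<open>g\<^sub>j\<close>, Jensen's inequality bounds the logarithm of a Gaussian average below by the average of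
  \<open>ln g\<^sub>j\<close> along any translate, minus the entropic cost of the translation. On the side of the
  \<open>f\<^sub>i\<close>, translating by the gradient of \<open>ln f\<^sub>i\<close> makes this an equality up to a quadratic error.
  Since \<open>x \<mapsto> (U\<^sub>1 x, \<dots>, U\<^sub>k x)\<close> is onto, the translations by these gradients are the components
  of one vector, and the frame identity says that the total costs on both sides agree.
  Iterating \<open>n\<close> steps of length \<open>1/n\<close> leaves an error of order \<open>1/n\<close>.
\<close>

section \<open>Gaussian measure\<close>

text \<open>The density \<open>exp (- (pi * (norm x)\<^sup>2))\<close> has mass 1 in every
  dimension, so the pullbacks need no normalising constants that depend on the dimensions of the
  spaces. Each coordinate has variance \<open>1 / (2 * pi)\<close>; hence the factor
  \<open>2 * pi\<close> in the translations by gradients. A step of parameter \<open>r\<close> takes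
  time \<open>r\<^sup>2\<close> and errs by \<open>C * r ^ 4\<close>. Summing such errors is useful
  only if one \<open>C\<close> serves every step. This shapes the proof: \<open>C\<close> depends on
  the functions only through the constants of \<open>tame\<close>, and the flow preserves these. The
  given functions are merely measurable, may vanish and may have infinite integrals, so nothing is
  tame at the start. They are clamped between positive constants, chosen so that the product
  inequality survives. The initial averaging of the logarithms then provides gradients, and it turns
  an inequality valid almost everywhere into one valid everywhere. Its effect vanishes in the limit
  because Lipschitz functions are dense in L1 of the Gaussian. Removing the clamps at the end is
  monotone convergence, with care for products of 0 and \<infinity>.\<close>

definition gauss :: "'a::euclidean_space measure" where
  "gauss = density lborel (\<lambda>x. ennreal (exp (- (pi * (norm x)\<^sup>2))))"

lemma sets_gauss [measurable_cong, simp]: "sets gauss = sets borel"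
  by (simp add: gauss_def)

lemma space_gauss [simp]: "space gauss = UNIV"
  by (simp add: gauss_def)

lemma nn_integral_exp_pi_real: "(\<integral>\<^sup>+x. ennreal (exp (- (pi * x\<^sup>2))) \<partial>(lborel :: real measure)) = 1"
proof -
  \<comment> \<open>With standard deviation \<open>1 / sqrt (2 * pi)\<close> the prefactor of the
    normal density is 1.\<close>
  have "prob_space (density lborel (normal_density 0 (1 / sqrt (2 * pi))))"
    by (rule prob_space_normal_density) simp
  then have "emeasure (density lborel (normal_density 0 (1 / sqrt (2 * pi)))) UNIV = 1"
    using prob_space.emeasure_space_1 by fastforce
  moreover have "normal_density 0 (1 / sqrt (2 * pi)) x = exp (- (pi * x\<^sup>2))" for x
    by (simp add: normal_density_def power_divide field_simps)
  ultimately show ?thesis by (simp add: emeasure_density)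
qed

lemma norm_square_Basis: "(norm (x::'a::euclidean_space))\<^sup>2 = (\<Sum>b\<in>Basis. (x \<bullet> b)\<^sup>2)"
  unfolding power2_norm_eq_inner by (subst euclidean_inner) (simp add: power2_eq_square)

lemma nn_integral_exp_pi:
  "(\<integral>\<^sup>+x. ennreal (exp (- (pi * (norm (x::'a::euclidean_space))\<^sup>2))) \<partial>lborel) = 1"
proof -
  have "ennreal (exp (- (pi * (norm x)\<^sup>2))) = (\<Prod>b\<in>Basis. ennreal (exp (- (pi * (x \<bullet> b)\<^sup>2))))" for x :: 'a
    by (simp add: norm_square_Basis sum_distrib_left exp_sum prod_ennreal sum_negf[symmetric])
  then have "(\<integral>\<^sup>+x. ennreal (exp (- (pi * (norm (x::'a))\<^sup>2))) \<partial>lborel)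
      = (\<integral>\<^sup>+x. (\<Prod>b\<in>Basis. ennreal (exp (- (pi * (x \<bullet> b)\<^sup>2)))) \<partial>(lborel :: 'a measure))" by simp
  also have "\<dots> = 1"
    by (subst nn_integral_lborel_prod) (auto simp: nn_integral_exp_pi_real)
  finally show ?thesis .
qed

lemma prob_space_gauss: "prob_space (gauss :: 'a::euclidean_space measure)"
  by (rule prob_spaceI) (simp add: gauss_def emeasure_density nn_integral_exp_pi)

interpretation gauss: prob_space "gauss :: 'a::euclidean_space measure"
  by (rule prob_space_gauss)

lemma measure_gauss_UNIV [simp]: "measure (gauss :: 'a::euclidean_space measure) UNIV = 1"
  using gauss.prob_space[where 'a = 'a] by simp

lemma nn_integral_gauss:
  assumes [measurable]: "f \<in> borel_measurable borel"
  shows "(\<integral>\<^sup>+x. f x \<partial>gauss) = (\<integral>\<^sup>+x. ennreal (exp (- (pi * (norm x)\<^sup>2))) * f x \<partial>lborel)"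
  by (simp add: gauss_def nn_integral_density)

text \<open>From \<open>0 \<le> (l - norm x / 2)\<^sup>2\<close> the linear exponent is at most
  \<open>l\<^sup>2\<close> plus a quarter of \<open>(norm x)\<^sup>2\<close>. What remains is
  dominated by the Gaussian at half scale, whose integral is a power of 2.\<close>

lemma integrable_gauss_exp_norm: "integrable gauss (\<lambda>x::'a::euclidean_space. exp (l * norm x))"
proof -
  have "(\<integral>\<^sup>+x. ennreal (exp (l * norm x)) \<partial>(gauss :: 'a measure))
      \<le> (\<integral>\<^sup>+x. ennreal (exp (l\<^sup>2)) * ennreal (exp (- (pi * (norm ((1/2) *\<^sub>R x))\<^sup>2))) \<partial>(lborel :: 'a measure))"
  proof (subst nn_integral_gauss, simp, rule nn_integral_mono)
    fix x :: 'a
    have "0 \<le> (l - norm x / 2)\<^sup>2" "3 * (norm x)\<^sup>2 \<le> pi * (norm x)\<^sup>2" "(norm x)\<^sup>2 \<le> pi * (3 * (norm x)\<^sup>2)"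
      using pi_gt3 mult_right_mono[of 1 "pi * 3" "(norm x)\<^sup>2"] by (auto intro: mult_right_mono)
    then have "- pi * (norm x)\<^sup>2 + l * norm x \<le> l\<^sup>2 - pi * (norm x / 2)\<^sup>2"
      unfolding power2_diff power_divide by (simp add: field_simps)
    then show "ennreal (exp (- (pi * (norm x)\<^sup>2))) * ennreal (exp (l * norm x))
      \<le> ennreal (exp (l\<^sup>2)) * ennreal (exp (- (pi * (norm ((1/2) *\<^sub>R x))\<^sup>2)))"
      by (simp add: ennreal_mult[symmetric] exp_add[symmetric])
  qed
  also have "\<dots> = ennreal (exp (l\<^sup>2)) * (\<integral>\<^sup>+x. ennreal (exp (- (pi * (norm ((1/2) *\<^sub>R x))\<^sup>2))) \<partial>(lborel :: 'a measure))"
    by (simp add: nn_integral_cmult)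
  also have "(\<integral>\<^sup>+x. ennreal (exp (- (pi * (norm ((1/2) *\<^sub>R x))\<^sup>2))) \<partial>(lborel :: 'a measure))
      = 2 ^ DIM('a) * (\<integral>\<^sup>+x. ennreal (exp (- (pi * (norm x)\<^sup>2))) \<partial>(lborel :: 'a measure))"
    by (subst lborel_affine[of 2 0])
       (simp_all add: nn_integral_density nn_integral_distr nn_integral_cmult ennreal_power[symmetric])
  also have "ennreal (exp (l\<^sup>2)) * \<dots> < \<infinity>"
    by (simp add: nn_integral_exp_pi ennreal_mult_less_top power_less_top_ennreal)
  finally show ?thesis
    by (intro integrableI_bounded) auto
qed

text \<open>A single term of the exponential series gives \<open>t ^ n \<le> fact n * exp t\<close>,
  so the polynomial factor only raises \<open>l\<close> by one. The powers 1, 2 and 4 serve as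
  dominating functions for first moments and for Taylor remainders.\<close>

lemma integrable_gauss_poly_exp_norm:
  assumes a: "0 \<le> a"
  shows "integrable gauss (\<lambda>x::'a::euclidean_space. (norm x + a) ^ n * exp (l * norm x))"
proof (rule Bochner_Integration.integrable_bound)
  show "integrable gauss (\<lambda>x::'a. fact n * exp a * exp ((l + 1) * norm x))"
    by (intro integrable_mult_right integrable_gauss_exp_norm)
  have "t ^ n \<le> fact n * exp t" if "0 \<le> t" for t :: real
    using sum_le_suminf[OF summable_exp_generic[of t], of "{n}"] that
    by (simp add: exp_def field_simps)
  then have "(norm x + a) ^ n \<le> fact n * exp (norm x + a)" for x :: 'a
    using a by (simp add: add_nonneg_nonneg)
  then have "(norm x + a) ^ n * exp (l * norm x) \<le> fact n * exp (norm x + a) * exp (l * norm x)" for x :: 'a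
    by (intro mult_right_mono) auto
  then show "AE x in gauss. norm ((norm (x::'a) + a) ^ n * exp (l * norm x)) \<le> norm (fact n * exp a * exp ((l + 1) * norm x))"
    using a by (auto simp: abs_mult exp_add algebra_simps)
qed simp

text \<open>The Cameron-Martin formula, by completing the square in the exponent. It is the origin
  of every cost \<open>pi * (norm v)\<^sup>2\<close> below.\<close>

lemma gauss_shift:
  "distr (density gauss (\<lambda>x. ennreal (exp (- (2 * pi * (x \<bullet> v)) - pi * (norm v)\<^sup>2)))) borel (\<lambda>x. x + v) = gauss"
  (is "?L = gauss")
proof (rule measure_eqI)
  fix A assume "A \<in> sets ?L"
  then have [measurable]: "A \<in> sets borel" by simp
  have eq: "- (2 * pi * (x \<bullet> v)) - pi * (norm v)\<^sup>2 - pi * (norm x)\<^sup>2 = - (pi * (norm (v + x))\<^sup>2)" for x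
    by (simp add: power2_norm_eq_inner inner_simps inner_commute algebra_simps)
  have "emeasure ?L A = (\<integral>\<^sup>+x. indicator A (x + v) * ennreal (exp (- (2 * pi * (x \<bullet> v)) - pi * (norm v)\<^sup>2)) \<partial>gauss)"
    by (simp add: nn_integral_distr nn_integral_density mult.commute flip: nn_integral_indicator)
  also have "\<dots> = (\<integral>\<^sup>+x. ennreal (exp (- (pi * (norm (v + x))\<^sup>2))) * indicator A (v + x) \<partial>lborel)"
    by (subst nn_integral_gauss)
       (auto intro!: nn_integral_cong simp: indicator_def add.commute ennreal_mult[symmetric] exp_add[symmetric] eq
          split: if_splits)
  also have "\<dots> = (\<integral>\<^sup>+x. ennreal (exp (- (pi * (norm x)\<^sup>2))) * indicator A x \<partial>distr lborel borel ((+) v))"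
    by (simp add: nn_integral_distr)
  also have "\<dots> = emeasure gauss A"
    by (simp add: lborel_distr_plus gauss_def emeasure_density)
  finally show "emeasure ?L A = emeasure gauss A" .
qed simp

lemma integral_gauss_shift:
  fixes f :: "'a::euclidean_space \<Rightarrow> real"
  assumes [measurable]: "f \<in> borel_measurable borel"
  shows "(\<integral>x. exp (- (2 * pi * (x \<bullet> v)) - pi * (norm v)\<^sup>2) * f (x + v) \<partial>gauss) = (\<integral>x. f x \<partial>gauss)"
proof -
  have "(\<integral>x. f x \<partial>gauss) = (\<integral>x. f x \<partial>distr (density gauss (\<lambda>x. ennreal (exp (- (2 * pi * (x \<bullet> v)) - pi * (norm v)\<^sup>2)))) borel (\<lambda>x. x + v))"
    by (simp only: gauss_shift)
  then show ?thesis
    by (simp add: integral_distr integral_density)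
qed

lemma gauss_uminus: "distr gauss borel uminus = (gauss :: 'a::euclidean_space measure)"
proof (rule measure_eqI)
  fix A :: "'a set" assume "A \<in> sets (distr gauss borel uminus)"
  then have [measurable]: "A \<in> sets borel" by simp
  have "emeasure (distr gauss borel uminus) A = (\<integral>\<^sup>+x. indicator A (- x) \<partial>gauss)"
    by (simp add: nn_integral_distr flip: nn_integral_indicator)
  also have "\<dots> = (\<integral>\<^sup>+x. ennreal (exp (- (pi * (norm x)\<^sup>2))) * indicator A (- x) \<partial>lborel)"
    by (simp add: nn_integral_gauss)
  also have "\<dots> = (\<integral>\<^sup>+x. ennreal (exp (- (pi * (norm x)\<^sup>2))) * indicator A x \<partial>lborel)"
    by (subst lborel_affine[of "-1" 0])
       (simp_all add: nn_integral_density nn_integral_distr)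
  also have "\<dots> = emeasure gauss A"
    by (simp add: gauss_def emeasure_density)
  finally show "emeasure (distr gauss borel uminus) A = emeasure gauss A" .
qed simp

lemma integral_gauss_inner: "(\<integral>x. x \<bullet> v \<partial>gauss) = (0::real)"
proof -
  have "(\<integral>x. x \<bullet> v \<partial>gauss) = (\<integral>x. x \<bullet> v \<partial>distr gauss borel uminus)"
    by (simp only: gauss_uminus)
  also have "\<dots> = - (\<integral>x. x \<bullet> v \<partial>gauss)"
    by (simp add: integral_distr)
  finally show ?thesis by simp
qed

lemma nn_integral_lborel_affine:
  fixes t :: "'a::euclidean_space"
  assumes "r \<noteq> 0" and [measurable]: "f \<in> borel_measurable borel"
  shows "(\<integral>\<^sup>+x. f x \<partial>lborel) = (\<integral>\<^sup>+x. ennreal (\<bar>1 / r\<bar> ^ DIM('a)) * f ((1 / r) *\<^sub>R (x - t)) \<partial>lborel)"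
proof -
  have "(\<integral>\<^sup>+x. f x \<partial>lborel) = (\<integral>\<^sup>+x. f x \<partial>density (distr lborel borel (\<lambda>x. - (1 / r) *\<^sub>R t + (1 / r) *\<^sub>R x)) (\<lambda>_. ennreal (\<bar>1 / r\<bar> ^ DIM('a))))"
    using assms(1) lborel_affine[of "1 / r" "- (1 / r) *\<^sub>R t"] by (simp add: ennreal_power)
  also have "\<dots> = (\<integral>\<^sup>+x. ennreal (\<bar>1 / r\<bar> ^ DIM('a)) * f ((1 / r) *\<^sub>R (x - t)) \<partial>lborel)"
    by (simp add: nn_integral_density nn_integral_distr algebra_simps)
  finally show ?thesis .
qed

lemma gauss_add:
  assumes rs: "r\<^sup>2 + s\<^sup>2 = 1" and r: "r \<noteq> 0"
  shows "distr (gauss \<Otimes>\<^sub>M gauss) borel (\<lambda>(x, y). r *\<^sub>R x + s *\<^sub>R y) = (gauss :: 'a::euclidean_space measure)"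
    (is "?L = _")
proof (rule measure_eqI)
  fix A assume "A \<in> sets ?L"
  then have [measurable]: "A \<in> sets borel" by simp
  interpret P: pair_sigma_finite "gauss :: 'a measure" "gauss :: 'a measure" ..
  define e where "e x = ennreal (exp (- (pi * (norm x)\<^sup>2)))" for x :: 'a
  define w where "w = ennreal (\<bar>1 / r\<bar> ^ DIM('a))"
  have e_meas [measurable]: "e \<in> borel_measurable borel" unfolding e_def by simp
  have e1: "(\<integral>\<^sup>+x. e x \<partial>lborel) = 1" unfolding e_def by (rule nn_integral_exp_pi)
  \<comment> \<open>Since \<open>r\<^sup>2 + s\<^sup>2 = 1\<close>, the joint exponent in
    \<open>y\<close> and \<open>z = r *\<^sub>R x + s *\<^sub>R y\<close> is symmetric under
    exchanging \<open>y\<close> and \<open>z\<close>. After the exchange the Gaussian in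
    \<open>z\<close> factors out, and \<open>y\<close> is integrated away by the same affine
    substitution.\<close>
  have key: "e y * e ((1 / r) *\<^sub>R (z - s *\<^sub>R y)) = e z * e ((1 / r) *\<^sub>R (y - s *\<^sub>R z))" for y z
  proof -
    have "r\<^sup>2 * (norm y)\<^sup>2 + (norm (z - s *\<^sub>R y))\<^sup>2 = r\<^sup>2 * (norm z)\<^sup>2 + (norm (y - s *\<^sub>R z))\<^sup>2"
    proof -
      have r2: "r\<^sup>2 = 1 - s * s" using rs by (simp add: power2_eq_square)
      show ?thesis
        unfolding r2 by (simp add: power2_norm_eq_inner inner_simps inner_commute algebra_simps)
    qed
    then have "(norm y)\<^sup>2 + (norm ((1 / r) *\<^sub>R (z - s *\<^sub>R y)))\<^sup>2 = (norm z)\<^sup>2 + (norm ((1 / r) *\<^sub>R (y - s *\<^sub>R z)))\<^sup>2"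
      using r unfolding norm_scaleR power_mult_distrib by (simp add: field_simps)
    then have "- (pi * (norm y)\<^sup>2) + - (pi * (norm ((1 / r) *\<^sub>R (z - s *\<^sub>R y)))\<^sup>2)
        = - (pi * (norm z)\<^sup>2) + - (pi * (norm ((1 / r) *\<^sub>R (y - s *\<^sub>R z)))\<^sup>2)"
      unfolding minus_add_distrib[symmetric] distrib_left[symmetric] by simp
    then show ?thesis
      unfolding e_def by (simp only: ennreal_mult[symmetric] exp_ge_zero exp_add[symmetric])
  qed
  have inner_affine: "(\<integral>\<^sup>+x. e x * indicator A (r *\<^sub>R x + s *\<^sub>R y) \<partial>lborel)
      = (\<integral>\<^sup>+z. w * (e ((1 / r) *\<^sub>R (z - s *\<^sub>R y)) * indicator A z) \<partial>lborel)" for y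
    by (rule trans[OF nn_integral_lborel_affine[OF r, of _ "s *\<^sub>R y"]]) (use r in \<open>simp_all add: w_def\<close>)
  have outer_affine: "(\<integral>\<^sup>+y. w * e ((1 / r) *\<^sub>R (y - s *\<^sub>R z)) \<partial>lborel) = 1" for z
    using nn_integral_lborel_affine[OF r e_meas, of "s *\<^sub>R z"] by (simp add: w_def e1)
  have "emeasure ?L A = (\<integral>\<^sup>+p. indicator A (r *\<^sub>R fst p + s *\<^sub>R snd p) \<partial>(gauss \<Otimes>\<^sub>M gauss))"
    by (simp add: nn_integral_distr case_prod_beta flip: nn_integral_indicator)
  also have "\<dots> = (\<integral>\<^sup>+y. \<integral>\<^sup>+x. indicator A (r *\<^sub>R x + s *\<^sub>R y) \<partial>gauss \<partial>gauss)"
    by (subst P.nn_integral_snd[symmetric]) simp_all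
  also have "\<dots> = (\<integral>\<^sup>+y. e y * (\<integral>\<^sup>+x. e x * indicator A (r *\<^sub>R x + s *\<^sub>R y) \<partial>lborel) \<partial>lborel)"
    by (simp add: nn_integral_gauss e_def)
  also have "\<dots> = (\<integral>\<^sup>+y. e y * (\<integral>\<^sup>+z. w * (e ((1 / r) *\<^sub>R (z - s *\<^sub>R y)) * indicator A z) \<partial>lborel) \<partial>lborel)"
    by (simp add: inner_affine)
  also have "\<dots> = (\<integral>\<^sup>+y. \<integral>\<^sup>+z. e y * (w * (e ((1 / r) *\<^sub>R (z - s *\<^sub>R y)) * indicator A z)) \<partial>lborel \<partial>lborel)"
    by (simp add: nn_integral_cmult)
  also have "\<dots> = (\<integral>\<^sup>+z. \<integral>\<^sup>+y. e y * (w * (e ((1 / r) *\<^sub>R (z - s *\<^sub>R y)) * indicator A z)) \<partial>lborel \<partial>lborel)"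
    by (rule lborel_pair.Fubini') simp
  also have "\<dots> = (\<integral>\<^sup>+z. \<integral>\<^sup>+y. (e z * indicator A z) * (w * e ((1 / r) *\<^sub>R (y - s *\<^sub>R z))) \<partial>lborel \<partial>lborel)"
  proof (intro nn_integral_cong)
    fix z y :: 'a
    have "e y * (w * (e ((1 / r) *\<^sub>R (z - s *\<^sub>R y)) * indicator A z)) = (e y * e ((1 / r) *\<^sub>R (z - s *\<^sub>R y))) * (w * indicator A z)"
      by (simp only: mult_ac)
    also have "\<dots> = e z * indicator A z * (w * e ((1 / r) *\<^sub>R (y - s *\<^sub>R z)))"
      by (subst key) (simp only: mult_ac)
    finally show "e y * (w * (e ((1 / r) *\<^sub>R (z - s *\<^sub>R y)) * indicator A z))
        = e z * indicator A z * (w * e ((1 / r) *\<^sub>R (y - s *\<^sub>R z)))" .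
  qed
  also have "\<dots> = (\<integral>\<^sup>+z. (e z * indicator A z) * (\<integral>\<^sup>+y. w * e ((1 / r) *\<^sub>R (y - s *\<^sub>R z)) \<partial>lborel) \<partial>lborel)"
    by (simp add: nn_integral_cmult)
  also have "\<dots> = (\<integral>\<^sup>+z. e z * indicator A z \<partial>lborel)"
    by (simp add: outer_affine)
  also have "\<dots> = emeasure gauss A"
    by (simp add: gauss_def emeasure_density e_def)
  finally show "emeasure ?L A = emeasure gauss A" .
qed simp

section \<open>Heat evolution of tame functions\<close>

text \<open>The parameter is the square root of the time.\<close>
definition heat :: "real \<Rightarrow> ('a::euclidean_space \<Rightarrow> 'b::{banach,second_countable_topology}) \<Rightarrow> 'a \<Rightarrow> 'b" where
  "heat r f x = (\<integral>y. f (x + r *\<^sub>R y) \<partial>gauss)"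

lemma heat_measurable [measurable]:
  assumes [measurable]: "f \<in> borel_measurable borel"
  shows "heat r f \<in> borel_measurable borel"
  unfolding heat_def by measurable

lemma gauss_integrable_bounded:
  fixes f :: "'a::euclidean_space \<Rightarrow> 'b::{banach,second_countable_topology}"
  assumes "f \<in> borel_measurable borel" "\<And>x. norm (f x) \<le> B"
  shows "integrable gauss f"
  using assms by (intro gauss.integrable_const_bound[of _ B]) auto

lemma gauss_integrable_range:
  fixes f :: "'a::euclidean_space \<Rightarrow> real"
  assumes "f \<in> borel_measurable borel" "\<And>x. f x \<in> {a..b}"
  shows "integrable gauss f"
proof (rule gauss_integrable_bounded[where B = "max \<bar>a\<bar> \<bar>b\<bar>"])
  fix x show "norm (f x) \<le> max \<bar>a\<bar> \<bar>b\<bar>" using assms(2)[of x] by auto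
qed (rule assms)

lemma heat_range:
  fixes f :: "'a::euclidean_space \<Rightarrow> real"
  assumes [measurable]: "f \<in> borel_measurable borel" and "\<And>x. f x \<in> {a..b}"
  shows "heat r f x \<in> {a..b}"
proof -
  have i: "integrable gauss (\<lambda>y. f (x + r *\<^sub>R y))"
    by (rule gauss_integrable_range[where a = a and b = b]) (use assms in auto)
  have "a \<le> heat r f x" "heat r f x \<le> b"
    unfolding heat_def
    by (rule gauss.integral_ge_const[OF i] gauss.integral_le_const[OF i]; use assms in auto)+
  then show ?thesis by simp
qed

text \<open>Semigroup law: times are squared parameters, and they add. Taking out the common factor
  \<open>t\<close> reduces it to \<open>gauss_add\<close>; boundedness of \<open>f\<close> serves
  Fubini.\<close>

lemma heat_heat:
  fixes f :: "'a::euclidean_space \<Rightarrow> real"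
  assumes [measurable]: "f \<in> borel_measurable borel" and ab: "\<And>x. f x \<in> {a..b}"
    and r: "0 < r"
  shows "heat r (heat s f) = heat (sqrt (r\<^sup>2 + s\<^sup>2)) f"
proof
  fix x
  interpret P: pair_prob_space "gauss :: 'a measure" "gauss :: 'a measure" ..
  define t where "t = sqrt (r\<^sup>2 + s\<^sup>2)"
  have t: "0 < t" "t\<^sup>2 = r\<^sup>2 + s\<^sup>2" using r unfolding t_def by (auto simp: add_pos_nonneg)
  have rs: "(r / t)\<^sup>2 + (s / t)\<^sup>2 = 1" "r / t \<noteq> 0" using t r by (auto simp: power_divide simp flip: add_divide_distrib)
  have "heat r (heat s f) x = (\<integral>y. \<integral>z. f (x + r *\<^sub>R y + s *\<^sub>R z) \<partial>gauss \<partial>gauss)"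
    by (simp add: heat_def)
  also have "\<dots> = (\<integral>p. f (x + r *\<^sub>R fst p + s *\<^sub>R snd p) \<partial>(gauss \<Otimes>\<^sub>M gauss))"
  proof (subst P.integral_fst'[symmetric])
    show "integrable (gauss \<Otimes>\<^sub>M gauss) (\<lambda>p. f (x + r *\<^sub>R fst p + s *\<^sub>R snd p))"
    proof (rule P.P.integrable_const_bound[where B = "max \<bar>a\<bar> \<bar>b\<bar>"])
      have "\<bar>f x\<bar> \<le> max \<bar>a\<bar> \<bar>b\<bar>" for x using ab[of x] by auto
      then show "AE p in gauss \<Otimes>\<^sub>M gauss. norm (f (x + r *\<^sub>R fst p + s *\<^sub>R snd p)) \<le> max \<bar>a\<bar> \<bar>b\<bar>" by simp
    qed simp
  qed simp
  also have "\<dots> = (\<integral>p. f (x + t *\<^sub>R (\<lambda>(y, z). (r / t) *\<^sub>R y + (s / t) *\<^sub>R z) p) \<partial>(gauss \<Otimes>\<^sub>M gauss))"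
    using t by (simp add: case_prod_beta algebra_simps)
  also have "\<dots> = (\<integral>y. f (x + t *\<^sub>R y) \<partial>distr (gauss \<Otimes>\<^sub>M gauss) borel (\<lambda>(y, z). (r / t) *\<^sub>R y + (s / t) *\<^sub>R z))"
    by (subst integral_distr) (simp_all add: case_prod_beta)
  also have "\<dots> = heat t f x"
    by (simp add: gauss_add[OF rs] heat_def)
  finally show "heat r (heat s f) x = heat (sqrt (r\<^sup>2 + s\<^sup>2)) f x" unfolding t_def .
qed

text \<open>The gradient is an explicit datum so that its measurability is available.\<close>
definition tame :: "real \<Rightarrow> real \<Rightarrow> real \<Rightarrow> real \<Rightarrow> ('a::euclidean_space \<Rightarrow> real) \<Rightarrow> ('a \<Rightarrow> 'a) \<Rightarrow> bool" where
  "tame a b L K f q \<longleftrightarrow> f \<in> borel_measurable borel \<and> q \<in> borel_measurable borel \<and>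
     (\<forall>x. f x \<in> {a..b}) \<and> (\<forall>x. norm (q x) \<le> L) \<and>
     (\<forall>x z. \<bar>f (x + z) - f x - q x \<bullet> z\<bar> \<le> K * (norm z)\<^sup>2)"

text \<open>Every clause of \<open>tame\<close> is a translation-invariant bound that survives
  averaging, so the constants do not deteriorate along the flow. This is what makes the error of a
  step uniform over the whole iteration.\<close>

lemma tame_heat:
  fixes f :: "'a::euclidean_space \<Rightarrow> real"
  assumes "tame a b L K f q"
  shows "tame a b L K (heat r f) (heat r q)"
proof -
  have [measurable]: "f \<in> borel_measurable borel" "q \<in> borel_measurable borel"
    and ab: "\<And>x. f x \<in> {a..b}" and L: "\<And>x. norm (q x) \<le> L"
    and K: "\<And>x z. \<bar>f (x + z) - f x - q x \<bullet> z\<bar> \<le> K * (norm z)\<^sup>2"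
    using assms unfolding tame_def by auto
  have fi: "integrable gauss (\<lambda>y. f (x + r *\<^sub>R y))" for x
    by (rule gauss_integrable_range[where a = a and b = b]) (use ab in auto)
  have qi: "integrable gauss (\<lambda>y. q (x + r *\<^sub>R y))" for x
    by (rule gauss_integrable_bounded[where B = L]) (use L in auto)
  have "norm (heat r q x) \<le> L" for x
  proof -
    have "norm (heat r q x) \<le> (\<integral>y. norm (q (x + r *\<^sub>R y)) \<partial>gauss)"
      unfolding heat_def by (rule integral_norm_bound)
    also have "\<dots> \<le> L"
      by (rule gauss.integral_le_const) (use qi L in auto)
    finally show ?thesis .
  qed
  moreover have "\<bar>heat r f (x + z) - heat r f x - heat r q x \<bullet> z\<bar> \<le> K * (norm z)\<^sup>2" for x z
  proof -
    have eq: "heat r f (x + z) - heat r f x - heat r q x \<bullet> z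
      = (\<integral>y. f (x + r *\<^sub>R y + z) - f (x + r *\<^sub>R y) - q (x + r *\<^sub>R y) \<bullet> z \<partial>gauss)"
      unfolding heat_def using fi[of "x + z"] fi[of x] qi[of x]
      by (simp add: add.assoc add.commute[of z])
    have "\<bar>heat r f (x + z) - heat r f x - heat r q x \<bullet> z\<bar>
        \<le> (\<integral>y. norm (f (x + r *\<^sub>R y + z) - f (x + r *\<^sub>R y) - q (x + r *\<^sub>R y) \<bullet> z) \<partial>gauss)"
      unfolding eq real_norm_def[symmetric] by (rule integral_norm_bound)
    also have "\<dots> \<le> K * (norm z)\<^sup>2"
    proof (rule gauss.integral_le_const)
      show "integrable gauss (\<lambda>y. norm (f (x + r *\<^sub>R y + z) - f (x + r *\<^sub>R y) - q (x + r *\<^sub>R y) \<bullet> z))"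
        using fi[of "x + z"] fi[of x] qi[of x]
        by (intro integrable_norm Bochner_Integration.integrable_diff) (simp_all add: algebra_simps)
    qed (use K in auto)
    finally show ?thesis .
  qed
  ultimately show ?thesis
    unfolding tame_def using heat_range[of f a b] ab by auto
qed

section \<open>Second-order estimates for one small step\<close>

lemma ln_ge_quadratic:
  fixes t :: real
  assumes "m \<le> t" "0 < m"
  shows "t - 1 - (t - 1)\<^sup>2 / m \<le> ln t"
proof -
  have "- ln t = ln (1 / t)" using assms by (simp add: ln_div)
  also have "\<dots> \<le> 1 / t - 1" using assms by (intro ln_le_minus_one) auto
  also have "\<dots> = (1 - t) + (t - 1)\<^sup>2 / t" using assms by (simp add: field_simps power2_eq_square)
  also have "\<dots> \<le> (1 - t) + (t - 1)\<^sup>2 / m" using assms by (intro add_left_mono divide_left_mono) auto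
  finally show ?thesis by simp
qed

lemma exp_le_quadratic:
  fixes s :: real
  shows "exp s - 1 - s \<le> s\<^sup>2 * exp \<bar>s\<bar>"
proof -
  have "exp s - 1 \<le> s * exp s"
  proof -
    have "1 + - s \<le> exp (- s)" by (rule exp_ge_add_one_self)
    then have "(1 - s) * exp s \<le> exp (- s) * exp s" by (intro mult_right_mono) auto
    then show ?thesis by (simp add: exp_minus algebra_simps)
  qed
  moreover have "s * (exp s - 1) \<le> s\<^sup>2 * exp \<bar>s\<bar>"
  proof (cases "0 \<le> s")
    case True
    have "s * (exp s - 1) \<le> s * (s * exp s)" using True calculation by (intro mult_left_mono)
    then show ?thesis using True by (simp add: power2_eq_square)
  next
    case False
    have "(- s) * (1 - exp s) \<le> (- s) * (- s)"
      using False exp_ge_add_one_self[of s] by (intro mult_left_mono) linarith+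
    also have "\<dots> \<le> s\<^sup>2 * exp \<bar>s\<bar>" by (simp add: power2_eq_square mult_le_cancel_left1)
    finally show ?thesis by (simp add: algebra_simps)
  qed
  ultimately show ?thesis by (simp add: algebra_simps)
qed

lemma abs_exp_remainder_le:
  fixes s :: real
  shows "\<bar>exp s - 1 - s\<bar> \<le> s\<^sup>2 * exp \<bar>s\<bar>"
  using exp_le_quadratic[of s] exp_ge_add_one_self[of s] by linarith

lemma tame_D:
  assumes "tame a b L K f q"
  shows "f \<in> borel_measurable borel" "q \<in> borel_measurable borel" "f x \<in> {a..b}" "norm (q x) \<le> L"
    "\<bar>f (x + z) - f x - q x \<bullet> z\<bar> \<le> K * (norm z)\<^sup>2"
  using assms unfolding tame_def by auto

text \<open>For \<open>norm z \<le> 1\<close> the quadratic error is at most linear, which gives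
  \<open>L + K\<close>; for longer \<open>z\<close> the oscillation \<open>b - a\<close> of
  \<open>f\<close> is enough. The constant simply adds up both cases.\<close>

lemma tame_lipschitz:
  fixes f :: "'a::euclidean_space \<Rightarrow> real"
  assumes t: "tame a b L K f q" and K: "0 \<le> K"
  shows "\<bar>f (x + z) - f x\<bar> \<le> (L + K + b - a) * norm z"
proof -
  define M where "M = L + K + b - a"
  have fx: "f x \<in> {a..b}" "f (x + z) \<in> {a..b}" and L: "norm (q x) \<le> L" "0 \<le> L"
    using tame_D[OF t] norm_ge_zero[of "q x"] order_trans by blast+
  have "\<bar>f (x + z) - f x\<bar> \<le> M * norm z"
  proof (cases "norm z \<le> 1")
    case True
    have "\<bar>q x \<bullet> z\<bar> \<le> L * norm z"
      using Cauchy_Schwarz_ineq2[of "q x" z] mult_right_mono[OF L(1), of "norm z"] by auto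
    moreover have "K * (norm z)\<^sup>2 \<le> K * norm z"
      using True K by (intro mult_left_mono) (auto simp: power2_eq_square mult_le_cancel_left1 mult_left_le)
    ultimately have "\<bar>f (x + z) - f x\<bar> \<le> (L + K) * norm z"
      using tame_D(5)[OF t, of x z] by (simp add: algebra_simps)
    also have "\<dots> \<le> M * norm z" unfolding M_def using fx by (intro mult_right_mono) auto
    finally show ?thesis .
  next
    case False
    have "\<bar>f (x + z) - f x\<bar> \<le> M * 1" using fx K L unfolding M_def by auto
    also have "\<dots> \<le> M * norm z" using False fx K L unfolding M_def by (intro mult_left_mono) auto
    finally show ?thesis .
  qed
  then show ?thesis unfolding M_def .
qed

text \<open>With \<open>\<rho> = f (x + z) / f x\<close>, linearising \<open>f\<close> costs
  \<open>K / a\<close>. Replacing \<open>ln \<rho>\<close> by \<open>\<rho> - 1\<close> costs at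
  most \<open>(\<rho> - 1)\<^sup>2 / (a / b)\<close>, because \<open>\<rho>\<close> is at least
  \<open>a / b\<close>; the Lipschitz bound makes this quadratic in \<open>z\<close>.\<close>

lemma tame_ln:
  fixes f :: "'a::euclidean_space \<Rightarrow> real"
  assumes t: "tame a b L K f q" and a: "0 < a" and K: "0 \<le> K"
  shows "\<bar>ln (f (x + z)) - ln (f x) - (q x /\<^sub>R f x) \<bullet> z\<bar> \<le> (K / a + (L + K + b - a)\<^sup>2 / a\<^sup>2 * b / a) * (norm z)\<^sup>2"
proof -
  define \<rho> where "\<rho> = f (x + z) / f x"
  define M where "M = L + K + b - a"
  have fx: "f x \<in> {a..b}" "f (x + z) \<in> {a..b}" and L: "norm (q x) \<le> L" "0 \<le> L"
    using tame_D[OF t] norm_ge_zero[of "q x"] order_trans by blast+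
  have pos: "0 < f x" "0 < f (x + z)" "0 < b" using fx a by auto
  have ln_eq: "ln (f (x + z)) - ln (f x) = ln \<rho>" unfolding \<rho>_def using pos by (simp add: ln_div)
  have \<rho>: "a / b \<le> \<rho>" unfolding \<rho>_def using fx a pos by (intro frac_le) auto
  have first: "\<bar>\<rho> - 1 - (q x /\<^sub>R f x) \<bullet> z\<bar> \<le> K / a * (norm z)\<^sup>2"
  proof -
    have "\<rho> - 1 - (q x /\<^sub>R f x) \<bullet> z = (f (x + z) - f x - q x \<bullet> z) / f x"
      unfolding \<rho>_def using pos by (simp add: field_simps)
    also have "\<bar>\<dots>\<bar> \<le> (K * (norm z)\<^sup>2) / a"
      unfolding abs_divide using fx a tame_D(5)[OF t, of x z] K by (intro frac_le) auto
    finally show ?thesis by simp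
  qed
  have lip: "\<bar>f (x + z) - f x\<bar> \<le> M * norm z"
    unfolding M_def by (rule tame_lipschitz[OF t K])
  have second: "(\<rho> - 1)\<^sup>2 / (a / b) \<le> M\<^sup>2 / a\<^sup>2 * b / a * (norm z)\<^sup>2"
  proof -
    have "\<rho> - 1 = (f (x + z) - f x) / f x" unfolding \<rho>_def using pos by (simp add: field_simps)
    also have "\<bar>\<dots>\<bar> \<le> (M * norm z) / a"
      unfolding abs_divide using fx a lip by (intro frac_le) auto
    finally have "(\<rho> - 1)\<^sup>2 \<le> ((M * norm z) / a)\<^sup>2"
      by (metis abs_ge_zero power2_abs power_mono)
    then have "(\<rho> - 1)\<^sup>2 / (a / b) \<le> ((M * norm z) / a)\<^sup>2 / (a / b)"
      using a pos by (intro divide_right_mono) auto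
    then show ?thesis by (simp add: power_mult_distrib power_divide field_simps)
  qed
  have "ln \<rho> \<le> \<rho> - 1" using pos unfolding \<rho>_def by (intro ln_le_minus_one) auto
  moreover have "\<rho> - 1 - (\<rho> - 1)\<^sup>2 / (a / b) \<le> ln \<rho>"
    using \<rho> a pos by (intro ln_ge_quadratic) auto
  moreover have "0 \<le> M\<^sup>2 / a\<^sup>2 * b / a * (norm z)\<^sup>2"
    using a pos by simp
  ultimately show ?thesis
    unfolding ln_eq distrib_right M_def[symmetric] using first second by linarith
qed

lemma integrable_gauss_exp_inner:
  "integrable gauss (\<lambda>y::'a::euclidean_space. exp (- (2 * pi * (y \<bullet> v)) - pi * (norm v)\<^sup>2))"
proof (rule Bochner_Integration.integrable_bound[OF integrable_gauss_exp_norm[of "2 * pi * norm v"]])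
  have "- (2 * pi * (y \<bullet> v)) - pi * (norm v)\<^sup>2 \<le> 2 * pi * (norm v * norm y)" for y :: 'a
  proof -
    have "- (y \<bullet> v) \<le> norm v * norm y"
      using Cauchy_Schwarz_ineq2[of y v] by (simp add: mult.commute)
    then have "2 * pi * - (y \<bullet> v) \<le> 2 * pi * (norm v * norm y)"
      by (intro mult_left_mono) auto
    moreover have "0 \<le> pi * (norm v)\<^sup>2" by simp
    ultimately show ?thesis by linarith
  qed
  then show "AE y in gauss. norm (exp (- (2 * pi * ((y::'a) \<bullet> v)) - pi * (norm v)\<^sup>2)) \<le> norm (exp (2 * pi * norm v * norm y))"
    by (simp add: mult.assoc)
qed simp

lemma integrable_gauss_inner: "integrable gauss (\<lambda>y::'a::euclidean_space. y \<bullet> v)"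
proof (rule Bochner_Integration.integrable_bound)
  show "integrable gauss (\<lambda>y::'a. norm v * ((norm y + 0) ^ 1 * exp (0 * norm y)))"
    by (intro integrable_mult_right integrable_gauss_poly_exp_norm) simp
  show "AE y in gauss. norm ((y::'a) \<bullet> v) \<le> norm (norm v * ((norm y + 0) ^ 1 * exp (0 * norm y)))"
    using Cauchy_Schwarz_ineq2[of _ v] by (auto simp: abs_mult mult.commute)
qed simp

lemma gauss_integrable_exp_inner_mult:
  fixes f :: "'a::euclidean_space \<Rightarrow> real"
  assumes [measurable]: "f \<in> borel_measurable borel" and ab: "\<And>x. \<bar>f x\<bar> \<le> b"
  shows "integrable gauss (\<lambda>y. exp (- (2 * pi * (y \<bullet> v)) - pi * (norm v)\<^sup>2) * f y)"
proof (rule Bochner_Integration.integrable_bound)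
  show "integrable gauss (\<lambda>y::'a. b * exp (- (2 * pi * (y \<bullet> v)) - pi * (norm v)\<^sup>2))"
    by (intro integrable_mult_right integrable_gauss_exp_inner)
  show "AE y in gauss. norm (exp (- (2 * pi * (y \<bullet> v)) - pi * (norm v)\<^sup>2) * f y) \<le>
      norm (b * exp (- (2 * pi * (y \<bullet> v)) - pi * (norm v)\<^sup>2))"
  proof (rule AE_I2)
    fix y
    have "\<bar>f y\<bar> \<le> \<bar>b\<bar>" using ab[of y] by linarith
    then show "norm (exp (- (2 * pi * (y \<bullet> v)) - pi * (norm v)\<^sup>2) * f y) \<le>
      norm (b * exp (- (2 * pi * (y \<bullet> v)) - pi * (norm v)\<^sup>2))"
      by (simp add: abs_mult mult.commute)
  qed
qed simp

text \<open>The easy half of the Gibbs variational principle: the exponent of the translated Gaussian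
  density is the entropic cost of the translation by \<open>v\<close>.\<close>
lemma heat_ln_le_ln_heat:
  fixes f :: "'a::euclidean_space \<Rightarrow> real"
  assumes [measurable]: "f \<in> borel_measurable borel" and ab: "\<And>x. f x \<in> {a..b}" and a: "0 < a"
  shows "heat r (\<lambda>x. ln (f x)) (x + r *\<^sub>R v) - pi * (norm v)\<^sup>2 \<le> ln (heat r f x)"
proof -
  define m where "m = heat r f x"
  define X where "X y = exp (- (2 * pi * (y \<bullet> v)) - pi * (norm v)\<^sup>2) * f (x + r *\<^sub>R (y + v))" for y
  have fpos: "0 < f y" for y using ab[of y] a by auto
  have m: "0 < m" using heat_range[of f a b r x] ab a unfolding m_def by auto
  have X_int: "integrable gauss X" unfolding X_def
  proof (rule gauss_integrable_exp_inner_mult)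
    show "\<bar>f (x + r *\<^sub>R (y + v))\<bar> \<le> b" for y using ab[of "x + r *\<^sub>R (y + v)"] a by auto
  qed simp
  have EX: "(\<integral>y. X y \<partial>gauss) = m"
    unfolding X_def m_def heat_def
    using integral_gauss_shift[of "\<lambda>y. f (x + r *\<^sub>R y)" v] by simp
  have lnf_int: "integrable gauss (\<lambda>y. ln (f (x + r *\<^sub>R (y + v))))"
  proof (rule gauss_integrable_range[where a = "ln a" and b = "ln b"])
    show "ln (f (x + r *\<^sub>R (y + v))) \<in> {ln a..ln b}" for y
      using ab[of "x + r *\<^sub>R (y + v)"] a by auto
  qed simp
  have "heat r (\<lambda>x. ln (f x)) (x + r *\<^sub>R v) = (\<integral>y. ln (f (x + r *\<^sub>R (y + v))) \<partial>gauss)"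
    unfolding heat_def by (simp add: algebra_simps)
  then have "heat r (\<lambda>x. ln (f x)) (x + r *\<^sub>R v) - pi * (norm v)\<^sup>2 - ln m
      = (\<integral>y. ln (f (x + r *\<^sub>R (y + v))) - 2 * pi * (y \<bullet> v) - pi * (norm v)\<^sup>2 - ln m \<partial>gauss)"
    using lnf_int integrable_gauss_inner[of v] integral_gauss_inner[of v] by simp
  \<comment> \<open>Jensen in the form \<open>ln t \<le> t - 1\<close>, applied to
    \<open>X y / m\<close>. By Cameron-Martin this quotient has mean 1, so the right side integrates
    to 0; on the left the term \<open>y \<bullet> v\<close> has mean 0.\<close>
  also have "\<dots> \<le> (\<integral>y. X y / m - 1 \<partial>gauss)"
  proof (rule integral_mono)
    fix y
    have "ln (X y / m) \<le> X y / m - 1"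
      using m fpos by (intro ln_le_minus_one) (auto simp: X_def)
    then show "ln (f (x + r *\<^sub>R (y + v))) - 2 * pi * (y \<bullet> v) - pi * (norm v)\<^sup>2 - ln m \<le> X y / m - 1"
      using m fpos[of "x + r *\<^sub>R (y + v)"] by (simp add: X_def ln_div ln_mult)
  qed (use lnf_int integrable_gauss_inner[of v] X_int in auto)
  also have "\<dots> = 0" using X_int EX m by simp
  finally show ?thesis unfolding m_def by simp
qed

text \<open>The choice of translation makes the linear term of \<open>ln f\<close> cancel exactly, so that only the
  quadratic remainder contributes to the error.\<close>
lemma ln_heat_le_tame:
  assumes a: "0 < a" and K: "0 \<le> K"
  shows "\<exists>C\<ge>0. \<forall>(f :: 'a::euclidean_space \<Rightarrow> real) q x r. tame a b L K f q \<longrightarrow> 0 < r \<longrightarrow> r \<le> 1 \<longrightarrow>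
    ln (heat r f x) \<le> heat r (\<lambda>x. ln (f x)) (x + r *\<^sub>R ((r / (2 * pi * f x)) *\<^sub>R q x))
      - pi * (norm ((r / (2 * pi * f x)) *\<^sub>R q x))\<^sup>2 + C * r ^ 4"
proof (intro exI conjI allI impI)
  define D where "D = K / a + (L + K + b - a)\<^sup>2 / a\<^sup>2 * b / a"
  \<comment> \<open>\<open>l\<close> bounds the gradient of \<open>ln f\<close>. The
    \<open>max\<close> makes it nonnegative before any tame function, which would force
    \<open>0 \<le> L\<close>, has been fixed.\<close>
  define l where "l = max 0 (L / a)"
  define B where "B = ln b - ln a"
  define C where "C = D\<^sup>2 * exp (B + l\<^sup>2) * (\<integral>y. (norm y + l) ^ 4 * exp (l * norm y) \<partial>(gauss :: 'a measure))"
  show "0 \<le> C" unfolding C_def l_def by (intro mult_nonneg_nonneg Bochner_Integration.integral_nonneg) auto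
  fix f :: "'a \<Rightarrow> real" and q x r
  assume t: "tame a b L K f q" and r: "0 < r" "r \<le> (1::real)"
  have [measurable]: "f \<in> borel_measurable borel" using tame_D[OF t] by blast
  have ab: "f y \<in> {a..b}" for y using tame_D[OF t] by blast
  have fpos: "0 < f y" for y using ab[of y] a by auto
  have L: "0 \<le> L" "norm (q x) \<le> L" using tame_D[OF t] norm_ge_zero[of "q x"] order_trans by blast+
  have l: "0 \<le> l" "l = L / a" using a L unfolding l_def by auto
  \<comment> \<open>With \<open>p\<close> the gradient of \<open>ln f\<close> at \<open>x\<close>,
    \<open>v\<close> solves \<open>r *\<^sub>R p = (2 * pi) *\<^sub>R v\<close>. Then the linear
    term of \<open>ln f\<close> at displacement \<open>r *\<^sub>R (y + v)\<close> equals
    \<open>2 * pi * (v \<bullet> (y + v))\<close>, and its part in \<open>y\<close> is opposite to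
    that in the exponent of the Cameron-Martin weight.\<close>
  define v where "v = (r / (2 * pi * f x)) *\<^sub>R q x"
  define p where "p = q x /\<^sub>R f x"
  have rp: "r *\<^sub>R p = (2 * pi) *\<^sub>R v" unfolding p_def v_def using fpos[of x] by (simp add: field_simps)
  have norm_p: "norm p \<le> l"
    unfolding p_def l norm_scaleR using L fpos[of x] ab[of x] a by (simp add: frac_le field_simps)
      (metis ab atLeastAtMost_iff mult_mono norm_ge_zero less_imp_le mult.commute)
  have norm_v: "norm v \<le> l"
  proof -
    have "2 * pi * norm v = r * norm p"
      using arg_cong[OF rp, of norm] r by simp
    also have "\<dots> \<le> 1 * l" using r norm_p by (intro mult_mono) auto
    finally have "2 * pi * norm v \<le> l" by simp
    moreover have "1 * norm v \<le> 2 * pi * norm v" using pi_gt3 by (intro mult_right_mono) auto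
    ultimately show ?thesis by simp
  qed
  define R where "R z = ln (f (x + z)) - ln (f x) - p \<bullet> z" for z
  have [measurable]: "R \<in> borel_measurable borel" unfolding R_def by measurable
  have R1: "\<bar>R z\<bar> \<le> D * (norm z)\<^sup>2" for z
    unfolding R_def D_def p_def using tame_ln[OF t a K] by blast
  \<comment> \<open>The bound \<open>R1\<close> cannot be used inside an exponential, since
    \<open>exp (D * (norm z)\<^sup>2)\<close> need not be Gaussian integrable. So
    \<open>S_bound\<close> takes the square of \<open>S\<close> from \<open>R1\<close>, which yields
    \<open>r ^ 4\<close>, and \<open>exp \<bar>S y\<bar>\<close> from this linear bound.\<close>
  have R2: "\<bar>R z\<bar> \<le> B + l * norm z" for z
  proof -
    have "ln a \<le> ln (f y)" "ln (f y) \<le> ln b" for y using ab[of y] a by auto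
    then have "\<bar>ln (f (x + z)) - ln (f x)\<bar> \<le> B" unfolding B_def by (smt (verit))
    moreover have "\<bar>p \<bullet> z\<bar> \<le> l * norm z"
      using Cauchy_Schwarz_ineq2[of p z] mult_right_mono[OF norm_p, of "norm z"] by auto
    ultimately show ?thesis unfolding R_def by linarith
  qed
  define S where "S y = R (r *\<^sub>R (y + v))" for y
  have [measurable]: "S \<in> borel_measurable borel" unfolding S_def by measurable
  define W where "W y = D\<^sup>2 * exp (B + l\<^sup>2) * ((norm y + l) ^ 4 * exp (l * norm y))" for y :: 'a
  have W_int: "integrable gauss W" unfolding W_def
    by (intro integrable_mult_right integrable_gauss_poly_exp_norm) (rule l)
  have W_eq: "(\<integral>y. W y \<partial>gauss) = C" unfolding W_def C_def by simp
  have norm_ryv: "norm (r *\<^sub>R (y + v)) \<le> r * (norm y + l)" for y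
    using norm_triangle_ineq[of y v] norm_v r by (auto intro!: mult_left_mono)
  have S_bound: "(S y)\<^sup>2 * exp \<bar>S y\<bar> \<le> r ^ 4 * W y" for y
  proof -
    have "\<bar>S y\<bar> \<le> D * (r * (norm y + l))\<^sup>2"
    proof -
      have "D \<ge> 0" unfolding D_def using a K ab[of x] by (intro add_nonneg_nonneg) auto
      then have "D * (norm (r *\<^sub>R (y + v)))\<^sup>2 \<le> D * (r * (norm y + l))\<^sup>2"
        using norm_ryv[of y] by (intro mult_left_mono power_mono) auto
      then show ?thesis using R1[of "r *\<^sub>R (y + v)"] unfolding S_def by linarith
    qed
    then have "\<bar>S y\<bar>\<^sup>2 \<le> (D * (r * (norm y + l))\<^sup>2)\<^sup>2" by (intro power_mono) auto
    then have 1: "(S y)\<^sup>2 \<le> r ^ 4 * (D\<^sup>2 * (norm y + l) ^ 4)"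
      by (simp add: power_mult_distrib mult_ac)
    have "\<bar>S y\<bar> \<le> B + l * norm (r *\<^sub>R (y + v))" unfolding S_def by (rule R2)
    also have "\<dots> \<le> B + l * (1 * (norm y + l))"
      using order_trans[OF norm_ryv[of y] mult_right_mono[of r 1 "norm y + l"]] l r
      by (intro add_left_mono mult_left_mono) auto
    finally have "exp \<bar>S y\<bar> \<le> exp (B + l\<^sup>2) * exp (l * norm y)"
      by (simp add: power2_eq_square algebra_simps flip: exp_add)
    then have "(S y)\<^sup>2 * exp \<bar>S y\<bar> \<le> (r ^ 4 * (D\<^sup>2 * (norm y + l) ^ 4)) * (exp (B + l\<^sup>2) * exp (l * norm y))"
      using 1 by (intro mult_mono) auto
    then show ?thesis unfolding W_def by (simp add: algebra_simps)
  qed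
  have lnf_int: "integrable gauss (\<lambda>y. ln (f (x + r *\<^sub>R (y + v))))"
  proof (rule gauss_integrable_range[where a = "ln a" and b = "ln b"])
    show "ln (f (x + r *\<^sub>R (y + v))) \<in> {ln a..ln b}" for y
      using ab[of "x + r *\<^sub>R (y + v)"] a by auto
  qed simp
  have S_eq: "S y = ln (f (x + r *\<^sub>R (y + v))) - ln (f x) - 2 * pi * (y \<bullet> v) - 2 * pi * (norm v)\<^sup>2" for y
  proof -
    have "p \<bullet> (r *\<^sub>R (y + v)) = (r *\<^sub>R p) \<bullet> (y + v)" by simp
    also have "\<dots> = 2 * pi * (y \<bullet> v) + 2 * pi * (norm v)\<^sup>2"
      unfolding rp by (simp add: power2_norm_eq_inner inner_simps inner_commute algebra_simps)
    finally show ?thesis unfolding S_def R_def by simp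
  qed
  have S_int: "integrable gauss S" unfolding S_eq
    using lnf_int integrable_gauss_inner[of v] by auto
  have ES: "(\<integral>y. S y \<partial>gauss) = heat r (\<lambda>x. ln (f x)) (x + r *\<^sub>R v) - ln (f x) - 2 * pi * (norm v)\<^sup>2"
  proof -
    have "heat r (\<lambda>x. ln (f x)) (x + r *\<^sub>R v) = (\<integral>y. ln (f (x + r *\<^sub>R (y + v))) \<partial>gauss)"
      unfolding heat_def by (simp add: algebra_simps)
    then show ?thesis unfolding S_eq
      using lnf_int integrable_gauss_inner[of v] integral_gauss_inner[of v] by simp
  qed
  define X where "X y = exp (- (2 * pi * (y \<bullet> v)) - pi * (norm v)\<^sup>2) * f (x + r *\<^sub>R (y + v))" for y
  have X_int: "integrable gauss X" unfolding X_def
  proof (rule gauss_integrable_exp_inner_mult)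
    show "\<bar>f (x + r *\<^sub>R (y + v))\<bar> \<le> b" for y using ab[of "x + r *\<^sub>R (y + v)"] a by auto
  qed simp
  have EX: "(\<integral>y. X y \<partial>gauss) = heat r f x"
    unfolding X_def heat_def
    using integral_gauss_shift[of "\<lambda>y. f (x + r *\<^sub>R y)" v] by simp
  \<comment> \<open>The cancellation itself: the weight times the translated function is a constant
    times \<open>exp (S y)\<close>, with \<open>S\<close> the pure remainder. It remains to bound
    the mean of \<open>exp (S y)\<close> by \<open>1 + S y\<close> plus a term of order
    \<open>r ^ 4\<close>.\<close>
  have X_eq: "X y = f x * exp (pi * (norm v)\<^sup>2) * exp (S y)" for y
  proof -
    have "f (x + r *\<^sub>R (y + v)) = exp (S y + ln (f x) + 2 * pi * (y \<bullet> v) + 2 * pi * (norm v)\<^sup>2)"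
      unfolding S_eq using fpos by simp
    then have "X y = exp (ln (f x)) * (exp (pi * (norm v)\<^sup>2) * exp (S y))"
      unfolding X_def by (simp flip: exp_add)
    then show ?thesis using fpos by simp
  qed
  have c_pos: "0 < f x * exp (pi * (norm v)\<^sup>2)" using fpos by simp
  have expS_int: "integrable gauss (\<lambda>y. exp (S y))"
  proof -
    have "(\<lambda>y. exp (S y)) = (\<lambda>y. X y / (f x * exp (pi * (norm v)\<^sup>2)))"
      using c_pos fpos[of x] by (auto simp: X_eq fun_eq_iff)
    then show ?thesis using X_int by simp
  qed
  have expS_le: "(\<integral>y. exp (S y) \<partial>gauss) \<le> (\<integral>y. 1 + S y + r ^ 4 * W y \<partial>gauss)"
  proof (rule integral_mono)
    show "exp (S y) \<le> 1 + S y + r ^ 4 * W y" for y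
      using exp_le_quadratic[of "S y"] S_bound[of y] by linarith
  qed (use expS_int S_int W_int in auto)
  also have "\<dots> = 1 + (\<integral>y. S y \<partial>gauss) + r ^ 4 * C"
    using S_int W_int gauss.prob_space by (simp add: W_eq)
  finally have le: "(\<integral>y. exp (S y) \<partial>gauss) - 1 \<le> (\<integral>y. S y \<partial>gauss) + r ^ 4 * C" by simp
  have heat_eq: "heat r f x = f x * exp (pi * (norm v)\<^sup>2) * (\<integral>y. exp (S y) \<partial>gauss)"
    unfolding EX[symmetric] X_eq by simp
  have "0 < heat r f x" using heat_range[of f a b r x] ab a by auto
  then have pos: "0 < (\<integral>y. exp (S y) \<partial>gauss)"
    unfolding heat_eq using c_pos by (simp add: zero_less_mult_iff)
  have "ln (heat r f x) = ln (f x) + pi * (norm v)\<^sup>2 + ln (\<integral>y. exp (S y) \<partial>gauss)"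
    unfolding heat_eq using fpos[of x] pos by (simp add: ln_mult)
  also have "ln (\<integral>y. exp (S y) \<partial>gauss) \<le> (\<integral>y. S y \<partial>gauss) + r ^ 4 * C"
    using ln_le_minus_one[OF pos] le by linarith
  finally have "ln (heat r f x) \<le> heat r (\<lambda>x. ln (f x)) (x + r *\<^sub>R v) - pi * (norm v)\<^sup>2 + C * r ^ 4"
    unfolding ES by (simp add: algebra_simps)
  then show "ln (heat r f x) \<le> heat r (\<lambda>x. ln (f x)) (x + r *\<^sub>R ((r / (2 * pi * f x)) *\<^sub>R q x))
      - pi * (norm ((r / (2 * pi * f x)) *\<^sub>R q x))\<^sup>2 + C * r ^ 4"
    unfolding v_def .
qed

section \<open>Preservation of the inequality by the heat flow\<close>

text \<open>For a linear projection \<open>Q\<close> this says that \<open>f\<close> equals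
  \<open>f\<close> composed with \<open>Q\<close>. The base point \<open>x\<close> absorbs
  translations, so the property passes directly through the averages in \<open>heat\<close>.\<close>

definition invariant :: "('a::euclidean_space \<Rightarrow> 'a) \<Rightarrow> ('a \<Rightarrow> 'b) \<Rightarrow> bool" where
  "invariant Q f \<longleftrightarrow> (\<forall>x y. f (x + Q y) = f (x + y))"

lemma invariant_heat:
  assumes "invariant Q f"
  shows "invariant Q (heat r f)"
proof -
  have "f (x + Q y + r *\<^sub>R z) = f (x + y + r *\<^sub>R z)" for x y z
  proof -
    have "f ((x + r *\<^sub>R z) + Q y) = f ((x + r *\<^sub>R z) + y)"
      using assms unfolding invariant_def by blast
    then show ?thesis by (simp only: add_ac)
  qed
  then show ?thesis unfolding invariant_def heat_def by simp
qed

lemma invariant_comp: "invariant Q f \<Longrightarrow> invariant Q (\<lambda>x. h (f x))"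
  unfolding invariant_def by simp

text \<open>The datum \<open>q\<close> may have components that \<open>f\<close> does not see.
  Replacing \<open>z\<close> by \<open>Q z\<close> in the Taylor bound and moving \<open>Q\<close>
  to the gradient by self-adjointness removes them; the translations in a heat step then have the
  form \<open>Q i w\<close>.\<close>

lemma tame_project:
  assumes t: "tame a b L K f q" and inv: "invariant Q f" and K: "0 \<le> K"
    and lin: "linear Q" and le: "\<And>x. norm (Q x) \<le> norm x" and adj: "\<And>x y. Q x \<bullet> y = x \<bullet> Q y"
  shows "tame a b L K f (\<lambda>x. Q (q x))"
proof -
  have Q[measurable]: "Q \<in> borel_measurable borel"
    using lin by (simp add: borel_measurable_continuous_onI linear_continuous_on linear_linear)
  have [measurable]: "q \<in> borel_measurable borel" using tame_D[OF t] by blast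
  have "\<bar>f (x + z) - f x - Q (q x) \<bullet> z\<bar> \<le> K * (norm z)\<^sup>2" for x z
  proof -
    have "\<bar>f (x + z) - f x - Q (q x) \<bullet> z\<bar> = \<bar>f (x + Q z) - f x - q x \<bullet> Q z\<bar>"
      using inv unfolding invariant_def by (simp add: adj)
    also have "\<dots> \<le> K * (norm (Q z))\<^sup>2" using tame_D[OF t] by blast
    also have "\<dots> \<le> K * (norm z)\<^sup>2" using K le by (intro mult_left_mono power_mono) auto
    finally show ?thesis .
  qed
  moreover have "norm (Q (q x)) \<le> L" for x using le tame_D(4)[OF t] order_trans by blast
  ultimately show ?thesis using t unfolding tame_def by simp
qed

text \<open>\<open>Q i\<close> and \<open>R j\<close> stand for the projections \<open>U\<^sub>i\<^sup>* U\<^sub>i\<close> and \<open>V\<^sub>j\<^sup>* V\<^sub>j\<close>; functions factoring through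
  \<open>U\<^sub>i\<close> are those invariant under \<open>Q i\<close>.\<close>
locale projection_datum =
  fixes I :: "'i set" and J :: "'j set" and c :: "'i \<Rightarrow> real" and d :: "'j \<Rightarrow> real"
    and Q :: "'i \<Rightarrow> 'a::euclidean_space \<Rightarrow> 'a" and R :: "'j \<Rightarrow> 'a \<Rightarrow> 'a"
  assumes finite_I: "finite I" and finite_J: "finite J"
    and c_pos: "i \<in> I \<Longrightarrow> 0 < c i" and d_pos: "j \<in> J \<Longrightarrow> 0 < d j"
    and Q_linear: "i \<in> I \<Longrightarrow> linear (Q i)" and R_linear: "j \<in> J \<Longrightarrow> linear (R j)"
    and Q_le: "i \<in> I \<Longrightarrow> norm (Q i x) \<le> norm x"
    and Q_adj: "i \<in> I \<Longrightarrow> Q i x \<bullet> y = x \<bullet> Q i y"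
    and frame: "(\<Sum>i\<in>I. c i * (norm (Q i x))\<^sup>2) = (\<Sum>j\<in>J. d j * (norm (R j x))\<^sup>2)"
    and joint_surj: "\<exists>w. \<forall>i\<in>I. Q i w = Q i (u i)"
begin

text \<open>All averages of logarithms are compared around the common point
  \<open>x + r *\<^sub>R w\<close>: by invariance, translating by \<open>Q i w\<close> or
  \<open>R j w\<close> has the same effect as translating by \<open>w\<close>. There the pointwise
  hypothesis can be integrated, and \<open>frame\<close> balances the costs. \<open>C\<close> is
  chosen before the functions and \<open>e\<close> carries the earlier errors, so the step can be
  repeated.\<close>

lemma heat_step:
  assumes a: "0 < a" and K: "0 \<le> K"
  shows "\<exists>C\<ge>0. \<forall>f g r e. (\<forall>i\<in>I. (\<exists>q. tame a b L K (f i) q) \<and> invariant (Q i) (f i)) \<longrightarrow>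
    (\<forall>j\<in>J. g j \<in> borel_measurable borel \<and> (\<forall>x. g j x \<in> {a..b}) \<and> invariant (R j) (g j)) \<longrightarrow>
    (\<forall>x. (\<Sum>i\<in>I. c i * ln (f i x)) \<le> (\<Sum>j\<in>J. d j * ln (g j x)) + e) \<longrightarrow> 0 < r \<longrightarrow> r \<le> 1 \<longrightarrow>
    (\<forall>x. (\<Sum>i\<in>I. c i * ln (heat r (f i) x)) \<le> (\<Sum>j\<in>J. d j * ln (heat r (g j) x)) + (e + C * r ^ 4))"
proof -
  obtain C where C: "0 \<le> C" and upper: "\<And>(f :: 'a \<Rightarrow> real) q x r. tame a b L K f q \<Longrightarrow> 0 < r \<Longrightarrow> r \<le> 1 \<Longrightarrow>
    ln (heat r f x) \<le> heat r (\<lambda>x. ln (f x)) (x + r *\<^sub>R ((r / (2 * pi * f x)) *\<^sub>R q x))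
      - pi * (norm ((r / (2 * pi * f x)) *\<^sub>R q x))\<^sup>2 + C * r ^ 4"
    using ln_heat_le_tame[OF a K, of b L] by blast
  have sum_pos: "0 \<le> sum c I" using c_pos by (intro sum_nonneg) (simp add: less_imp_le)
  show ?thesis
  proof (intro exI[of _ "sum c I * C"] conjI allI impI)
    show "0 \<le> sum c I * C" using C sum_pos by simp
    fix f :: "'i \<Rightarrow> 'a \<Rightarrow> real" and g :: "'j \<Rightarrow> 'a \<Rightarrow> real" and r e :: real and x
    assume f: "\<forall>i\<in>I. (\<exists>q. tame a b L K (f i) q) \<and> invariant (Q i) (f i)"
      and g: "\<forall>j\<in>J. g j \<in> borel_measurable borel \<and> (\<forall>x. g j x \<in> {a..b}) \<and> invariant (R j) (g j)"
      and le: "\<forall>x. (\<Sum>i\<in>I. c i * ln (f i x)) \<le> (\<Sum>j\<in>J. d j * ln (g j x)) + e"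
      and r: "0 < r" "r \<le> 1"
    obtain q where q: "\<And>i. i \<in> I \<Longrightarrow> tame a b L K (f i) (q i)" using f by metis
    have qQ: "tame a b L K (f i) (\<lambda>x. Q i (q i x))" if "i \<in> I" for i
      using tame_project[OF q[OF that] _ K] f that Q_linear Q_le Q_adj by blast
    obtain w where w: "\<And>i. i \<in> I \<Longrightarrow> Q i w = Q i ((r / (2 * pi * f i x)) *\<^sub>R q i x)"
      using joint_surj[of "\<lambda>i. (r / (2 * pi * f i x)) *\<^sub>R q i x"] by blast
    have Qw: "(r / (2 * pi * f i x)) *\<^sub>R Q i (q i x) = Q i w" if "i \<in> I" for i
      using w[OF that] Q_linear[OF that] by (simp add: linear_cmul)
    have shift: "heat r h (x + r *\<^sub>R P w) = heat r h (x + r *\<^sub>R w)"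
      if "invariant P h" "linear P" for P and h :: "'a \<Rightarrow> real"
      using invariant_heat[OF that(1), of r] that(2) unfolding invariant_def
      by (metis linear_cmul)
    have f_int: "integrable gauss (\<lambda>y. ln (f i (z + r *\<^sub>R y)))" if "i \<in> I" for i z
    proof (rule gauss_integrable_range[where a = "ln a" and b = "ln b"])
      have [measurable]: "f i \<in> borel_measurable borel" using tame_D[OF q[OF that]] by blast
      show "(\<lambda>y. ln (f i (z + r *\<^sub>R y))) \<in> borel_measurable borel" by simp
      show "ln (f i (z + r *\<^sub>R y)) \<in> {ln a..ln b}" for y
        using tame_D(3)[OF q[OF that], of "z + r *\<^sub>R y"] a by auto
    qed
    have g_int: "integrable gauss (\<lambda>y. ln (g j (z + r *\<^sub>R y)))" if "j \<in> J" for j z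
    proof (rule gauss_integrable_range[where a = "ln a" and b = "ln b"])
      have [measurable]: "g j \<in> borel_measurable borel" using g that by blast
      show "(\<lambda>y. ln (g j (z + r *\<^sub>R y))) \<in> borel_measurable borel" by simp
      have "g j (z + r *\<^sub>R y) \<in> {a..b}" for y using g that by blast
      then show "ln (g j (z + r *\<^sub>R y)) \<in> {ln a..ln b}" for y
        using a by (metis (no_types, lifting) atLeastAtMost_iff ln_mono order_less_le_trans)
    qed
    have "(\<Sum>i\<in>I. c i * ln (heat r (f i) x)) \<le>
        (\<Sum>i\<in>I. c i * (heat r (\<lambda>x. ln (f i x)) (x + r *\<^sub>R w) - pi * (norm (Q i w))\<^sup>2 + C * r ^ 4))"
    proof (rule sum_mono)
      fix i assume i: "i \<in> I"
      have "invariant (Q i) (\<lambda>x. ln (f i x))" using f i invariant_comp by blast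
      then show "c i * ln (heat r (f i) x) \<le>
          c i * (heat r (\<lambda>x. ln (f i x)) (x + r *\<^sub>R w) - pi * (norm (Q i w))\<^sup>2 + C * r ^ 4)"
        using upper[OF qQ[OF i] r, of x] c_pos[OF i] shift[of "Q i" "\<lambda>x. ln (f i x)"] Q_linear[OF i]
        by (intro mult_left_mono) (simp_all add: Qw[OF i])
    qed
    also have "\<dots> = (\<Sum>i\<in>I. c i * heat r (\<lambda>x. ln (f i x)) (x + r *\<^sub>R w))
        - pi * (\<Sum>i\<in>I. c i * (norm (Q i w))\<^sup>2) + sum c I * C * r ^ 4"
      by (simp add: algebra_simps sum.distrib sum_subtractf sum_distrib_left sum_distrib_right)
    also have "(\<Sum>i\<in>I. c i * heat r (\<lambda>x. ln (f i x)) (x + r *\<^sub>R w))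
        = (\<integral>y. (\<Sum>i\<in>I. c i * ln (f i (x + r *\<^sub>R w + r *\<^sub>R y))) \<partial>gauss)"
      unfolding heat_def using f_int by (subst Bochner_Integration.integral_sum) auto
    also have "\<dots> \<le> (\<integral>y. (\<Sum>j\<in>J. d j * ln (g j (x + r *\<^sub>R w + r *\<^sub>R y))) + e \<partial>gauss)"
      using f_int g_int le by (intro integral_mono) auto
    also have "\<dots> = (\<Sum>j\<in>J. d j * heat r (\<lambda>x. ln (g j x)) (x + r *\<^sub>R w)) + e"
      unfolding heat_def using g_int by (subst Bochner_Integration.integral_add) (auto simp: Bochner_Integration.integral_sum)
    also have "\<dots> \<le> (\<Sum>j\<in>J. d j * (ln (heat r (g j) x) + pi * (norm (R j w))\<^sup>2)) + e"
    proof (intro add_right_mono sum_mono)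
      fix j assume j: "j \<in> J"
      have gj: "g j \<in> borel_measurable borel" "\<And>x. g j x \<in> {a..b}" using g j by blast+
      have "invariant (R j) (\<lambda>x. ln (g j x))" using g j invariant_comp by blast
      then show "d j * heat r (\<lambda>x. ln (g j x)) (x + r *\<^sub>R w) \<le> d j * (ln (heat r (g j) x) + pi * (norm (R j w))\<^sup>2)"
        using heat_ln_le_ln_heat[OF gj a, of r x "R j w"] d_pos[OF j] shift[of "R j" "\<lambda>x. ln (g j x)"] R_linear[OF j]
        by (intro mult_left_mono) simp_all
    qed
    also have "\<dots> = (\<Sum>j\<in>J. d j * ln (heat r (g j) x)) + pi * (\<Sum>i\<in>I. c i * (norm (Q i w))\<^sup>2) + e"
      unfolding frame by (simp add: algebra_simps sum.distrib sum_distrib_left)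
    finally show "(\<Sum>i\<in>I. c i * ln (heat r (f i) x)) \<le> (\<Sum>j\<in>J. d j * ln (heat r (g j) x)) + (e + sum c I * C * r ^ 4)"
      by simp
  qed
qed

lemma heat_monotone:
  assumes a: "0 < a" and K: "0 \<le> K" and t: "0 < t" "t \<le> 1"
    and f: "\<And>i. i \<in> I \<Longrightarrow> \<exists>q. tame a b L K (f i) q" "\<And>i. i \<in> I \<Longrightarrow> invariant (Q i) (f i)"
    and g: "\<And>j. j \<in> J \<Longrightarrow> g j \<in> borel_measurable borel" "\<And>j x. j \<in> J \<Longrightarrow> g j x \<in> {a..b}"
      "\<And>j. j \<in> J \<Longrightarrow> invariant (R j) (g j)"
    and le: "\<And>x. (\<Sum>i\<in>I. c i * ln (f i x)) \<le> (\<Sum>j\<in>J. d j * ln (g j x))"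
  shows "(\<Sum>i\<in>I. c i * ln (heat t (f i) x)) \<le> (\<Sum>j\<in>J. d j * ln (heat t (g j) x))"
proof -
  obtain C where C: "0 \<le> C" and step: "\<And>f g r e. (\<forall>i\<in>I. (\<exists>q. tame a b L K (f i) q) \<and> invariant (Q i) (f i)) \<Longrightarrow>
    (\<forall>j\<in>J. g j \<in> borel_measurable borel \<and> (\<forall>x. g j x \<in> {a..b}) \<and> invariant (R j) (g j)) \<Longrightarrow>
    (\<forall>x. (\<Sum>i\<in>I. c i * ln (f i x)) \<le> (\<Sum>j\<in>J. d j * ln (g j x)) + e) \<Longrightarrow> 0 < r \<Longrightarrow> r \<le> 1 \<Longrightarrow>
    (\<forall>x. (\<Sum>i\<in>I. c i * ln (heat r (f i) x)) \<le> (\<Sum>j\<in>J. d j * ln (heat r (g j) x)) + (e + C * r ^ 4))"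
    using heat_step[OF a K, of b L] by blast
  \<comment> \<open>\<open>n\<close> steps of time \<open>r\<^sup>2\<close> amount to parameter
    \<open>sqrt n * r\<close>, and each adds \<open>C * r ^ 4\<close> to the error; at
    \<open>n = 0\<close> the flow is the identity.\<close>
  have iter: "(\<Sum>i\<in>I. c i * ln (heat (sqrt n * r) (f i) x)) \<le> (\<Sum>j\<in>J. d j * ln (heat (sqrt n * r) (g j) x)) + n * C * r ^ 4"
    if r: "0 < r" "r \<le> 1" for n :: nat and r x
  proof (induction n arbitrary: x)
    case 0
    then show ?case using le by (simp add: heat_def)
  next
    case (Suc n)
    have eq: "heat r (heat (sqrt n * r) h) = heat (sqrt (Suc n) * r) h"
      if "h \<in> borel_measurable borel" "\<And>x. h x \<in> {a..b}" for h :: "'a \<Rightarrow> real"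
    proof -
      have "sqrt (r\<^sup>2 + (sqrt n * r)\<^sup>2) = sqrt (real (Suc n) * r\<^sup>2)"
        by (simp add: power_mult_distrib algebra_simps)
      also have "\<dots> = sqrt (Suc n) * r" using r by (simp add: real_sqrt_mult)
      finally show ?thesis using heat_heat[OF that r(1), of "sqrt n * r"] by simp
    qed
    have eqf: "heat r (heat (sqrt n * r) (f i)) = heat (sqrt (Suc n) * r) (f i)" if "i \<in> I" for i
      using f(1)[OF that] tame_D by (intro eq) blast+
    have eqg: "heat r (heat (sqrt n * r) (g j)) = heat (sqrt (Suc n) * r) (g j)" if "j \<in> J" for j
      using g that by (intro eq) blast+
    have 1: "\<forall>i\<in>I. (\<exists>q. tame a b L K (heat (sqrt n * r) (f i)) q) \<and> invariant (Q i) (heat (sqrt n * r) (f i))"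
      using f by (intro ballI conjI invariant_heat) (meson tame_heat, simp)
    have 2: "\<forall>j\<in>J. heat (sqrt n * r) (g j) \<in> borel_measurable borel \<and> (\<forall>x. heat (sqrt n * r) (g j) x \<in> {a..b})
        \<and> invariant (R j) (heat (sqrt n * r) (g j))"
      using g by (intro ballI conjI allI heat_measurable heat_range invariant_heat) simp_all
    have "(\<Sum>i\<in>I. c i * ln (heat r (heat (sqrt n * r) (f i)) x))
        \<le> (\<Sum>j\<in>J. d j * ln (heat r (heat (sqrt n * r) (g j)) x)) + (n * C * r ^ 4 + C * r ^ 4)"
      using step[OF 1 2 _ r] Suc.IH by blast
    then show ?case using eqf eqg by (simp add: algebra_simps)
  qed
  have "(\<Sum>i\<in>I. c i * ln (heat t (f i) x)) \<le> (\<Sum>j\<in>J. d j * ln (heat t (g j) x)) + C * t ^ 4 * inverse (real (Suc n))" for n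
  proof -
    \<comment> \<open>\<open>Suc n\<close> steps of this size reach time \<open>t\<^sup>2\<close>
      exactly, and their total error is \<open>C * t ^ 4 / Suc n\<close>, which tends to 0.\<close>
    define r where "r = t / sqrt (Suc n)"
    have "1 \<le> sqrt (Suc n)" by simp
    then have r: "0 < r" "r \<le> 1" "sqrt (Suc n) * r = t"
      unfolding r_def using t by (auto simp: divide_le_eq intro: order_trans[of t 1])
    have "sqrt (Suc n) ^ 4 = (real (Suc n))\<^sup>2"
      using power_mult[of "sqrt (Suc n)" 2 2] by simp
    then have "Suc n * C * r ^ 4 = C * t ^ 4 * inverse (real (Suc n))"
      unfolding r_def power_divide by (simp add: power2_eq_square field_simps del: of_nat_Suc)
    then show ?thesis using iter[OF r(1,2), of "Suc n" x] unfolding r(3) by (simp only:)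
  qed
  moreover have "(\<lambda>n. (\<Sum>j\<in>J. d j * ln (heat t (g j) x)) + C * t ^ 4 * inverse (real (Suc n)))
      \<longlonglongrightarrow> (\<Sum>j\<in>J. d j * ln (heat t (g j) x)) + C * t ^ 4 * 0"
    by (intro tendsto_intros LIMSEQ_inverse_real_of_nat)
  ultimately show ?thesis
    by (intro LIMSEQ_le_const[where X = "\<lambda>n. (\<Sum>j\<in>J. d j * ln (heat t (g j) x)) + C * t ^ 4 * inverse (real (Suc n))"])
       (auto)
qed

end

section \<open>Producing tame functions from bounded measurable ones\<close>

lemma tame_exp:
  fixes f :: "'a::euclidean_space \<Rightarrow> real"
  assumes t: "tame a b L K f q" and K: "0 \<le> K"
  shows "tame (exp a) (exp b) (exp b * L) (exp b * ((L + K + b - a)\<^sup>2 * exp (b - a) + K))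
    (\<lambda>x. exp (f x)) (\<lambda>x. exp (f x) *\<^sub>R q x)"
proof -
  have [measurable]: "f \<in> borel_measurable borel" "q \<in> borel_measurable borel"
    and ab: "\<And>x. f x \<in> {a..b}" and L: "\<And>x. norm (q x) \<le> L"
    using tame_D[OF t] by auto
  have "\<bar>exp (f (x + z)) - exp (f x) - (exp (f x) *\<^sub>R q x) \<bullet> z\<bar>
      \<le> exp b * ((L + K + b - a)\<^sup>2 * exp (b - a) + K) * (norm z)\<^sup>2" for x z
  proof -
    \<comment> \<open>\<open>s\<close> is bounded twice: linearly in \<open>norm z\<close> for the
      factor \<open>s\<^sup>2\<close>, and by \<open>b - a\<close> for the factor
      \<open>exp \<bar>s\<bar>\<close> of the remainder.\<close>
    define s where "s = f (x + z) - f x"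
    have s: "\<bar>s\<bar> \<le> (L + K + b - a) * norm z" unfolding s_def by (rule tame_lipschitz[OF t K])
    have "\<bar>s\<bar> \<le> b - a" unfolding s_def using ab[of x] ab[of "x + z"] by auto
    then have "s\<^sup>2 * exp \<bar>s\<bar> \<le> ((L + K + b - a) * norm z)\<^sup>2 * exp (b - a)"
      using s by (intro mult_mono) (auto simp: abs_le_square_iff[symmetric])
    then have 1: "\<bar>exp s - 1 - s\<bar> \<le> (L + K + b - a)\<^sup>2 * exp (b - a) * (norm z)\<^sup>2"
      using abs_exp_remainder_le[of s] by (simp add: power_mult_distrib mult_ac)
    have "\<bar>s - q x \<bullet> z\<bar> \<le> K * (norm z)\<^sup>2"
      unfolding s_def using tame_D(5)[OF t] by blast
    then have 2: "\<bar>exp s - 1 - q x \<bullet> z\<bar> \<le> ((L + K + b - a)\<^sup>2 * exp (b - a) + K) * (norm z)\<^sup>2"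
      using 1 by (simp add: distrib_right)
    have "exp (f (x + z)) = exp (f x) * exp s" unfolding s_def by (simp flip: exp_add)
    then have "exp (f (x + z)) - exp (f x) - (exp (f x) *\<^sub>R q x) \<bullet> z = exp (f x) * (exp s - 1 - q x \<bullet> z)"
      by (simp add: algebra_simps)
    then have "\<bar>exp (f (x + z)) - exp (f x) - (exp (f x) *\<^sub>R q x) \<bullet> z\<bar> = exp (f x) * \<bar>exp s - 1 - q x \<bullet> z\<bar>"
      by (simp add: abs_mult)
    also have "\<dots> \<le> exp b * (((L + K + b - a)\<^sup>2 * exp (b - a) + K) * (norm z)\<^sup>2)"
      using 2 ab[of x] by (intro mult_mono) auto
    finally show ?thesis by (simp add: mult.assoc)
  qed
  moreover have "norm (exp (f x) *\<^sub>R q x) \<le> exp b * L" for x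
    unfolding norm_scaleR using ab[of x] L[of x] by (intro mult_mono) auto
  ultimately show ?thesis
    unfolding tame_def using ab by auto
qed

text \<open>\<open>F\<close> has no regularity, so the displacement is moved onto the Gaussian: by
  Cameron-Martin, \<open>heat r F (x + r *\<^sub>R v)\<close> integrates
  \<open>F (x + r *\<^sub>R y)\<close> against a weight that is smooth in \<open>v\<close>, and this
  weight is expanded to first order. The constants do not depend on \<open>F\<close>, so one pair
  serves all the functions at once.\<close>

lemma tame_heat_bounded:
  assumes r: "0 < r"
  shows "\<exists>L. \<exists>K\<ge>0. \<forall>F :: 'a::euclidean_space \<Rightarrow> real. F \<in> borel_measurable borel \<longrightarrow> (\<forall>x. F x \<in> {- M..M}) \<longrightarrow>
    (\<exists>q. tame (- M) M L K (heat r F) q)"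
proof (cases "0 \<le> M")
  case False
  then have "\<not> F x \<in> {- M..M}" for F :: "'a \<Rightarrow> real" and x by simp
  then show ?thesis by blast
next
  case M: True
  define N where "N = (\<integral>y. norm y \<partial>(gauss :: 'a measure))"
  \<comment> \<open>\<open>G\<close> dominates the remainder of the weight divided by
    \<open>(norm v)\<^sup>2\<close> when \<open>norm v \<le> 1\<close>. The main term is
    \<open>s\<^sup>2 * exp \<bar>s\<bar>\<close> for the exponent \<open>s\<close> of the weight;
    the summand \<open>pi\<close> pays for the quadratic term in \<open>s\<close>, which is not part
    of the first-order expansion.\<close>
  define G where "G y = 4 * pi\<^sup>2 * exp (2 * pi) * ((norm y + 1) ^ 2 * exp (2 * pi * norm y)) + pi" for y :: 'a
  define L where "L = M * N * (2 * pi / r)"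
  \<comment> \<open>The first summand is for \<open>norm v \<le> 1\<close>. The others bound the two
    values of \<open>heat r F\<close> and the gradient term when \<open>norm v > 1\<close>, where
    \<open>1\<close> and \<open>norm v\<close> are at most \<open>(norm v)\<^sup>2\<close>.\<close>
  define K where "K = M * (\<integral>y. G y \<partial>gauss) + 2 * M + 2 * pi * M * N"
  have norm_int: "integrable gauss (\<lambda>y::'a. norm y)"
    using integrable_gauss_poly_exp_norm[of 0 1 0, where 'a = 'a] by simp
  have G_int: "integrable gauss G" unfolding G_def
    by (intro Bochner_Integration.integrable_add integrable_mult_right integrable_gauss_poly_exp_norm) auto
  have N: "0 \<le> N" unfolding N_def by (intro Bochner_Integration.integral_nonneg) auto
  have EG: "0 \<le> (\<integral>y. G y \<partial>gauss)" unfolding G_def by (intro Bochner_Integration.integral_nonneg) auto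
  have K: "0 \<le> K" unfolding K_def using M N EG by simp
  have "\<exists>q. tame (- M) M L (K / r\<^sup>2) (heat r F) q"
    if [measurable]: "F \<in> borel_measurable borel" and F: "\<And>x. F x \<in> {- M..M}" for F :: "'a \<Rightarrow> real"
  proof -
    have F': "\<bar>F x\<bar> \<le> M" for x using F[of x] by auto
    \<comment> \<open>The gradient after integration by parts: the Gaussian kernel is differentiated
      instead of \<open>F\<close>, which gives \<open>2 * pi\<close> times \<open>y\<close>, and the
      scaling by \<open>r\<close> gives \<open>1 / r\<close>.\<close>
    define q where "q x = (2 * pi / r) *\<^sub>R (\<integral>y. F (x + r *\<^sub>R y) *\<^sub>R y \<partial>gauss)" for x
    have [measurable]: "q \<in> borel_measurable borel" unfolding q_def by measurable
    have Fy_int: "integrable gauss (\<lambda>y. F (x + r *\<^sub>R y) *\<^sub>R y)" for x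
    proof (rule Bochner_Integration.integrable_bound)
      show "integrable gauss (\<lambda>y::'a. M * norm y)" using norm_int by simp
      show "AE y in gauss. norm (F (x + r *\<^sub>R y) *\<^sub>R y) \<le> norm (M * norm y)"
        using F' M by (auto intro!: AE_I2 mult_right_mono)
    qed simp
    have F_int: "integrable gauss (\<lambda>y. F (x + r *\<^sub>R y))" for x
      by (rule gauss_integrable_range[where a = "- M" and b = M]) (use F in auto)
    have "norm (q x) \<le> L" for x
    proof -
      have "norm (\<integral>y. F (x + r *\<^sub>R y) *\<^sub>R y \<partial>gauss) \<le> (\<integral>y. norm (F (x + r *\<^sub>R y) *\<^sub>R y) \<partial>gauss)"
        by (rule integral_norm_bound)
      also have "\<dots> \<le> (\<integral>y. M * norm y \<partial>(gauss :: 'a measure))"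
        using integrable_norm[OF Fy_int[of x]] norm_int F' by (intro integral_mono) (auto intro!: mult_right_mono)
      also have "\<dots> = M * N" unfolding N_def by simp
      finally have "norm (\<integral>y. F (x + r *\<^sub>R y) *\<^sub>R y \<partial>gauss) * (2 * pi / r) \<le> M * N * (2 * pi / r)"
        using r by (intro mult_right_mono) auto
      then show ?thesis unfolding q_def L_def using r by (simp add: mult.commute)
    qed
    moreover have "\<bar>heat r F (x + z) - heat r F x - q x \<bullet> z\<bar> \<le> K / r\<^sup>2 * (norm z)\<^sup>2" for x z
    proof -
      define v where "v = z /\<^sub>R r"
      have z: "z = r *\<^sub>R v" unfolding v_def using r by simp
      define E where "E y = exp (2 * pi * (y \<bullet> v) - pi * (norm v)\<^sup>2) - 1 - 2 * pi * (y \<bullet> v)" for y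
      have [measurable]: "E \<in> borel_measurable borel" unfolding E_def by simp
      define A where "A y = exp (2 * pi * (y \<bullet> v) - pi * (norm v)\<^sup>2) * F (x + r *\<^sub>R y)" for y
      define B where "B y = F (x + r *\<^sub>R y) * (y \<bullet> v)" for y
      have A: "heat r F (x + z) = (\<integral>y. A y \<partial>gauss)"
        using integral_gauss_shift[of "\<lambda>y. F (x + r *\<^sub>R (y + v))" "- v"]
        by (simp add: heat_def z A_def algebra_simps)
      have A_int: "integrable gauss A"
        using gauss_integrable_exp_inner_mult[of "\<lambda>y. F (x + r *\<^sub>R y)" M "- v"] F' unfolding A_def by simp
      have B: "q x \<bullet> z = 2 * pi * (\<integral>y. B y \<partial>gauss)"
      proof -
        have "q x \<bullet> z = 2 * pi * ((\<integral>y. F (x + r *\<^sub>R y) *\<^sub>R y \<partial>gauss) \<bullet> v)"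
          unfolding q_def z using r by simp
        also have "(\<integral>y. F (x + r *\<^sub>R y) *\<^sub>R y \<partial>gauss) \<bullet> v = (\<integral>y. B y \<partial>gauss)"
          unfolding B_def using Fy_int[of x] by (subst integral_inner_left[symmetric]) auto
        finally show ?thesis .
      qed
      have B_int: "integrable gauss B"
        unfolding B_def using integrable_inner_left[OF Fy_int[of x], of v] by simp
      have FE: "F (x + r *\<^sub>R y) * E y = A y - F (x + r *\<^sub>R y) - 2 * pi * B y" for y
        unfolding A_def B_def E_def by (simp add: algebra_simps)
      have int: "integrable gauss (\<lambda>y. F (x + r *\<^sub>R y) * E y)"
        unfolding FE using A_int B_int F_int[of x] by auto
      have "heat r F (x + z) - heat r F x - q x \<bullet> z = (\<integral>y. F (x + r *\<^sub>R y) * E y \<partial>gauss)"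
        unfolding FE A B heat_def[of r F x] using A_int B_int F_int[of x] by simp
      then have eq: "\<bar>heat r F (x + z) - heat r F x - q x \<bullet> z\<bar> \<le> (\<integral>y. \<bar>F (x + r *\<^sub>R y) * E y\<bar> \<partial>gauss)"
        using integral_norm_bound[of gauss "\<lambda>y. F (x + r *\<^sub>R y) * E y"] by simp
      have "\<bar>heat r F (x + z) - heat r F x - q x \<bullet> z\<bar> \<le> K * (norm v)\<^sup>2"
      proof (cases "norm v \<le> 1")
        case True
        have E_le: "\<bar>E y\<bar> \<le> (norm v)\<^sup>2 * G y" for y
        proof -
          define s where "s = 2 * pi * (y \<bullet> v) - pi * (norm v)\<^sup>2"
          have "\<bar>y \<bullet> v\<bar> \<le> norm y * norm v" by (rule Cauchy_Schwarz_ineq2)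
          then have "\<bar>2 * pi * (y \<bullet> v)\<bar> \<le> 2 * pi * (norm y * norm v)" by (simp add: abs_mult)
          moreover have "\<bar>pi * (norm v)\<^sup>2\<bar> \<le> 2 * pi * norm v"
          proof -
            have "norm v * norm v \<le> 1 * norm v" using True by (intro mult_right_mono) auto
            then have "pi * (norm v * norm v) \<le> pi * (1 * norm v)" by (intro mult_left_mono) auto
            moreover have "0 \<le> pi * norm v" "\<bar>pi * (norm v)\<^sup>2\<bar> = pi * (norm v * norm v)"
              by (simp_all add: power2_eq_square)
            ultimately show ?thesis by linarith
          qed
          ultimately have "\<bar>s\<bar> \<le> 2 * pi * (norm y * norm v) + 2 * pi * norm v"
            unfolding s_def by linarith
          then have s: "\<bar>s\<bar> \<le> 2 * pi * (norm y + 1) * norm v"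
            by (simp add: distrib_left distrib_right mult.assoc)
          also have "\<dots> \<le> 2 * pi * (norm y + 1) * 1" using True by (intro mult_left_mono) auto
          finally have "exp \<bar>s\<bar> \<le> exp (2 * pi) * exp (2 * pi * norm y)"
            by (simp add: algebra_simps flip: exp_add)
          moreover have "s\<^sup>2 \<le> (2 * pi * (norm y + 1) * norm v)\<^sup>2"
            using s power_mono[OF s, of 2] by simp
          ultimately have "s\<^sup>2 * exp \<bar>s\<bar> \<le> (2 * pi * (norm y + 1) * norm v)\<^sup>2 * (exp (2 * pi) * exp (2 * pi * norm y))"
            by (intro mult_mono) auto
          also have "\<dots> = (norm v)\<^sup>2 * (G y - pi)"
            unfolding G_def power_mult_distrib by simp
          finally have "\<bar>exp s - 1 - s\<bar> \<le> (norm v)\<^sup>2 * (G y - pi)"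
            using abs_exp_remainder_le[of s] by linarith
          moreover have "E y = exp s - 1 - s - pi * (norm v)\<^sup>2" unfolding E_def s_def by simp
          moreover have "0 \<le> pi * (norm v)\<^sup>2"
            "(norm v)\<^sup>2 * (G y - pi) = (norm v)\<^sup>2 * G y - pi * (norm v)\<^sup>2"
            by (simp_all add: algebra_simps)
          ultimately show ?thesis by linarith
        qed
        have "(\<integral>y. \<bar>F (x + r *\<^sub>R y) * E y\<bar> \<partial>gauss) \<le> (\<integral>y. M * ((norm v)\<^sup>2 * G y) \<partial>gauss)"
        proof (rule integral_mono)
          show "\<bar>F (x + r *\<^sub>R y) * E y\<bar> \<le> M * ((norm v)\<^sup>2 * G y)" for y
            unfolding abs_mult using F' E_le M by (intro mult_mono) auto
        qed (use int G_int in auto)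
        also have "\<dots> = M * (\<integral>y. G y \<partial>gauss) * (norm v)\<^sup>2" by simp
        also have "\<dots> \<le> K * (norm v)\<^sup>2" unfolding K_def using M N by (intro mult_right_mono) auto
        finally show ?thesis using eq by linarith
      next
        case False
        have "\<bar>heat r F (x + z)\<bar> \<le> M" "\<bar>heat r F x\<bar> \<le> M"
          using heat_range[OF that(1) F, of r "x + z"] heat_range[OF that(1) F, of r x] by auto
        moreover have "\<bar>q x \<bullet> z\<bar> \<le> 2 * pi * M * N * norm v"
        proof -
          have "\<bar>q x \<bullet> z\<bar> \<le> norm (q x) * norm z" by (rule Cauchy_Schwarz_ineq2)
          also have "\<dots> \<le> L * norm z" using calculation \<open>norm (q x) \<le> L\<close> by (intro mult_right_mono) auto
          also have "\<dots> = 2 * pi * M * N * norm v" unfolding L_def z using r by simp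
          finally show ?thesis .
        qed
        ultimately have "\<bar>heat r F (x + z) - heat r F x - q x \<bullet> z\<bar> \<le> 2 * M + 2 * pi * M * N * norm v"
          by linarith
        also have "\<dots> \<le> 2 * M * (norm v)\<^sup>2 + 2 * pi * M * N * (norm v)\<^sup>2"
        proof (intro add_mono mult_left_mono)
          have "1 * norm v \<le> norm v * norm v" using False by (intro mult_right_mono) auto
          then show "norm v \<le> (norm v)\<^sup>2" by (simp add: power2_eq_square)
          then have "1 \<le> (norm v)\<^sup>2" using False by simp
          then show "2 * M \<le> 2 * M * (norm v)\<^sup>2" using M by (simp add: mult_le_cancel_left1)
        qed (use M N in auto)
        also have "\<dots> \<le> K * (norm v)\<^sup>2" unfolding K_def distrib_right using M EG by simp
        finally show ?thesis .
      qed
      also have "\<dots> = K / r\<^sup>2 * (norm z)\<^sup>2" unfolding z using r by (simp add: power_mult_distrib)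
      finally show ?thesis .
    qed
    ultimately have "tame (- M) M L (K / r\<^sup>2) (heat r F) q"
      unfolding tame_def using heat_range[OF that(1) F, of r] by auto
    then show ?thesis by - (rule exI, assumption)
  qed
  moreover have "0 \<le> K / r\<^sup>2" using K by simp
  ultimately show ?thesis by blast
qed

section \<open>Lipschitz approximation and removal of the initial averaging\<close>

lemma lipschitz_gauss_integrable:
  fixes \<phi> :: "'a::euclidean_space \<Rightarrow> real"
  assumes "l-lipschitz_on UNIV \<phi>"
  shows "integrable gauss \<phi>"
proof (rule Bochner_Integration.integrable_bound)
  show "integrable gauss (\<lambda>x::'a. \<bar>\<phi> 0\<bar> + l * ((norm x + 0) ^ 1 * exp (0 * norm x)))"
    by (intro Bochner_Integration.integrable_add integrable_mult_right integrable_gauss_poly_exp_norm) auto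
  show "\<phi> \<in> borel_measurable gauss"
    using borel_measurable_continuous_onI[OF lipschitz_on_continuous_on[OF assms]]
    by (simp add: measurable_cong_sets[OF sets_gauss refl])
  show "AE x in gauss. norm (\<phi> x) \<le> norm (\<bar>\<phi> 0\<bar> + l * ((norm x + 0) ^ 1 * exp (0 * norm x)))"
  proof (rule AE_I2)
    fix x
    have "\<bar>\<phi> x - \<phi> 0\<bar> \<le> l * norm x"
      using lipschitz_onD[OF assms, of x 0] by (simp add: dist_norm)
    then show "norm (\<phi> x) \<le> norm (\<bar>\<phi> 0\<bar> + l * ((norm x + 0) ^ 1 * exp (0 * norm x)))"
      by simp
  qed
qed

text \<open>Indicators are approximated from inside by compact sets and then by cut-offs of the
  distance; linearity and dominated convergence do the rest. It replaces the missing continuity of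
  \<open>F\<close> when the averaging time tends to 0.\<close>

lemma gauss_lipschitz_dense:
  fixes f :: "'a::euclidean_space \<Rightarrow> real"
  assumes "integrable gauss f" "0 < e"
  shows "\<exists>l \<phi>. l-lipschitz_on UNIV \<phi> \<and> (\<integral>x. \<bar>f x - \<phi> x\<bar> \<partial>gauss) \<le> e"
  using assms
proof (induction arbitrary: e rule: integrable_induct)
  case (base A c)
  then have A [measurable]: "A \<in> sets borel" by simp
  \<comment> \<open>One \<epsilon> is spent on passing from \<open>A\<close> to a compact
    \<open>K\<close>, one on passing from \<open>K\<close> to a Lipschitz function; the
    \<open>+ 1\<close> covers \<open>c = 0\<close>.\<close>
  define \<epsilon> where "\<epsilon> = e / (2 * (\<bar>c\<bar> + 1))"
  have \<epsilon>: "0 < \<epsilon>" "\<bar>c\<bar> * (2 * \<epsilon>) \<le> e" unfolding \<epsilon>_def using base by (auto simp: field_simps)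
  obtain K where K: "K \<subseteq> A" "compact K" "measure gauss A - \<epsilon> < measure gauss K"
  proof (cases "measure gauss A = 0")
    case True
    then show ?thesis using that[of "{}"] \<epsilon> by simp
  next
    case False
    have "ennreal (measure gauss A - \<epsilon>) < emeasure gauss A"
      unfolding gauss.emeasure_eq_measure using False \<epsilon> by (intro ennreal_lessI) (auto simp: zero_less_measure_iff)
    also have "emeasure gauss A = (SUP K \<in> {K. K \<subseteq> A \<and> compact K}. emeasure gauss K)"
      by (rule inner_regular) (use A in \<open>auto simp: gauss.emeasure_finite\<close>)
    finally obtain K where "K \<subseteq> A" "compact K" "ennreal (measure gauss A - \<epsilon>) < ennreal (measure gauss K)"
      unfolding less_SUP_iff gauss.emeasure_eq_measure by auto
    then show ?thesis using that by (metis ennreal_leI leD leI)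
  qed
  then have K_meas [measurable]: "K \<in> sets borel" by (simp add: borel_compact)
  have AK: "(\<integral>x. \<bar>indicator A x - indicator K x :: real\<bar> \<partial>gauss) \<le> \<epsilon>"
  proof -
    have "(\<integral>x. \<bar>indicator A x - indicator K x :: real\<bar> \<partial>gauss) = (\<integral>x. indicator (A - K) x \<partial>(gauss :: 'a measure))"
      using K(1) by (intro Bochner_Integration.integral_cong) (auto simp: indicator_def)
    also have "\<dots> = measure gauss A - measure gauss K"
      using K(1) A K_meas by (simp add: gauss.finite_measure_Diff)
    finally show ?thesis using K(3) by simp
  qed
  obtain l \<psi> where \<psi>: "l-lipschitz_on UNIV \<psi>" "(\<integral>x. \<bar>indicator K x - \<psi> x :: real\<bar> \<partial>gauss) \<le> \<epsilon>"
  \<comment> \<open>By convention \<open>infdist x {} = 0\<close>, so for empty \<open>K\<close> the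
    cut-offs of the other case would be constantly 1.\<close>
  proof (cases "K = {}")
    case True
    then show ?thesis using that[of 0 "\<lambda>_. 0"] \<epsilon> by (simp add: lipschitz_on_constant)
  next
    case False
    define \<psi> where "\<psi> n x = max 0 (1 - real n * infdist x K)" for n x
    have \<psi>_lip: "(real n)-lipschitz_on UNIV (\<psi> n)" for n
    proof (rule lipschitz_onI)
      fix x y :: 'a
      have "real n * \<bar>infdist x K - infdist y K\<bar> \<le> real n * dist x y"
        using infdist_triangle_abs[of x K y] by (intro mult_left_mono) auto
      then have "\<bar>real n * infdist x K - real n * infdist y K\<bar> \<le> real n * dist x y"
        by (simp add: abs_mult flip: right_diff_distrib)
      then show "dist (\<psi> n x) (\<psi> n y) \<le> real n * dist x y"
        unfolding \<psi>_def dist_real_def by linarith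
    qed simp
    have [measurable]: "\<psi> n \<in> borel_measurable gauss" for n
      using lipschitz_gauss_integrable[OF \<psi>_lip] by blast
    have "(\<lambda>n. \<integral>x. \<bar>indicator K x - \<psi> n x\<bar> \<partial>gauss) \<longlonglongrightarrow> (\<integral>x. 0 \<partial>(gauss :: 'a measure))"
    proof (rule integral_dominated_convergence)
      show "AE x in gauss. (\<lambda>n. \<bar>indicator K x - \<psi> n x\<bar>) \<longlonglongrightarrow> 0"
      proof (rule AE_I2)
        fix x :: 'a
        show "(\<lambda>n. \<bar>indicator K x - \<psi> n x\<bar>) \<longlonglongrightarrow> 0"
        proof (cases "x \<in> K")
          case True
          then show ?thesis by (simp add: \<psi>_def)
        next
          case x: False
          have "infdist x K > 0"
            using x K(2) False by (simp add: infdist_pos_not_in_closed compact_imp_closed)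
          then obtain N :: nat where "1 < N * infdist x K" using reals_Archimedean3 by blast
          then have "\<psi> n x = 0" if "n \<ge> N" for n
            using that mult_right_mono[of "real N" "real n" "infdist x K"] infdist_nonneg[of x K] unfolding \<psi>_def by auto
          then have "\<forall>\<^sub>F n in sequentially. \<bar>indicator K x - \<psi> n x\<bar> = 0"
            using x by (auto simp: eventually_sequentially)
          then show ?thesis by (rule tendsto_eventually)
        qed
      qed
      show "AE x in gauss. norm \<bar>indicator K x - \<psi> n x\<bar> \<le> 1" for n
        by (rule AE_I2) (auto simp: \<psi>_def indicator_def infdist_nonneg)
    qed auto
    then have "\<forall>\<^sub>F n in sequentially. (\<integral>x. \<bar>indicator K x - \<psi> n x\<bar> \<partial>gauss) < \<epsilon>"
      using \<epsilon> by (intro order_tendstoD) auto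
    then obtain n where "(\<integral>x. \<bar>indicator K x - \<psi> n x\<bar> \<partial>gauss) < \<epsilon>"
      using eventually_happens by fastforce
    then show ?thesis using that[OF \<psi>_lip[of n]] by simp
  qed
  have int: "integrable gauss \<psi>" using \<psi> lipschitz_gauss_integrable by blast
  have "(\<integral>x. \<bar>indicator A x *\<^sub>R c - c * \<psi> x\<bar> \<partial>gauss)
      \<le> (\<integral>x. \<bar>c\<bar> * (\<bar>indicator A x - indicator K x\<bar> + \<bar>indicator K x - \<psi> x\<bar>) \<partial>gauss)"
  proof (rule integral_mono)
    fix x
    have "indicator A x *\<^sub>R c - c * \<psi> x = c * ((indicator A x - indicator K x) + (indicator K x - \<psi> x))"
      by (simp add: algebra_simps)
    then show "\<bar>indicator A x *\<^sub>R c - c * \<psi> x\<bar> \<le> \<bar>c\<bar> * (\<bar>indicator A x - indicator K x\<bar> + \<bar>indicator K x - \<psi> x\<bar>)"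
      by (simp only: abs_mult) (intro mult_left_mono, auto)
  qed (use int A K_meas in \<open>auto intro!: integrable_abs Bochner_Integration.integrable_add Bochner_Integration.integrable_diff
      integrable_mult_right simp: gauss.emeasure_finite less_top[symmetric]\<close>)
  also have "\<dots> = \<bar>c\<bar> * ((\<integral>x. \<bar>indicator A x - indicator K x\<bar> \<partial>gauss) + (\<integral>x. \<bar>indicator K x - \<psi> x\<bar> \<partial>gauss))"
    using int A K_meas by (subst integral_mult_right_zero, subst Bochner_Integration.integral_add)
      (auto intro!: integrable_abs Bochner_Integration.integrable_diff simp: gauss.emeasure_finite less_top[symmetric])
  also have "\<dots> \<le> \<bar>c\<bar> * (2 * \<epsilon>)" using AK \<psi>(2) by (intro mult_left_mono) auto
  also have "\<dots> \<le> e" by (rule \<epsilon>)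
  finally show ?case using lipschitz_on_cmult_real[OF \<psi>(1), of c] by blast
next
  case (add f g)
  then have "0 < e / 2" by simp
  obtain l1 \<phi>1 where 1: "l1-lipschitz_on UNIV \<phi>1" "(\<integral>x. \<bar>f x - \<phi>1 x\<bar> \<partial>gauss) \<le> e / 2"
    using add.IH(1)[OF \<open>0 < e / 2\<close>] by blast
  obtain l2 \<phi>2 where 2: "l2-lipschitz_on UNIV \<phi>2" "(\<integral>x. \<bar>g x - \<phi>2 x\<bar> \<partial>gauss) \<le> e / 2"
    using add.IH(2)[OF \<open>0 < e / 2\<close>] by blast
  have int: "integrable gauss \<phi>1" "integrable gauss \<phi>2" using 1 2 lipschitz_gauss_integrable by blast+
  have "(\<integral>x. \<bar>f x + g x - (\<phi>1 x + \<phi>2 x)\<bar> \<partial>gauss) \<le> (\<integral>x. \<bar>f x - \<phi>1 x\<bar> + \<bar>g x - \<phi>2 x\<bar> \<partial>gauss)"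
    using add.hyps int by (intro integral_mono) auto
  also have "\<dots> = (\<integral>x. \<bar>f x - \<phi>1 x\<bar> \<partial>gauss) + (\<integral>x. \<bar>g x - \<phi>2 x\<bar> \<partial>gauss)"
    using add.hyps int by (intro Bochner_Integration.integral_add) auto
  also have "\<dots> \<le> e" using 1 2 by simp
  finally show ?case using lipschitz_on_add[OF 1(1) 2(1)] by blast
next
  case (lim f s)
  then have [measurable]: "f \<in> borel_measurable gauss" "\<And>i. s i \<in> borel_measurable gauss" by auto
  have "(\<lambda>i. \<integral>x. \<bar>f x - s i x\<bar> \<partial>gauss) \<longlonglongrightarrow> (\<integral>x. \<bar>f x - f x\<bar> \<partial>(gauss :: 'a measure))"
  proof (rule integral_dominated_convergence)
    show "integrable gauss (\<lambda>x. 3 * \<bar>f x\<bar>)" using lim.hyps by simp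
    show "AE x in gauss. (\<lambda>i. \<bar>f x - s i x\<bar>) \<longlonglongrightarrow> \<bar>f x - f x\<bar>"
      using lim.hyps(2) by (intro AE_I2 tendsto_intros) auto
    show "AE x in gauss. norm \<bar>f x - s i x\<bar> \<le> 3 * \<bar>f x\<bar>" for i
    proof (rule AE_I2)
      fix x :: 'a
      have "\<bar>s i x\<bar> \<le> 2 * \<bar>f x\<bar>" using lim.hyps(3)[of x i] by simp
      then show "norm \<bar>f x - s i x\<bar> \<le> 3 * \<bar>f x\<bar>" by simp
    qed
  qed auto
  then have "\<forall>\<^sub>F i in sequentially. (\<integral>x. \<bar>f x - s i x\<bar> \<partial>gauss) < e / 2"
    using lim.prems by (intro order_tendstoD) auto
  then obtain i where i: "(\<integral>x. \<bar>f x - s i x\<bar> \<partial>gauss) < e / 2"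
    using eventually_happens by fastforce
  have "0 < e / 2" using lim.prems by simp
  obtain l \<phi> where 1: "l-lipschitz_on UNIV \<phi>" "(\<integral>x. \<bar>s i x - \<phi> x\<bar> \<partial>gauss) \<le> e / 2"
    using lim.IH[OF \<open>0 < e / 2\<close>] by blast
  have int: "integrable gauss \<phi>" using 1 lipschitz_gauss_integrable by blast
  have "(\<integral>x. \<bar>f x - \<phi> x\<bar> \<partial>gauss) \<le> (\<integral>x. \<bar>f x - s i x\<bar> + \<bar>s i x - \<phi> x\<bar> \<partial>gauss)"
    using lim.hyps int by (intro integral_mono) auto
  also have "\<dots> = (\<integral>x. \<bar>f x - s i x\<bar> \<partial>gauss) + (\<integral>x. \<bar>s i x - \<phi> x\<bar> \<partial>gauss)"
    using lim.hyps int by (intro Bochner_Integration.integral_add) auto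
  also have "\<dots> \<le> e" using i 1 by simp
  finally show ?case using 1 by blast
qed

lemma heat_heat_complement:
  fixes f :: "'a::euclidean_space \<Rightarrow> real"
  assumes "f \<in> borel_measurable borel" "\<And>x. f x \<in> {a..b}" "0 < r" "r < 1"
  shows "heat (sqrt (1 - r\<^sup>2)) (heat r f) = heat 1 f"
proof -
  have "r\<^sup>2 < 1" using assms(3,4) by (simp add: power_less_one_iff)
  then show ?thesis using heat_heat[OF assms(1,2), of "sqrt (1 - r\<^sup>2)" r] by simp
qed

lemma exp_diff_le:
  fixes s t :: real
  assumes "s \<le> M" "t \<le> M"
  shows "\<bar>exp s - exp t\<bar> \<le> exp M * \<bar>s - t\<bar>"
proof -
  have *: "exp s - exp t \<le> exp M * (s - t)" if "t \<le> s" "s \<le> M" for s t :: real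
  proof -
    have "exp s * (1 + (t - s)) \<le> exp s * exp (t - s)" by (intro mult_left_mono exp_ge_add_one_self) auto
    then have "exp s - exp t \<le> exp s * (s - t)" by (simp add: algebra_simps flip: exp_add)
    also have "\<dots> \<le> exp M * (s - t)" using that by (intro mult_right_mono) auto
    finally show ?thesis .
  qed
  show ?thesis using *[of t s] *[of s t] assms by (cases "t \<le> s") auto
qed

text \<open>The two quantities differ in whether \<open>exp\<close> is applied after or before
  averaging over time \<open>r\<^sup>2\<close>. Locally both are close to
  \<open>exp (\<phi> z)\<close>, with an error made of the averaged distance \<open>\<delta>\<close>
  of \<open>F\<close> from \<phi> and the variation \<open>l * r * N\<close> of \<phi>. The
  remaining flow for time \<open>1 - r\<^sup>2\<close> turns the averaged \<delta> into its Gaussian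
  mean, by the semigroup law.\<close>

lemma heat_exp_heat_bound:
  fixes F \<phi> :: "'a::euclidean_space \<Rightarrow> real"
  assumes [measurable]: "F \<in> borel_measurable borel" and F: "\<And>x. F x \<in> {- M..M}"
    and \<phi>: "l-lipschitz_on UNIV \<phi>" and \<phi>M: "\<And>x. \<phi> x \<in> {- M..M}" and r: "0 < r" "r < 1"
  shows "\<bar>heat (sqrt (1 - r\<^sup>2)) (\<lambda>x. exp (heat r F x)) 0 - heat 1 (\<lambda>x. exp (F x)) 0\<bar>
    \<le> 2 * exp M * ((\<integral>x. \<bar>F x - \<phi> x\<bar> \<partial>gauss) + l * r * (\<integral>x. norm x \<partial>(gauss :: 'a measure)))"
proof -
  define t where "t = sqrt (1 - r\<^sup>2)"
  define N where "N = (\<integral>x. norm x \<partial>(gauss :: 'a measure))"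
  define \<delta> where "\<delta> x = \<bar>F x - \<phi> x\<bar>" for x
  have \<phi>_meas [measurable]: "\<phi> \<in> borel_measurable borel"
    using lipschitz_on_continuous_on[OF \<phi>] by (rule borel_measurable_continuous_onI)
  have \<delta>_meas [measurable]: "\<delta> \<in> borel_measurable borel" unfolding \<delta>_def by measurable
  have \<delta>: "\<delta> x \<in> {0..2 * M}" for x using F[of x] \<phi>M[of x] unfolding \<delta>_def by (simp add: abs_le_iff)
  have expF: "exp (F x) \<in> {exp (- M)..exp M}" for x using F[of x] by simp
  have heatF: "heat r F x \<in> {- M..M}" for x using heat_range[of F "- M" M] F by simp
  have exp_heatF: "exp (heat r F x) \<in> {exp (- M)..exp M}" for x using heatF[of x] by simp
  have heat_expF: "heat r (\<lambda>x. exp (F x)) x \<in> {exp (- M)..exp M}" for x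
    by (rule heat_range) (use expF in auto)
  have norm_int: "integrable gauss (\<lambda>y::'a. norm y)"
    using integrable_gauss_poly_exp_norm[of 0 1 0, where 'a = 'a] by simp
  have l: "0 \<le> l" using \<phi> by (rule lipschitz_on_nonneg)
  have pointwise: "\<bar>exp (heat r F z) - heat r (\<lambda>x. exp (F x)) z\<bar> \<le> 2 * exp M * (heat r \<delta> z + l * r * N)" for z
  proof -
    define k where "k = \<phi> z"
    have k: "k \<le> M" using \<phi>M[of z] unfolding k_def by simp
    have F_int: "integrable gauss (\<lambda>y. F (z + r *\<^sub>R y))"
      by (rule gauss_integrable_range[where a = "- M" and b = M]) (use F in auto)
    have expF_int: "integrable gauss (\<lambda>y. exp (F (z + r *\<^sub>R y)))"
      by (rule gauss_integrable_range[where a = "exp (- M)" and b = "exp M"]) (use expF in auto)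
    have \<delta>_int: "integrable gauss (\<lambda>y. \<delta> (z + r *\<^sub>R y))"
      by (rule gauss_integrable_range[where a = 0 and b = "2 * M"]) (use \<delta> in auto)
    define A where "A = (\<integral>y. \<bar>F (z + r *\<^sub>R y) - k\<bar> \<partial>gauss)"
    have "\<bar>heat r F z - k\<bar> \<le> A"
    proof -
      have "heat r F z - k = (\<integral>y. F (z + r *\<^sub>R y) - k \<partial>gauss)"
        unfolding heat_def using F_int by simp
      then show ?thesis unfolding A_def using integral_norm_bound[of gauss "\<lambda>y. F (z + r *\<^sub>R y) - k"] by simp
    qed
    then have 1: "\<bar>exp (heat r F z) - exp k\<bar> \<le> exp M * A"
      using exp_diff_le[of "heat r F z" M k] heatF[of z] k by (smt (verit) atLeastAtMost_iff exp_gt_zero mult_left_mono)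
    have 2: "\<bar>heat r (\<lambda>x. exp (F x)) z - exp k\<bar> \<le> exp M * A"
    proof -
      have eq: "heat r (\<lambda>x. exp (F x)) z - exp k = (\<integral>y. exp (F (z + r *\<^sub>R y)) - exp k \<partial>gauss)"
        unfolding heat_def using expF_int by simp
      have "\<bar>heat r (\<lambda>x. exp (F x)) z - exp k\<bar> \<le> (\<integral>y. \<bar>exp (F (z + r *\<^sub>R y)) - exp k\<bar> \<partial>gauss)"
        unfolding eq using integral_norm_bound[of gauss "\<lambda>y. exp (F (z + r *\<^sub>R y)) - exp k"] by simp
      also have "\<dots> \<le> (\<integral>y. exp M * \<bar>F (z + r *\<^sub>R y) - k\<bar> \<partial>gauss)"
        using F_int expF_int F k exp_diff_le by (intro integral_mono) auto
      also have "\<dots> = exp M * A" unfolding A_def by simp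
      finally show ?thesis .
    qed
    have "A \<le> (\<integral>y. \<delta> (z + r *\<^sub>R y) + l * r * norm y \<partial>gauss)"
      unfolding A_def
    proof (rule integral_mono)
      fix y
      have "\<bar>\<phi> (z + r *\<^sub>R y) - k\<bar> \<le> l * (r * norm y)"
        using lipschitz_onD[OF \<phi>, of "z + r *\<^sub>R y" z] r unfolding k_def by (simp add: dist_norm)
      then show "\<bar>F (z + r *\<^sub>R y) - k\<bar> \<le> \<delta> (z + r *\<^sub>R y) + l * r * norm y"
        unfolding \<delta>_def by simp
    qed (use F_int \<delta>_int norm_int in auto)
    also have "\<dots> = heat r \<delta> z + l * r * N"
      unfolding heat_def N_def using \<delta>_int norm_int by simp
    finally have "exp M * A \<le> exp M * (heat r \<delta> z + l * r * N)" by (intro mult_left_mono) auto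
    then have "\<bar>exp (heat r F z) - heat r (\<lambda>x. exp (F x)) z\<bar> \<le> 2 * (exp M * (heat r \<delta> z + l * r * N))"
      using 1 2 by linarith
    then show ?thesis by (simp only: mult.assoc)
  qed
  have eq: "heat t (heat r (\<lambda>x. exp (F x))) = heat 1 (\<lambda>x. exp (F x))"
    unfolding t_def by (rule heat_heat_complement[OF _ expF r]) simp
  have eq\<delta>: "heat t (heat r \<delta>) = heat 1 \<delta>"
    unfolding t_def by (rule heat_heat_complement[OF _ \<delta> r]) simp
  have int1: "integrable gauss (\<lambda>y. exp (heat r F (t *\<^sub>R y)))"
    by (rule gauss_integrable_range[where a = "exp (- M)" and b = "exp M"]) (use exp_heatF in auto)
  have int2: "integrable gauss (\<lambda>y. heat r (\<lambda>x. exp (F x)) (t *\<^sub>R y))"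
    by (rule gauss_integrable_range[where a = "exp (- M)" and b = "exp M"]) (use heat_expF in auto)
  have int3: "integrable gauss (\<lambda>y. heat r \<delta> (t *\<^sub>R y))"
    by (rule gauss_integrable_range[where a = 0 and b = "2 * M"]) (use heat_range[OF \<delta>_meas \<delta>] in auto)
  have diff: "heat t (\<lambda>x. exp (heat r F x)) 0 - heat 1 (\<lambda>x. exp (F x)) 0
      = (\<integral>y. exp (heat r F (t *\<^sub>R y)) - heat r (\<lambda>x. exp (F x)) (t *\<^sub>R y) \<partial>gauss)"
    unfolding eq[symmetric] using int1 int2 by (simp add: heat_def[of t])
  have "\<bar>heat t (\<lambda>x. exp (heat r F x)) 0 - heat 1 (\<lambda>x. exp (F x)) 0\<bar> \<le> (\<integral>y. \<bar>exp (heat r F (t *\<^sub>R y)) - heat r (\<lambda>x. exp (F x)) (t *\<^sub>R y)\<bar> \<partial>gauss)"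
    unfolding diff using integral_norm_bound[of gauss "\<lambda>y. exp (heat r F (t *\<^sub>R y)) - heat r (\<lambda>x. exp (F x)) (t *\<^sub>R y)"] by simp
  also have "\<dots> \<le> (\<integral>y. 2 * exp M * (heat r \<delta> (t *\<^sub>R y) + l * r * N) \<partial>gauss)"
    using int1 int2 int3 pointwise by (intro integral_mono) auto
  also have "\<dots> = 2 * exp M * (heat t (heat r \<delta>) 0 + l * r * N)"
    using int3 by (simp add: heat_def[of t])
  also have "heat t (heat r \<delta>) 0 = (\<integral>x. \<bar>F x - \<phi> x\<bar> \<partial>gauss)"
    unfolding eq\<delta> by (simp add: heat_def \<delta>_def)
  finally show ?thesis unfolding t_def N_def .
qed

lemma heat_exp_heat_tendsto:
  fixes F :: "'a::euclidean_space \<Rightarrow> real"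
  assumes F_meas [measurable]: "F \<in> borel_measurable borel" and F: "\<And>x. F x \<in> {- M..M}"
  shows "((\<lambda>r. heat (sqrt (1 - r\<^sup>2)) (\<lambda>x. exp (heat r F x)) 0) \<longlongrightarrow> heat 1 (\<lambda>x. exp (F x)) 0) (at_right 0)"
proof (rule tendstoI)
  fix e :: real assume e: "0 < e"
  define e' where "e' = e / (4 * exp M)"
  have e': "0 < e'" unfolding e'_def using e by simp
  have F_int: "integrable gauss F" by (rule gauss_integrable_range[OF F_meas F])
  obtain l \<phi> where \<phi>: "l-lipschitz_on UNIV \<phi>" "(\<integral>x. \<bar>F x - \<phi> x\<bar> \<partial>gauss) \<le> e'"
    using gauss_lipschitz_dense[OF F_int e'] by blast
  \<comment> \<open>Clamping to the range of \<open>F\<close> keeps the Lipschitz constant, does not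
    increase the distance to \<open>F\<close>, and supplies the upper bound needed to compare
    exponentials.\<close>
  define \<psi> where "\<psi> x = max (- M) (min M (\<phi> x))" for x
  have M: "0 \<le> M" using F[of 0] by simp
  have \<psi>M: "\<psi> x \<in> {- M..M}" for x unfolding \<psi>_def using M by auto
  have \<psi>_lip: "l-lipschitz_on UNIV \<psi>"
  proof (rule lipschitz_onI)
    show "dist (\<psi> x) (\<psi> y) \<le> l * dist x y" for x y
      using lipschitz_onD[OF \<phi>(1), of x y] unfolding \<psi>_def dist_real_def by auto
  qed (rule lipschitz_on_nonneg[OF \<phi>(1)])
  have "(\<integral>x. \<bar>F x - \<psi> x\<bar> \<partial>gauss) \<le> (\<integral>x. \<bar>F x - \<phi> x\<bar> \<partial>gauss)"
  proof (rule integral_mono)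
    show "\<bar>F x - \<psi> x\<bar> \<le> \<bar>F x - \<phi> x\<bar>" for x using F[of x] unfolding \<psi>_def by auto
  qed (use F_int lipschitz_gauss_integrable[OF \<phi>(1)] lipschitz_gauss_integrable[OF \<psi>_lip] in auto)
  then have \<psi>: "(\<integral>x. \<bar>F x - \<psi> x\<bar> \<partial>gauss) \<le> e'" using \<phi>(2) by simp
  define N where "N = (\<integral>x. norm x \<partial>(gauss :: 'a measure))"
  have "((\<lambda>r. l * r * N) \<longlongrightarrow> l * 0 * N) (at_right 0)" by (intro tendsto_intros)
  then have "\<forall>\<^sub>F r in at_right 0. l * r * N < e'"
    using e' by (intro order_tendstoD) auto
  moreover have "\<forall>\<^sub>F r in at_right 0. r \<in> {0<..<1::real}"
    by (rule eventually_at_right_real) simp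
  ultimately show "\<forall>\<^sub>F r in at_right 0. dist (heat (sqrt (1 - r\<^sup>2)) (\<lambda>x. exp (heat r F x)) 0) (heat 1 (\<lambda>x. exp (F x)) 0) < e"
  proof eventually_elim
    case (elim r)
    have "dist (heat (sqrt (1 - r\<^sup>2)) (\<lambda>x. exp (heat r F x)) 0) (heat 1 (\<lambda>x. exp (F x)) 0)
        \<le> 2 * exp M * ((\<integral>x. \<bar>F x - \<psi> x\<bar> \<partial>gauss) + l * r * N)"
      unfolding dist_real_def N_def using elim by (intro heat_exp_heat_bound F \<psi>_lip \<psi>M) auto
    also have "\<dots> < 2 * exp M * (e' + e')"
      using \<psi> elim by (intro mult_strict_left_mono add_le_less_mono) auto
    also have "\<dots> = e" unfolding e'_def by simp
    finally show ?case .
  qed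
qed

lemma AE_gauss_iff_lborel: "(AE x in gauss. P x) \<longleftrightarrow> (AE x in lborel. P x)"
  unfolding gauss_def by (subst AE_density) auto

text \<open>Gaussian null sets are Lebesgue null sets, and these are preserved by invertible affine
  maps. So an inequality valid almost everywhere may be averaged around every centre
  \<open>x\<close>.\<close>

lemma AE_gauss_affine:
  assumes r: "r \<noteq> 0" and ae: "AE x in gauss. P x" and [measurable]: "Measurable.pred borel P"
  shows "AE y in gauss. P (x + r *\<^sub>R y)"
proof -
  have "AE z in density (distr lborel borel (\<lambda>y. x + r *\<^sub>R y)) (\<lambda>_. ennreal (\<bar>r\<bar> ^ DIM('a))). P z"
    using ae r unfolding AE_gauss_iff_lborel by (subst (asm) lborel_affine[of r x]) (auto simp: ennreal_power)
  then show ?thesis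
    unfolding AE_gauss_iff_lborel using r by (auto simp: AE_density AE_distr_iff)
qed

context projection_datum
begin

text \<open>Averaging \<open>ln f\<^sub>i\<close> but \<open>g\<^sub>j\<close> itself over a short time \<open>r\<^sup>2\<close> keeps the inequality, by Jensen, and
  makes it hold everywhere between tame functions; the flow then runs for time \<open>1 - r\<^sup>2\<close>.\<close>
lemma bounded_log_inequality:
  assumes f: "\<And>i. i \<in> I \<Longrightarrow> f i \<in> borel_measurable borel" "\<And>i x. i \<in> I \<Longrightarrow> f i x \<in> {exp (- M)..exp M}"
      "\<And>i. i \<in> I \<Longrightarrow> invariant (Q i) (f i)"
    and g: "\<And>j. j \<in> J \<Longrightarrow> g j \<in> borel_measurable borel" "\<And>j x. j \<in> J \<Longrightarrow> g j x \<in> {exp (- M)..exp M}"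
      "\<And>j. j \<in> J \<Longrightarrow> invariant (R j) (g j)"
    and le: "AE x in gauss. (\<Sum>i\<in>I. c i * ln (f i x)) \<le> (\<Sum>j\<in>J. d j * ln (g j x))"
  shows "(\<Sum>i\<in>I. c i * ln (\<integral>x. f i x \<partial>gauss)) \<le> (\<Sum>j\<in>J. d j * ln (\<integral>x. g j x \<partial>gauss))"
proof -
  define F where "F i x = ln (f i x)" for i x
  have F_meas [measurable]: "F i \<in> borel_measurable borel" if "i \<in> I" for i
    unfolding F_def using f(1)[OF that] by measurable
  have F: "F i x \<in> {- M..M}" if "i \<in> I" for i x
    using f(2)[OF that, of x] unfolding F_def
    by (metis atLeastAtMost_iff exp_gt_zero ln_exp ln_mono order_less_le_trans)
  have G: "ln (g j x) \<in> {- M..M}" if "j \<in> J" for j x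
    using g(2)[OF that, of x]
    by (metis atLeastAtMost_iff exp_gt_zero ln_exp ln_mono order_less_le_trans)
  have expF: "exp (F i x) = f i x" if "i \<in> I" for i x
    using f(2)[OF that, of x] unfolding F_def by (auto intro!: exp_ln intro: less_le_trans[OF exp_gt_zero])
  have [measurable]: "Measurable.pred borel (\<lambda>x. (\<Sum>i\<in>I. c i * ln (f i x)) \<le> (\<Sum>j\<in>J. d j * ln (g j x)))"
    using f(1) g(1) by measurable
  have smoothed: "(\<Sum>i\<in>I. c i * ln (heat (sqrt (1 - r\<^sup>2)) (\<lambda>x. exp (heat r (F i) x)) 0))
      \<le> (\<Sum>j\<in>J. d j * ln (heat 1 (g j) 0))" if r: "0 < r" "r < 1" for r
  proof -
    define t where "t = sqrt (1 - r\<^sup>2)"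
    have t: "0 < t" "t \<le> 1" unfolding t_def using r by (auto simp: power_less_one_iff)
    obtain L K where K: "0 \<le> K" and tame: "\<And>F :: 'a \<Rightarrow> real. F \<in> borel_measurable borel \<Longrightarrow> (\<And>x. F x \<in> {- M..M}) \<Longrightarrow>
        \<exists>q. tame (- M) M L K (heat r F) q"
      using tame_heat_bounded[OF r(1), of M, where 'a = 'a] by metis
    \<comment> \<open>The constant of \<open>tame_exp\<close> at \<open>a = - M\<close> and
      \<open>b = M\<close>; the form \<open>M - - M\<close> is kept in order to match it.\<close>
    define K' where "K' = exp M * ((L + K + M - - M)\<^sup>2 * exp (M - - M) + K)"
    have K': "0 \<le> K'" unfolding K'_def using K by simp
    have "(\<Sum>i\<in>I. c i * ln (heat t (\<lambda>x. exp (heat r (F i) x)) 0)) \<le> (\<Sum>j\<in>J. d j * ln (heat t (heat r (g j)) 0))"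
    proof (rule heat_monotone[where a = "exp (- M)" and b = "exp M" and L = "exp M * L" and K = K'])
      show "\<exists>q. tame (exp (- M)) (exp M) (exp M * L) K' (\<lambda>x. exp (heat r (F i) x)) q" if i: "i \<in> I" for i
      proof -
        obtain q where "tame (- M) M L K (heat r (F i)) q"
          using tame[OF F_meas[OF i] F[OF i]] by blast
        from tame_exp[OF this K] show ?thesis unfolding K'_def by - (rule exI, assumption)
      qed
      show "invariant (Q i) (\<lambda>x. exp (heat r (F i) x))" if "i \<in> I" for i
        unfolding F_def using f(3)[OF that] by (intro invariant_comp[where h = exp] invariant_heat invariant_comp[where h = ln])
      show "heat r (g j) \<in> borel_measurable borel" if "j \<in> J" for j
        using g(1)[OF that] by (rule heat_measurable)
      show "heat r (g j) x \<in> {exp (- M)..exp M}" if "j \<in> J" for j x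
        using g(1,2)[OF that] by (rule heat_range)
      show "invariant (R j) (heat r (g j))" if "j \<in> J" for j
        using g(3)[OF that] by (rule invariant_heat)
      fix x
      have F_int: "integrable gauss (\<lambda>y. F i (x + r *\<^sub>R y))" if "i \<in> I" for i
        by (rule gauss_integrable_range[where a = "- M" and b = M]) (use F F_meas that in auto)
      have G_int: "integrable gauss (\<lambda>y. ln (g j (x + r *\<^sub>R y)))" if "j \<in> J" for j
        by (rule gauss_integrable_range[where a = "- M" and b = M]) (use G g(1) that in auto)
      have "(\<Sum>i\<in>I. c i * heat r (F i) x) = (\<integral>y. (\<Sum>i\<in>I. c i * F i (x + r *\<^sub>R y)) \<partial>gauss)"
        unfolding heat_def using F_int by (subst Bochner_Integration.integral_sum) auto
      also have "\<dots> \<le> (\<integral>y. (\<Sum>j\<in>J. d j * ln (g j (x + r *\<^sub>R y))) \<partial>gauss)"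
      proof (rule integral_mono_AE)
        show "AE y in gauss. (\<Sum>i\<in>I. c i * F i (x + r *\<^sub>R y)) \<le> (\<Sum>j\<in>J. d j * ln (g j (x + r *\<^sub>R y)))"
          unfolding F_def using r by (intro AE_gauss_affine[OF _ le]) auto
      qed (use F_int G_int in auto)
      also have "\<dots> = (\<Sum>j\<in>J. d j * heat r (\<lambda>x. ln (g j x)) x)"
        unfolding heat_def using G_int by (subst Bochner_Integration.integral_sum) auto
      \<comment> \<open>The variational bound with translation 0, which is plain Jensen.\<close>
      also have "\<dots> \<le> (\<Sum>j\<in>J. d j * ln (heat r (g j) x))"
      proof (intro sum_mono mult_left_mono)
        fix j assume j: "j \<in> J"
        show "heat r (\<lambda>x. ln (g j x)) x \<le> ln (heat r (g j) x)"
          using heat_ln_le_ln_heat[OF g(1,2)[OF j], of r x 0] j by simp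
      qed (simp add: d_pos less_imp_le)
      finally show "(\<Sum>i\<in>I. c i * ln (exp (heat r (F i) x))) \<le> (\<Sum>j\<in>J. d j * ln (heat r (g j) x))"
        by simp
    qed (use K' t in auto)
    moreover have "heat t (heat r (g j)) = heat 1 (g j)" if "j \<in> J" for j
      unfolding t_def using heat_heat_complement[OF g(1,2)[OF that] r] that by simp
    ultimately show ?thesis unfolding t_def by simp
  qed
  \<comment> \<open>In \<open>smoothed\<close> the right side is free of \<open>r\<close>, since the
    \<open>g j\<close> were averaged themselves and the semigroup law applies. Only the left side
    needs the limit \<open>r \<rightarrow> 0\<close>.\<close>
  have "((\<lambda>r. \<Sum>i\<in>I. c i * ln (heat (sqrt (1 - r\<^sup>2)) (\<lambda>x. exp (heat r (F i) x)) 0))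
      \<longlongrightarrow> (\<Sum>i\<in>I. c i * ln (heat 1 (\<lambda>x. exp (F i x)) 0))) (at_right 0)"
  proof (intro tendsto_intros heat_exp_heat_tendsto[where M = M] F_meas F)
    fix i assume i: "i \<in> I"
    have "heat 1 (\<lambda>x. exp (F i x)) 0 \<in> {exp (- M)..exp M}"
      by (rule heat_range) (use F[OF i] F_meas[OF i] in auto)
    then show "heat 1 (\<lambda>x. exp (F i x)) 0 \<noteq> 0" by (auto simp: not_le)
  qed
  moreover have "\<forall>\<^sub>F r in at_right 0. (\<Sum>i\<in>I. c i * ln (heat (sqrt (1 - r\<^sup>2)) (\<lambda>x. exp (heat r (F i) x)) 0))
      \<le> (\<Sum>j\<in>J. d j * ln (heat 1 (g j) 0))"
    using eventually_at_right_real[of 0 1] smoothed by (auto elim!: eventually_mono)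
  ultimately have "(\<Sum>i\<in>I. c i * ln (heat 1 (\<lambda>x. exp (F i x)) 0)) \<le> (\<Sum>j\<in>J. d j * ln (heat 1 (g j) 0))"
    by (intro tendsto_upperbound) auto
  then show ?thesis using expF by (simp add: heat_def)
qed

end

section \<open>Truncation\<close>

lemma prod_powr_eq_exp:
  fixes f :: "'i \<Rightarrow> real"
  assumes "\<And>i. i \<in> I \<Longrightarrow> 0 < f i"
  shows "(\<Prod>i\<in>I. f i powr c i) = exp (\<Sum>i\<in>I. c i * ln (f i))"
proof -
  have "(\<Prod>i\<in>I. f i powr c i) = (\<Prod>i\<in>I. exp (c i * ln (f i)))"
  proof (intro prod.cong refl)
    fix i assume "i \<in> I"
    then have "f i \<noteq> 0" using assms by force
    then show "f i powr c i = exp (c i * ln (f i))" by (simp add: powr_def)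
  qed
  then show ?thesis by (cases "finite I") (simp_all add: exp_sum)
qed

lemma prod_powr_const: "0 < (b::real) \<Longrightarrow> (\<Prod>i\<in>I. b powr c i) = b powr sum c I"
  by (subst prod_powr_eq_exp) (simp_all add: powr_def sum_distrib_right)

text \<open>One factor is kept and the others are replaced by their bound, so a single tiny factor
  makes the whole product tiny. Since \<open>1 \<le> b\<close>, the exponent may be enlarged to the
  full sum, which is the same for every \<open>i\<close>.\<close>

lemma prod_powr_le_remove:
  fixes f c :: "'i \<Rightarrow> real"
  assumes "finite I" "i \<in> I" and c: "\<And>k. k \<in> I \<Longrightarrow> 0 \<le> c k"
    and f: "\<And>k. k \<in> I \<Longrightarrow> 0 \<le> f k" "\<And>k. k \<in> I \<Longrightarrow> f k \<le> b" and b: "1 \<le> b"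
  shows "(\<Prod>k\<in>I. f k powr c k) \<le> f i powr c i * b powr sum c I"
proof -
  have "(\<Prod>k\<in>I. f k powr c k) = f i powr c i * (\<Prod>k\<in>I - {i}. f k powr c k)"
    using assms by (intro prod.remove)
  also have "\<dots> \<le> f i powr c i * (\<Prod>k\<in>I - {i}. b powr c k)"
    using c f by (intro mult_left_mono prod_mono) (auto intro: powr_mono2)
  also have "\<dots> = f i powr c i * b powr sum c (I - {i})"
    using b by (simp add: prod_powr_const)
  also have "\<dots> \<le> f i powr c i * b powr sum c I"
    using assms by (intro mult_left_mono powr_mono sum_mono2) auto
  finally show ?thesis .
qed

lemma prod_powr_ge_remove:
  fixes f c :: "'i \<Rightarrow> real"
  assumes "finite I" "i \<in> I" and c: "\<And>k. k \<in> I \<Longrightarrow> 0 \<le> c k"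
    and f: "\<And>k. k \<in> I \<Longrightarrow> b \<le> f k" and b: "0 < b" "b \<le> 1"
  shows "f i powr c i * b powr sum c I \<le> (\<Prod>k\<in>I. f k powr c k)"
proof -
  have "f i powr c i * b powr sum c I \<le> f i powr c i * b powr sum c (I - {i})"
    using assms by (intro mult_left_mono powr_mono' sum_mono2) auto
  also have "\<dots> = f i powr c i * (\<Prod>k\<in>I - {i}. b powr c k)"
    using b by (simp add: prod_powr_const)
  also have "\<dots> \<le> f i powr c i * (\<Prod>k\<in>I - {i}. f k powr c k)"
    using c f b by (intro mult_left_mono prod_mono) (auto intro: powr_mono2)
  also have "\<dots> = (\<Prod>k\<in>I. f k powr c k)"
    using assms by (intro prod.remove[symmetric])
  finally show ?thesis .
qed

lemma ennreal_powr_ennreal: "0 \<le> a \<Longrightarrow> ennreal_powr (ennreal a) c = ennreal (a powr c)"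
  by (simp add: ennreal_powr_def)

lemma ennreal_powr_eq_0_iff: "ennreal_powr a c = 0 \<longleftrightarrow> a = 0"
  by (cases a) (auto simp: ennreal_powr_def)

lemma tendsto_ennreal_powr:
  assumes X: "(X \<longlongrightarrow> a) F" and c: "0 < c"
  shows "((\<lambda>n. ennreal_powr (X n) c) \<longlongrightarrow> ennreal_powr a c) F"
proof (cases a)
  case top
  have "((\<lambda>n. ennreal_powr (X n) c) \<longlongrightarrow> top) F"
    unfolding tendsto_top_iff_ennreal
  proof (intro allI impI)
    fix l :: real assume l: "0 \<le> l"
    have "\<forall>\<^sub>F n in F. ennreal (l powr (1 / c)) < X n"
      using order_tendstoD(1)[OF X] top by simp
    then show "\<forall>\<^sub>F n in F. ennreal l < ennreal_powr (X n) c"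
    proof eventually_elim
      case (elim n)
      show ?case
      proof (cases "X n")
        case (real x)
        then have "l powr (1 / c) < x" using elim by (simp add: ennreal_less_iff)
        then have "(l powr (1 / c)) powr c < x powr c" using c by (intro powr_less_mono2) auto
        then show ?thesis using l c real by (simp add: powr_powr ennreal_powr_ennreal ennreal_less_iff)
      qed (simp add: ennreal_powr_def)
    qed
  qed
  then show ?thesis using top by (simp add: ennreal_powr_def)
next
  case (real r)
  have fin: "\<forall>\<^sub>F n in F. X n < top"
    using X real by (intro order_tendstoD(2)) auto
  have "((\<lambda>n. enn2real (X n)) \<longlongrightarrow> r) F"
    using X real by (intro tendsto_enn2real) auto
  then have "((\<lambda>n. enn2real (X n) powr c) \<longlongrightarrow> r powr c) F"
    using c by (intro tendsto_powr'[OF _ tendsto_const]) auto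
  then have "((\<lambda>n. ennreal (enn2real (X n) powr c)) \<longlongrightarrow> ennreal (r powr c)) F"
    by (rule tendsto_ennrealI)
  moreover have "\<forall>\<^sub>F n in F. ennreal (enn2real (X n) powr c) = ennreal_powr (X n) c"
    using fin by eventually_elim (simp add: ennreal_powr_def)
  ultimately show ?thesis
    using real by (simp add: ennreal_powr_ennreal tendsto_cong)
qed

text \<open>Multiplication on [0, \<infinity>] is discontinuous at 0 times \<infinity>; nonzero
  limits keep away from that point.\<close>

lemma tendsto_prod_ennreal_pos:
  fixes X :: "'n \<Rightarrow> 'i \<Rightarrow> ennreal"
  assumes "finite I" "\<And>i. i \<in> I \<Longrightarrow> ((\<lambda>n. X n i) \<longlongrightarrow> a i) F" "\<And>i. i \<in> I \<Longrightarrow> a i \<noteq> 0"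
  shows "((\<lambda>n. \<Prod>i\<in>I. X n i) \<longlongrightarrow> (\<Prod>i\<in>I. a i)) F"
  using assms
proof (induction I)
  case (insert i I)
  have "((\<lambda>n. X n i * (\<Prod>i\<in>I. X n i)) \<longlongrightarrow> a i * (\<Prod>i\<in>I. a i)) F"
    using insert by (intro tendsto_mult_ennreal) auto
  then show ?case using insert by simp
qed simp

context projection_datum
begin

text \<open>The left functions are clamped to \<open>{\<epsilon>..M}\<close>, the right ones to
  \<open>{\<eta>..B}\<close>. Given \<open>M\<close> and \<open>\<eta>\<close>, \<epsilon> is so
  small that one factor raised to \<epsilon> puts the left product below
  \<open>\<eta> powr sum d J\<close>, the least value on the right; \<open>B\<close> is so large
  that one factor cut at \<open>B\<close> puts the right product above
  \<open>M powr sum c I\<close>, the largest value on the left. Otherwise clamping lowers the left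
  and raises the right. Neither \<epsilon> nor \<open>B\<close> survives in the conclusion, because
  the clamped functions lie above \<open>min M (\<rho> i x)\<close> and below
  \<open>\<sigma> j x + \<eta>\<close>.\<close>

lemma truncated_inequality:
  assumes \<rho>: "\<And>i. i \<in> I \<Longrightarrow> \<rho> i \<in> borel_measurable borel" "\<And>i x. i \<in> I \<Longrightarrow> 0 \<le> \<rho> i x"
      "\<And>i. i \<in> I \<Longrightarrow> invariant (Q i) (\<rho> i)"
    and \<sigma>: "\<And>j. j \<in> J \<Longrightarrow> integrable gauss (\<sigma> j)" "\<And>j x. j \<in> J \<Longrightarrow> 0 \<le> \<sigma> j x"
      "\<And>j. j \<in> J \<Longrightarrow> invariant (R j) (\<sigma> j)"
    and le: "AE x in gauss. (\<Prod>i\<in>I. \<rho> i x powr c i) \<le> (\<Prod>j\<in>J. \<sigma> j x powr d j)"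
    and M: "1 \<le> M" and \<eta>: "0 < \<eta>" "\<eta> \<le> 1"
  shows "(\<Prod>i\<in>I. (\<integral>x. min M (\<rho> i x) \<partial>gauss) powr c i) \<le> (\<Prod>j\<in>J. ((\<integral>x. \<sigma> j x \<partial>gauss) + \<eta>) powr d j)"
proof -
  have \<sigma>_meas [measurable]: "\<sigma> j \<in> borel_measurable borel" if "j \<in> J" for j
    using borel_measurable_integrable[OF \<sigma>(1)[OF that]] by (simp add: measurable_cong_sets[OF sets_gauss refl])
  have c0: "0 \<le> c i" if "i \<in> I" for i using c_pos[OF that] by simp
  have d0: "0 \<le> d j" if "j \<in> J" for j using d_pos[OF that] by simp
  have "\<forall>\<^sub>F \<epsilon> in at_right 0. \<forall>i\<in>I. \<epsilon> powr c i * M powr sum c I < \<eta> powr sum d J"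
  proof (intro eventually_ball_finite finite_I ballI)
    fix i assume i: "i \<in> I"
    have "((\<lambda>\<epsilon>. \<epsilon> powr c i * M powr sum c I) \<longlongrightarrow> 0 powr c i * M powr sum c I) (at_right 0)"
      using c_pos[OF i] by (intro tendsto_intros tendsto_powr') (auto simp: eventually_at_right_less intro: eventually_mono[OF eventually_at_right_less])
    then show "\<forall>\<^sub>F \<epsilon> in at_right 0. \<epsilon> powr c i * M powr sum c I < \<eta> powr sum d J"
      using \<eta> by (intro order_tendstoD(2)) auto
  qed
  moreover have "\<forall>\<^sub>F \<epsilon> in at_right 0. \<epsilon> \<in> {0<..<1::real}"
    by (rule eventually_at_right_real) simp
  ultimately have "\<forall>\<^sub>F \<epsilon> in at_right 0. (\<forall>i\<in>I. \<epsilon> powr c i * M powr sum c I < \<eta> powr sum d J) \<and> \<epsilon> \<in> {0<..<1}"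
    by (rule eventually_conj)
  then have "\<exists>\<epsilon>. (\<forall>i\<in>I. \<epsilon> powr c i * M powr sum c I < \<eta> powr sum d J) \<and> \<epsilon> \<in> {0<..<1}"
    by (rule eventually_happens'[OF trivial_limit_at_right_real])
  then obtain \<epsilon> where \<epsilon>: "0 < \<epsilon>" "\<epsilon> < 1" "\<And>i. i \<in> I \<Longrightarrow> \<epsilon> powr c i * M powr sum c I < \<eta> powr sum d J"
    by auto
  have "\<forall>\<^sub>F B in at_top. \<forall>j\<in>J. M powr sum c I / \<eta> powr sum d J \<le> B powr d j"
  proof (intro eventually_ball_finite finite_J ballI)
    fix j assume j: "j \<in> J"
    define k where "k = M powr sum c I / \<eta> powr sum d J"
    have k: "0 < k" unfolding k_def using M \<eta> by simp
    have "\<forall>\<^sub>F B in at_top. k powr (1 / d j) \<le> B" by (rule eventually_ge_at_top)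
    then show "\<forall>\<^sub>F B in at_top. M powr sum c I / \<eta> powr sum d J \<le> B powr d j"
    proof eventually_elim
      case (elim B)
      then have "(k powr (1 / d j)) powr d j \<le> B powr d j"
        using d_pos[OF j] by (intro powr_mono2) auto
      then show ?case unfolding k_def[symmetric] using k d_pos[OF j] by (simp add: powr_powr)
    qed
  qed
  then have "\<forall>\<^sub>F B in at_top. (\<forall>j\<in>J. M powr sum c I / \<eta> powr sum d J \<le> B powr d j) \<and> 1 \<le> B"
    by (intro eventually_conj eventually_ge_at_top)
  then have "\<exists>B. (\<forall>j\<in>J. M powr sum c I / \<eta> powr sum d J \<le> B powr d j) \<and> 1 \<le> B"
    by (rule eventually_happens'[OF trivial_limit_at_top_linorder])
  then obtain B where B: "1 \<le> B" "\<And>j. j \<in> J \<Longrightarrow> M powr sum c I / \<eta> powr sum d J \<le> B powr d j"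
    by auto
  define f where "f i x = max \<epsilon> (min M (\<rho> i x))" for i x
  define g where "g j x = max \<eta> (min B (\<sigma> j x))" for j x
  have f_range: "f i x \<in> {\<epsilon>..M}" for i x unfolding f_def using \<epsilon> M by auto
  have g_range: "g j x \<in> {\<eta>..B}" for j x unfolding g_def using \<eta> B by auto
  have f_pos: "0 < f i x" for i x using f_range[of i x] \<epsilon> by auto
  have g_pos: "0 < g j x" for j x using g_range[of j x] \<eta> by auto
  have [measurable]: "f i \<in> borel_measurable borel" if "i \<in> I" for i unfolding f_def using \<rho>(1)[OF that] by measurable
  have [measurable]: "g j \<in> borel_measurable borel" if "j \<in> J" for j unfolding g_def using \<sigma>_meas[OF that] by measurable
  have clamp: "(\<Prod>i\<in>I. f i x powr c i) \<le> (\<Prod>j\<in>J. g j x powr d j)"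
    if x: "(\<Prod>i\<in>I. \<rho> i x powr c i) \<le> (\<Prod>j\<in>J. \<sigma> j x powr d j)" for x
  proof (cases "\<exists>j\<in>J. B < \<sigma> j x")
    case True
    then obtain j where j: "j \<in> J" "B < \<sigma> j x" by blast
    then have gj: "g j x = B" unfolding g_def using B \<eta> by auto
    have "(\<Prod>i\<in>I. f i x powr c i) \<le> (\<Prod>i\<in>I. M powr c i)"
      using f_range f_pos c0 by (intro prod_mono) (auto intro!: powr_mono2 simp: less_imp_le)
    also have "\<dots> = M powr sum c I" using M by (simp add: prod_powr_const)
    also have "\<dots> \<le> g j x powr d j * \<eta> powr sum d J"
      unfolding gj using B(2)[OF j(1)] \<eta> by (simp add: field_simps)
    also have "\<dots> \<le> (\<Prod>j\<in>J. g j x powr d j)"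
      using g_range d0 \<eta> j finite_J by (intro prod_powr_ge_remove) auto
    finally show ?thesis .
  next
    case \<sigma>B: False
    show ?thesis
    proof (cases "\<exists>i\<in>I. min M (\<rho> i x) < \<epsilon>")
      case True
      then obtain i where i: "i \<in> I" "min M (\<rho> i x) < \<epsilon>" by blast
      then have fi: "f i x = \<epsilon>" unfolding f_def by auto
      have "(\<Prod>i\<in>I. f i x powr c i) \<le> f i x powr c i * M powr sum c I"
        using f_range f_pos c0 M i finite_I by (intro prod_powr_le_remove) (auto simp: less_imp_le)
      also have "\<dots> \<le> \<eta> powr sum d J" unfolding fi using \<epsilon>(3)[OF i(1)] by simp
      also have "\<dots> = (\<Prod>j\<in>J. \<eta> powr d j)" using \<eta> by (simp add: prod_powr_const)
      also have "\<dots> \<le> (\<Prod>j\<in>J. g j x powr d j)"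
        using g_range d0 \<eta> by (intro prod_mono) (auto intro!: powr_mono2)
      finally show ?thesis .
    next
      case False
      then have fi: "f i x \<le> \<rho> i x" if "i \<in> I" for i unfolding f_def using that by force
      have gj: "\<sigma> j x \<le> g j x" if "j \<in> J" for j unfolding g_def using that \<sigma>B by force
      have "(\<Prod>i\<in>I. f i x powr c i) \<le> (\<Prod>i\<in>I. \<rho> i x powr c i)"
        using fi f_pos c0 by (intro prod_mono) (auto intro!: powr_mono2 simp: less_imp_le)
      also have "\<dots> \<le> (\<Prod>j\<in>J. \<sigma> j x powr d j)" by (rule x)
      also have "\<dots> \<le> (\<Prod>j\<in>J. g j x powr d j)"
        using gj \<sigma>(2) d0 by (intro prod_mono) (auto intro!: powr_mono2)
      finally show ?thesis .
    qed
  qed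
  \<comment> \<open>One symmetric range for all logarithms, as \<open>bounded_log_inequality\<close>
    expects.\<close>
  define m where "m = Max {- ln \<epsilon>, - ln \<eta>, ln M, ln B}"
  have m: "- ln \<epsilon> \<le> m" "- ln \<eta> \<le> m" "ln M \<le> m" "ln B \<le> m" unfolding m_def by auto
  have m_bounds: "exp (- m) \<le> \<epsilon>" "exp (- m) \<le> \<eta>" "M \<le> exp m" "B \<le> exp m"
    using m \<epsilon> \<eta> M B exp_le_cancel_iff[of "- m" "ln \<epsilon>"] exp_le_cancel_iff[of "- m" "ln \<eta>"]
      exp_le_cancel_iff[of "ln M" m] exp_le_cancel_iff[of "ln B" m]
    by simp_all
  have "(\<Sum>i\<in>I. c i * ln (\<integral>x. f i x \<partial>gauss)) \<le> (\<Sum>j\<in>J. d j * ln (\<integral>x. g j x \<partial>gauss))"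
  proof (rule bounded_log_inequality[where M = m])
    show "f i x \<in> {exp (- m)..exp m}" for i x using f_range[of i x] m_bounds by auto
    show "g j x \<in> {exp (- m)..exp m}" for j x using g_range[of j x] m_bounds by auto
    show "invariant (Q i) (f i)" if "i \<in> I" for i
      unfolding f_def by (rule invariant_comp[OF \<rho>(3)[OF that]])
    show "invariant (R j) (g j)" if "j \<in> J" for j
      unfolding g_def by (rule invariant_comp[OF \<sigma>(3)[OF that]])
    show "AE x in gauss. (\<Sum>i\<in>I. c i * ln (f i x)) \<le> (\<Sum>j\<in>J. d j * ln (g j x))"
      using le
    proof eventually_elim
      case (elim x)
      show ?case using clamp[OF elim] f_pos g_pos by (simp add: prod_powr_eq_exp)
    qed
  qed auto
  moreover have f_int_pos: "0 < (\<integral>x. f i x \<partial>gauss)" if "i \<in> I" for i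
    using heat_range[of "f i" \<epsilon> M 1 0] f_range that \<epsilon> by (auto simp: heat_def)
  moreover have g_int_pos: "0 < (\<integral>x. g j x \<partial>gauss)" if "j \<in> J" for j
    using heat_range[of "g j" \<eta> B 1 0] g_range that \<eta> by (auto simp: heat_def)
  ultimately have main: "(\<Prod>i\<in>I. (\<integral>x. f i x \<partial>gauss) powr c i) \<le> (\<Prod>j\<in>J. (\<integral>x. g j x \<partial>gauss) powr d j)"
    by (simp add: prod_powr_eq_exp)
  have f_int: "integrable gauss (f i)" if "i \<in> I" for i
    by (rule gauss_integrable_range[where a = \<epsilon> and b = M]) (use f_range that in auto)
  have g_int: "integrable gauss (g j)" if "j \<in> J" for j
    by (rule gauss_integrable_range[where a = \<eta> and b = B]) (use g_range that in auto)
  have min_range: "min M (\<rho> i x) \<in> {0..M}" if "i \<in> I" for i x using \<rho>(2)[OF that] M by auto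
  have min_int: "integrable gauss (\<lambda>x. min M (\<rho> i x))" if "i \<in> I" for i
    by (rule gauss_integrable_range[where a = 0 and b = M]) (use min_range \<rho>(1) that in auto)
  have "(\<Prod>i\<in>I. (\<integral>x. min M (\<rho> i x) \<partial>gauss) powr c i) \<le> (\<Prod>i\<in>I. (\<integral>x. f i x \<partial>gauss) powr c i)"
  proof (intro prod_mono conjI powr_mono2)
    fix i assume i: "i \<in> I"
    show "0 \<le> (\<integral>x. min M (\<rho> i x) \<partial>gauss)"
      using min_range[OF i] by (intro Bochner_Integration.integral_nonneg) auto
    show "(\<integral>x. min M (\<rho> i x) \<partial>gauss) \<le> (\<integral>x. f i x \<partial>gauss)"
      using min_int[OF i] f_int[OF i] by (intro integral_mono) (auto simp: f_def)
  qed (use c0 in auto)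
  also note main
  also have "(\<Prod>j\<in>J. (\<integral>x. g j x \<partial>gauss) powr d j) \<le> (\<Prod>j\<in>J. ((\<integral>x. \<sigma> j x \<partial>gauss) + \<eta>) powr d j)"
  proof (intro prod_mono conjI powr_mono2)
    fix j assume j: "j \<in> J"
    have "(\<integral>x. g j x \<partial>gauss) \<le> (\<integral>x. \<sigma> j x + \<eta> \<partial>gauss)"
      using g_int[OF j] \<sigma>(1,2)[OF j] \<eta> by (intro integral_mono) (auto simp: g_def)
    also have "\<dots> = (\<integral>x. \<sigma> j x \<partial>gauss) + \<eta>" using \<sigma>(1)[OF j] by simp
    finally show "(\<integral>x. g j x \<partial>gauss) \<le> (\<integral>x. \<sigma> j x \<partial>gauss) + \<eta>" .
  qed (use d0 g_int_pos in \<open>auto simp: less_imp_le\<close>)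
  finally show ?thesis .
qed

lemma truncated_inequality_limit:
  assumes \<rho>: "\<And>i. i \<in> I \<Longrightarrow> \<rho> i \<in> borel_measurable borel" "\<And>i x. i \<in> I \<Longrightarrow> 0 \<le> \<rho> i x"
      "\<And>i. i \<in> I \<Longrightarrow> invariant (Q i) (\<rho> i)"
    and \<sigma>: "\<And>j. j \<in> J \<Longrightarrow> integrable gauss (\<sigma> j)" "\<And>j x. j \<in> J \<Longrightarrow> 0 \<le> \<sigma> j x"
      "\<And>j. j \<in> J \<Longrightarrow> invariant (R j) (\<sigma> j)"
    and le: "AE x in gauss. (\<Prod>i\<in>I. \<rho> i x powr c i) \<le> (\<Prod>j\<in>J. \<sigma> j x powr d j)"
    and M: "1 \<le> M"
  shows "(\<Prod>i\<in>I. (\<integral>x. min M (\<rho> i x) \<partial>gauss) powr c i) \<le> (\<Prod>j\<in>J. (\<integral>x. \<sigma> j x \<partial>gauss) powr d j)"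
proof (rule tendsto_lowerbound)
  show "((\<lambda>\<eta>. \<Prod>j\<in>J. ((\<integral>x. \<sigma> j x \<partial>gauss) + \<eta>) powr d j) \<longlongrightarrow> (\<Prod>j\<in>J. (\<integral>x. \<sigma> j x \<partial>gauss) powr d j)) (at_right 0)"
  proof (intro tendsto_prod)
    fix j assume j: "j \<in> J"
    have 0: "0 \<le> (\<integral>x. \<sigma> j x \<partial>gauss)" using \<sigma>(2)[OF j] by (intro Bochner_Integration.integral_nonneg) auto
    have "((\<lambda>\<eta>. (\<integral>x. \<sigma> j x \<partial>gauss) + \<eta>) \<longlongrightarrow> (\<integral>x. \<sigma> j x \<partial>gauss) + 0) (at_right 0)"
      by (intro tendsto_intros)
    moreover have "\<forall>\<^sub>F \<eta> in at_right 0. 0 \<le> (\<integral>x. \<sigma> j x \<partial>gauss) + \<eta>"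
      using eventually_at_right_less[of "0::real"] by eventually_elim (use 0 in simp)
    ultimately show "((\<lambda>\<eta>. ((\<integral>x. \<sigma> j x \<partial>gauss) + \<eta>) powr d j) \<longlongrightarrow> (\<integral>x. \<sigma> j x \<partial>gauss) powr d j) (at_right 0)"
      using d_pos[OF j] by (intro tendsto_powr'[OF _ tendsto_const]) auto
  qed
  show "\<forall>\<^sub>F \<eta> in at_right 0. (\<Prod>i\<in>I. (\<integral>x. min M (\<rho> i x) \<partial>gauss) powr c i) \<le> (\<Prod>j\<in>J. ((\<integral>x. \<sigma> j x \<partial>gauss) + \<eta>) powr d j)"
    using eventually_at_right_real[of 0 1, simplified]
  proof eventually_elim
    case (elim \<eta>)
    then show ?case using truncated_inequality[OF assms(1-7) M, of \<eta>] by simp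
  qed
qed simp

text \<open>The bound \<open>M\<close> is sent to \<infinity> by monotone convergence. The cases
  settled first are those where the answer is immediate; with them gone, all factors on the left
  have nonzero limits, so the product converges as well.\<close>

lemma gaussian_inequality:
  assumes \<rho>: "\<And>i. i \<in> I \<Longrightarrow> \<rho> i \<in> borel_measurable borel" "\<And>i x. i \<in> I \<Longrightarrow> 0 \<le> \<rho> i x"
      "\<And>i. i \<in> I \<Longrightarrow> invariant (Q i) (\<rho> i)"
    and \<sigma>: "\<And>j. j \<in> J \<Longrightarrow> \<sigma> j \<in> borel_measurable borel" "\<And>j x. j \<in> J \<Longrightarrow> 0 \<le> \<sigma> j x"
      "\<And>j. j \<in> J \<Longrightarrow> invariant (R j) (\<sigma> j)"
    and le: "AE x in gauss. (\<Prod>i\<in>I. \<rho> i x powr c i) \<le> (\<Prod>j\<in>J. \<sigma> j x powr d j)"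
  shows "(\<Prod>i\<in>I. ennreal_powr (\<integral>\<^sup>+x. ennreal (\<rho> i x) \<partial>gauss) (c i))
    \<le> (\<Prod>j\<in>J. ennreal_powr (\<integral>\<^sup>+x. ennreal (\<sigma> j x) \<partial>gauss) (d j))" (is "?lhs \<le> ?rhs")
proof (cases "?rhs = top \<or> (\<exists>i\<in>I. (\<integral>\<^sup>+x. ennreal (\<rho> i x) \<partial>gauss) = 0)")
  case True
  then show ?thesis
  proof
    assume "\<exists>i\<in>I. (\<integral>\<^sup>+x. ennreal (\<rho> i x) \<partial>gauss) = 0"
    then have "\<exists>i\<in>I. ennreal_powr (\<integral>\<^sup>+x. ennreal (\<rho> i x) \<partial>gauss) (c i) = 0"
      by (auto simp: ennreal_powr_eq_0_iff)
    then have "?lhs = 0" by (rule prod_zero[OF finite_I])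
    then show ?thesis by (simp only: zero_le)
  qed simp
next
  case False
  have trunc: "(\<Prod>i\<in>I. ennreal_powr (\<integral>\<^sup>+x. ennreal (min (1 + real n) (\<rho> i x)) \<partial>gauss) (c i)) \<le> ?rhs" for n :: nat
  proof -
    have bound: "0 \<le> (\<integral>x. min (1 + real n) (\<rho> i x) \<partial>gauss)" if "i \<in> I" for i
      using \<rho>(2)[OF that] by (intro Bochner_Integration.integral_nonneg) auto
    have nn: "(\<integral>\<^sup>+x. ennreal (min (1 + real n) (\<rho> i x)) \<partial>gauss) = ennreal (\<integral>x. min (1 + real n) (\<rho> i x) \<partial>gauss)" if "i \<in> I" for i
    proof (rule nn_integral_eq_integral)
      show "integrable gauss (\<lambda>x. min (1 + real n) (\<rho> i x))"
        by (rule gauss_integrable_range[where a = 0 and b = "1 + real n"]) (use \<rho>(1,2)[OF that] in auto)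
    qed (use \<rho>(2)[OF that] in auto)
    have lhs: "(\<Prod>i\<in>I. ennreal_powr (\<integral>\<^sup>+x. ennreal (min (1 + real n) (\<rho> i x)) \<partial>gauss) (c i))
        = ennreal (\<Prod>i\<in>I. (\<integral>x. min (1 + real n) (\<rho> i x) \<partial>gauss) powr c i)"
      by (simp add: nn bound ennreal_powr_ennreal prod_ennreal)
    show ?thesis
    proof (cases "\<exists>j\<in>J. (\<integral>\<^sup>+x. ennreal (\<sigma> j x) \<partial>gauss) = 0")
      \<comment> \<open>Another factor may be infinite here, and \<open>0 * \<infinity> = 0\<close>; replace every \<open>\<sigma> j\<close> by \<open>0\<close>.\<close>
      case True
      then obtain j where j: "j \<in> J" "(\<integral>\<^sup>+x. ennreal (\<sigma> j x) \<partial>gauss) = 0" by blast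
      have "AE x in gauss. \<sigma> j x = 0"
        using j \<sigma>(1,2)[OF j(1)] by (simp add: nn_integral_0_iff_AE antisym)
      then have "AE x in gauss. (\<Prod>i\<in>I. \<rho> i x powr c i) \<le> (\<Prod>j\<in>J. 0 powr d j)"
        using le
      proof eventually_elim
        case (elim x)
        then have "(\<Prod>j\<in>J. \<sigma> j x powr d j) = 0" "(\<Prod>j\<in>J. 0 powr d j) = (0::real)"
          using j(1) by (intro prod_zero finite_J bexI[of _ j]; simp)+
        then show ?case using elim(2) by (simp only:)
      qed
      then have "(\<Prod>i\<in>I. (\<integral>x. min (1 + real n) (\<rho> i x) \<partial>gauss) powr c i) \<le> (\<Prod>j\<in>J. (\<integral>x. 0 \<partial>(gauss :: 'a measure)) powr d j)"
        by (intro truncated_inequality_limit \<rho>) (auto simp: invariant_def)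
      also have "\<dots> = 0" using j(1) by (intro prod_zero finite_J bexI[of _ j]) simp
      finally show ?thesis unfolding lhs by (simp add: ennreal_neg)
    next
      case pos: False
      \<comment> \<open>No factor on the right vanishes here, so an infinite one would make the
        whole right side infinite, a case already settled.\<close>
      have fin: "(\<integral>\<^sup>+x. ennreal (\<sigma> j x) \<partial>gauss) < top" if "j \<in> J" for j
      proof (rule ccontr)
        assume "\<not> (\<integral>\<^sup>+x. ennreal (\<sigma> j x) \<partial>gauss) < top"
        then have "ennreal_powr (\<integral>\<^sup>+x. ennreal (\<sigma> j x) \<partial>gauss) (d j) = top"
          by (simp add: ennreal_powr_def less_top[symmetric])
        moreover have "(\<Prod>j\<in>J - {j}. ennreal_powr (\<integral>\<^sup>+x. ennreal (\<sigma> j x) \<partial>gauss) (d j)) \<noteq> 0"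
          using pos finite_J by (auto simp: ennreal_powr_eq_0_iff)
        ultimately have "?rhs = top"
          using that finite_J by (subst prod.remove[of _ j]) (auto simp: ennreal_top_mult)
        then show False using False by blast
      qed
      have \<sigma>_int: "integrable gauss (\<sigma> j)" if "j \<in> J" for j
        using \<sigma>(1,2)[OF that] fin[OF that] by (intro integrableI_nonneg) (auto simp: measurable_cong_sets[OF sets_gauss refl])
      have \<sigma>_nn: "(\<integral>\<^sup>+x. ennreal (\<sigma> j x) \<partial>gauss) = ennreal (\<integral>x. \<sigma> j x \<partial>gauss)" "0 \<le> (\<integral>x. \<sigma> j x \<partial>gauss)" if "j \<in> J" for j
        using \<sigma>(2)[OF that] \<sigma>_int[OF that]
        by (auto intro!: nn_integral_eq_integral Bochner_Integration.integral_nonneg)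
      have "?rhs = ennreal (\<Prod>j\<in>J. (\<integral>x. \<sigma> j x \<partial>gauss) powr d j)"
        by (simp add: \<sigma>_nn ennreal_powr_ennreal prod_ennreal)
      then show ?thesis
        unfolding lhs using truncated_inequality_limit[OF \<rho> \<sigma>_int \<sigma>(2,3) le, of "1 + real n"] by (simp add: ennreal_leI)
    qed
  qed
  have "(\<lambda>n. \<integral>\<^sup>+x. ennreal (min (1 + real n) (\<rho> i x)) \<partial>gauss) \<longlonglongrightarrow> (\<integral>\<^sup>+x. ennreal (\<rho> i x) \<partial>gauss)" if "i \<in> I" for i
  proof (rule nn_integral_LIMSEQ)
    show "incseq (\<lambda>n x. ennreal (min (1 + real n) (\<rho> i x)))"
      by (auto simp: incseq_def le_fun_def intro!: ennreal_leI min.mono)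
    show "(\<lambda>n. ennreal (min (1 + real n) (\<rho> i x))) \<longlonglongrightarrow> ennreal (\<rho> i x)" for x
    proof (rule tendsto_eventually)
      obtain N :: nat where "\<rho> i x \<le> N" using real_arch_simple by blast
      then show "\<forall>\<^sub>F n in sequentially. ennreal (min (1 + real n) (\<rho> i x)) = ennreal (\<rho> i x)"
        by (intro eventually_sequentiallyI[of N]) (auto simp: min_def)
    qed
  qed (use \<rho>(1)[OF that] in \<open>auto simp: measurable_cong_sets[OF sets_gauss refl]\<close>)
  then have "(\<lambda>n. \<Prod>i\<in>I. ennreal_powr (\<integral>\<^sup>+x. ennreal (min (1 + real n) (\<rho> i x)) \<partial>gauss) (c i)) \<longlonglongrightarrow> ?lhs"
    using False c_pos finite_I
    by (intro tendsto_prod_ennreal_pos tendsto_ennreal_powr) (auto simp: ennreal_powr_eq_0_iff)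
  then show ?thesis using trunc by (intro LIMSEQ_le_const2) auto
qed

end

section \<open>Gaussian images under coisometries\<close>

lemma nn_integral_PiM_translate:
  fixes z :: "'i \<Rightarrow> real"
  assumes B: "finite B" and [measurable]: "h \<in> borel_measurable (\<Pi>\<^sub>M b\<in>B. lborel)"
  shows "(\<integral>\<^sup>+c. h (\<lambda>b\<in>B. z b + c b) \<partial>(\<Pi>\<^sub>M b\<in>B. lborel)) = (\<integral>\<^sup>+c. h c \<partial>(\<Pi>\<^sub>M b\<in>B. (lborel :: real measure)))"
proof -
  interpret P: product_sigma_finite "\<lambda>_ :: 'i. lborel :: real measure" ..
  \<comment> \<open>The restriction to \<open>B\<close> keeps the translated point extensional,
    hence inside the product space.\<close>
  let ?T = "\<lambda>c. \<lambda>b\<in>B. z b + c b"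
  have T [measurable]: "?T \<in> (\<Pi>\<^sub>M b\<in>B. lborel) \<rightarrow>\<^sub>M (\<Pi>\<^sub>M b\<in>B. (lborel :: real measure))"
    by measurable
  have "distr (\<Pi>\<^sub>M b\<in>B. lborel) (\<Pi>\<^sub>M b\<in>B. lborel) ?T = (\<Pi>\<^sub>M b\<in>B. (lborel :: real measure))"
  proof (rule P.PiM_eqI[OF B])
    fix A :: "'i \<Rightarrow> real set" assume A: "\<And>b. b \<in> B \<Longrightarrow> A b \<in> sets lborel"
    have "?T -` Pi\<^sub>E B A \<inter> space (\<Pi>\<^sub>M b\<in>B. lborel) = Pi\<^sub>E B (\<lambda>b. (\<lambda>t. z b + t) -` A b)"
      by (auto simp: space_PiM PiE_iff)
    then have "emeasure (distr (\<Pi>\<^sub>M b\<in>B. lborel) (\<Pi>\<^sub>M b\<in>B. lborel) ?T) (Pi\<^sub>E B A)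
        = emeasure (\<Pi>\<^sub>M b\<in>B. lborel) (Pi\<^sub>E B (\<lambda>b. (\<lambda>t. z b + t) -` A b))"
      using A B by (subst emeasure_distr) (auto intro!: sets_PiM_I_finite)
    also have "\<dots> = (\<Prod>b\<in>B. emeasure lborel ((\<lambda>t. z b + t) -` A b))"
    proof (rule P.emeasure_PiM[OF B])
      fix b assume "b \<in> B"
      then have [measurable]: "A b \<in> sets borel" using A by simp
      have "(\<lambda>t. z b + t) -` A b \<inter> space borel \<in> sets borel" by measurable
      then show "(\<lambda>t. z b + t) -` A b \<in> sets lborel" by simp
    qed
    also have "\<dots> = (\<Prod>b\<in>B. emeasure lborel (A b))"
    proof (rule prod.cong[OF refl])
      fix b assume b: "b \<in> B"
      then have "emeasure lborel (A b) = emeasure (distr lborel borel ((+) (z b))) (A b)"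
        by (simp add: lborel_distr_plus)
      also have "\<dots> = emeasure lborel ((\<lambda>t. z b + t) -` A b)"
        using A[OF b] by (subst emeasure_distr) auto
      finally show "emeasure lborel ((\<lambda>t. z b + t) -` A b) = emeasure lborel (A b)" ..
    qed
    finally show "emeasure (distr (\<Pi>\<^sub>M b\<in>B. lborel) (\<Pi>\<^sub>M b\<in>B. lborel) ?T) (Pi\<^sub>E B A) = (\<Prod>b\<in>B. emeasure lborel (A b))" .
  qed (simp cong: sets_PiM_cong)
  then have "(\<integral>\<^sup>+c. h c \<partial>(\<Pi>\<^sub>M b\<in>B. lborel)) = (\<integral>\<^sup>+c. h c \<partial>distr (\<Pi>\<^sub>M b\<in>B. lborel) (\<Pi>\<^sub>M b\<in>B. lborel) ?T)"
    by simp
  then show ?thesis by (simp add: nn_integral_distr)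
qed

text \<open>\<open>subspace_lborel\<close> picks its basis by \<open>SOME\<close>. Computing with an
  arbitrary orthonormal basis covers whichever is picked, including \<open>B = {}\<close> for the
  zero subspace.\<close>

locale orthonormal_coordinates =
  fixes S B :: "'b::euclidean_space set"
  assumes basis: "orthonormal_basis S B"
begin

definition "coord_measure = (\<Pi>\<^sub>M b\<in>B. (lborel :: real measure))"

definition embed :: "('b \<Rightarrow> real) \<Rightarrow> 'b" where
  "embed c = (\<Sum>b\<in>B. c b *\<^sub>R b)"

lemma span_B: "span B = S"
  using basis unfolding orthonormal_basis_def by simp

lemma finite_B: "finite B"
proof -
  have "0 \<notin> B" using basis unfolding orthonormal_basis_def by fastforce
  then have "independent B"
    using basis pairwise_orthogonal_independent unfolding orthonormal_basis_def by blast
  then show ?thesis by (rule independent_imp_finite)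
qed

lemma subspace_S: "subspace S"
  using span_B by (metis subspace_span)

lemma embed_in: "embed c \<in> S"
  unfolding embed_def span_B[symmetric] by (intro span_sum span_scale span_base)

lemma inner_B: "a \<in> B \<Longrightarrow> b \<in> B \<Longrightarrow> a \<bullet> b = (if a = b then 1 else 0)"
  using basis unfolding orthonormal_basis_def pairwise_def orthogonal_def
  by (auto simp: norm_eq_1)

lemma inner_embed: "b \<in> B \<Longrightarrow> embed c \<bullet> b = c b"
proof -
  assume b: "b \<in> B"
  have "embed c \<bullet> b = (\<Sum>a\<in>B. if a = b then c b else 0)"
    unfolding embed_def inner_sum_left using b inner_B by (intro sum.cong) auto
  also have "\<dots> = c b" using finite_B b by simp
  finally show ?thesis .
qed

lemma embed_coords: "y \<in> S \<Longrightarrow> embed (\<lambda>b. y \<bullet> b) = y"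
proof -
  assume y: "y \<in> S"
  then obtain c where c: "y = embed c"
    unfolding embed_def span_B[symmetric] span_finite[OF finite_B] by auto
  then show ?thesis using inner_embed by (simp add: embed_def)
qed

lemma norm_embed: "(norm (embed c))\<^sup>2 = (\<Sum>b\<in>B. (c b)\<^sup>2)"
  unfolding power2_norm_eq_inner
  by (subst (2) embed_def) (simp add: inner_sum_right inner_embed power2_eq_square)

lemma embed_measurable [measurable]: "embed \<in> coord_measure \<rightarrow>\<^sub>M borel"
  unfolding embed_def coord_measure_def by measurable

lemma embed_translate: "y \<in> S \<Longrightarrow> embed (\<lambda>b\<in>B. y \<bullet> b + c b) = y + embed c"
proof -
  assume y: "y \<in> S"
  have "embed (\<lambda>b\<in>B. y \<bullet> b + c b) = embed (\<lambda>b. y \<bullet> b) + embed c"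
    unfolding embed_def by (simp add: algebra_simps sum.distrib)
  then show ?thesis using embed_coords[OF y] by simp
qed

lemma nn_integral_embed_translate:
  assumes "y \<in> S" and [measurable]: "h \<in> borel_measurable borel"
  shows "(\<integral>\<^sup>+c. h (y + embed c) \<partial>coord_measure) = (\<integral>\<^sup>+c. h (embed c) \<partial>coord_measure)"
proof -
  have "(\<lambda>c. h (embed c)) \<in> borel_measurable (\<Pi>\<^sub>M b\<in>B. lborel)"
    unfolding coord_measure_def[symmetric] by measurable
  from nn_integral_PiM_translate[OF finite_B this, of "\<lambda>b. y \<bullet> b"]
  show ?thesis using assms(1) by (simp add: embed_translate coord_measure_def)
qed

lemma nn_integral_exp_embed: "(\<integral>\<^sup>+c. ennreal (exp (- (pi * (norm (embed c))\<^sup>2))) \<partial>coord_measure) = 1"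
proof -
  interpret P: product_sigma_finite "\<lambda>_ :: 'b. lborel :: real measure" ..
  have "ennreal (exp (- (pi * (norm (embed c))\<^sup>2))) = (\<Prod>b\<in>B. ennreal (exp (- (pi * (c b)\<^sup>2))))" for c
    by (simp add: norm_embed sum_distrib_left prod_ennreal exp_sum[OF finite_B] flip: sum_negf)
  then show ?thesis
    unfolding coord_measure_def
    by (simp add: P.product_nn_integral_prod[OF finite_B, where f = "\<lambda>_ t. ennreal (exp (- (pi * t\<^sup>2)))"] nn_integral_exp_pi_real)
qed

lemma sigma_finite_coord_measure: "sigma_finite_measure coord_measure"
proof -
  interpret P: product_sigma_finite "\<lambda>_ :: 'b. lborel :: real measure" ..
  show ?thesis unfolding coord_measure_def by (rule P.sigma_finite[OF finite_B])
qed

text \<open>A Gaussian is its own image under a coisometry. Pairing the two sides through a third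
  Gaussian and translating avoids extending an orthonormal basis.\<close>
lemma nn_integral_gauss_coisometry:
  fixes T :: "'a::euclidean_space \<Rightarrow> 'b"
  assumes T: "linear T" "\<And>x. T x \<in> S"
    and A: "\<And>x y. y \<in> S \<Longrightarrow> T x \<bullet> y = x \<bullet> A y" "\<And>y. y \<in> S \<Longrightarrow> T (A y) = y"
    and [measurable]: "h \<in> borel_measurable borel"
  shows "(\<integral>\<^sup>+x. h (T x) \<partial>gauss) = (\<integral>\<^sup>+c. h (embed c) * ennreal (exp (- (pi * (norm (embed c))\<^sup>2))) \<partial>coord_measure)"
proof -
  interpret C: sigma_finite_measure coord_measure by (rule sigma_finite_coord_measure)
  interpret P: pair_sigma_finite "gauss :: 'a measure" coord_measure ..
  define e where "e y = ennreal (exp (- (pi * (norm y)\<^sup>2)))" for y :: 'b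
  have [measurable]: "e \<in> borel_measurable borel" unfolding e_def by simp
  have e_uminus: "e (- y) = e y" for y by (simp add: e_def)
  have [measurable]: "T \<in> borel_measurable borel"
    using T(1) by (simp add: borel_measurable_continuous_onI linear_continuous_on linear_linear)
  have minus_T: "- T x \<in> S" for x using T(2) subspace_S by (simp add: subspace_neg)
  have one: "(\<integral>\<^sup>+c. e (embed c) \<partial>coord_measure) = 1"
    unfolding e_def by (rule nn_integral_exp_embed)
  \<comment> \<open>Translating by \<open>v = A y\<close> turns \<open>T x\<close> into
    \<open>T x + y\<close>. As \<open>norm v = norm y\<close>, the Cameron-Martin density combines
    with \<open>e (T x)\<close> into \<open>e (T x + y)\<close>, so that the integrand depends on
    \<open>T x + y\<close> alone.\<close>
  have shift: "(\<integral>\<^sup>+x. h (T x) * e (- T x + y) \<partial>gauss) = (\<integral>\<^sup>+x. h (T x + y) * e (T x + y) \<partial>gauss)" if y: "y \<in> S" for y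
  proof -
    define v where "v = A y"
    have Tv: "T v = y" unfolding v_def by (rule A(2)[OF y])
    have xv: "x \<bullet> v = T x \<bullet> y" for x unfolding v_def using A(1)[OF y] by simp
    have nv: "norm v = norm y"
      using xv[of v] Tv by (simp add: norm_eq_sqrt_inner)
    have dens: "ennreal (exp (- (2 * pi * (x \<bullet> v)) - pi * (norm v)\<^sup>2)) * e (T x) = e (T x + y)" for x
    proof -
      have "- (2 * pi * (x \<bullet> v)) - pi * (norm v)\<^sup>2 + - (pi * (norm (T x))\<^sup>2) = - (pi * (norm (T x + y))\<^sup>2)"
        unfolding nv xv by (simp add: power2_norm_eq_inner inner_simps inner_commute algebra_simps)
      then show ?thesis
        unfolding e_def by (simp add: ennreal_mult[symmetric] exp_add[symmetric])
    qed
    have "(\<integral>\<^sup>+x. h (T x) * e (- T x + y) \<partial>gauss)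
        = (\<integral>\<^sup>+x. h (T x) * e (- T x + y) \<partial>distr (density gauss (\<lambda>x. ennreal (exp (- (2 * pi * (x \<bullet> v)) - pi * (norm v)\<^sup>2)))) borel (\<lambda>x. x + v))"
      by (simp only: gauss_shift)
    also have "\<dots> = (\<integral>\<^sup>+x. ennreal (exp (- (2 * pi * (x \<bullet> v)) - pi * (norm v)\<^sup>2)) * (h (T x + y) * e (- T x)) \<partial>gauss)"
      by (simp add: nn_integral_distr nn_integral_density linear_add[OF T(1)] Tv)
    also have "\<dots> = (\<integral>\<^sup>+x. h (T x + y) * e (T x + y) \<partial>gauss)"
      unfolding dens[symmetric] e_uminus by (simp only: mult_ac)
    finally show ?thesis .
  qed
  \<comment> \<open>A factor 1 is inserted: the Gaussian of the subspace, recentred at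
    \<open>T x\<close>. After \<open>shift\<close>, translation invariance in the coordinates
    \<open>c\<close> removes \<open>x\<close> altogether.\<close>
  have "(\<integral>\<^sup>+x. h (T x) \<partial>gauss) = (\<integral>\<^sup>+x. \<integral>\<^sup>+c. h (T x) * e (- T x + embed c) \<partial>coord_measure \<partial>gauss)"
  proof (rule nn_integral_cong)
    fix x
    have "(\<integral>\<^sup>+c. h (T x) * e (- T x + embed c) \<partial>coord_measure) = h (T x) * (\<integral>\<^sup>+c. e (- T x + embed c) \<partial>coord_measure)"
      by (rule nn_integral_cmult) measurable
    also have "\<dots> = h (T x)"
      using nn_integral_embed_translate[OF minus_T, of e x] one by simp
    finally show "h (T x) = (\<integral>\<^sup>+c. h (T x) * e (- T x + embed c) \<partial>coord_measure)" ..
  qed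
  also have "\<dots> = (\<integral>\<^sup>+c. \<integral>\<^sup>+x. h (T x) * e (- T x + embed c) \<partial>gauss \<partial>coord_measure)"
    by (rule P.Fubini'[symmetric]) measurable
  also have "\<dots> = (\<integral>\<^sup>+c. \<integral>\<^sup>+x. h (T x + embed c) * e (T x + embed c) \<partial>gauss \<partial>coord_measure)"
    by (simp only: shift[OF embed_in])
  also have "\<dots> = (\<integral>\<^sup>+x. \<integral>\<^sup>+c. h (T x + embed c) * e (T x + embed c) \<partial>coord_measure \<partial>gauss)"
    by (rule P.Fubini') measurable
  also have "\<dots> = (\<integral>\<^sup>+x. \<integral>\<^sup>+c. h (embed c) * e (embed c) \<partial>coord_measure \<partial>(gauss :: 'a measure))"
    using nn_integral_embed_translate[OF T(2), of "\<lambda>y. h y * e y"] by simp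
  also have "\<dots> = (\<integral>\<^sup>+c. h (embed c) * e (embed c) \<partial>coord_measure)"
    using gauss.emeasure_space_1[where 'a = 'a] by simp
  finally show ?thesis unfolding e_def .
qed

end

lemma sets_subspace_lborel [measurable_cong, simp]: "sets (subspace_lborel S) = sets (restrict_space borel S)"
  by (simp add: subspace_lborel_def Let_def)

lemma space_subspace_lborel [simp]: "space (subspace_lborel S) = S"
  by (simp add: subspace_lborel_def Let_def space_restrict_space)

lemma nn_integral_gauss_subspace_lborel:
  fixes T :: "'a::euclidean_space \<Rightarrow> 'b::euclidean_space"
  assumes S: "subspace S" and T: "linear T" "\<And>x. T x \<in> S"
    and A: "\<And>x y. y \<in> S \<Longrightarrow> T x \<bullet> y = x \<bullet> A y" "\<And>y. y \<in> S \<Longrightarrow> T (A y) = y"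
    and h: "h \<in> borel_measurable (restrict_space borel S)"
  shows "(\<integral>\<^sup>+x. h (T x) \<partial>gauss) = (\<integral>\<^sup>+y. h y * ennreal (exp (- (pi * (norm y)\<^sup>2))) \<partial>subspace_lborel S)"
proof -
  define B where "B = (SOME B. orthonormal_basis S B)"
  have "orthonormal_basis S B"
    unfolding B_def using orthonormal_basis_exists[OF S] by (rule someI_ex)
  then interpret orthonormal_coordinates S B by unfold_locales
  \<comment> \<open>\<open>h\<close> is measurable on \<open>S\<close> only; extension by 0 is Borel
    on the whole type because the subspace \<open>S\<close> is closed.\<close>
  define h' where "h' y = h y * indicator S y" for y
  have "closed S" using S by (rule closed_subspace)
  then have "S \<inter> space borel \<in> sets borel" by simp
  then have h' [measurable]: "h' \<in> borel_measurable borel"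
    using h unfolding h'_def by (simp add: borel_measurable_restrict_space_iff_ennreal)
  have h'_eq: "h' y = h y" if "y \<in> S" for y unfolding h'_def using that by simp
  have emb: "embed \<in> coord_measure \<rightarrow>\<^sub>M restrict_space borel S"
    using embed_in by (intro measurable_restrict_space2) auto
  have "(\<integral>\<^sup>+y. h y * ennreal (exp (- (pi * (norm y)\<^sup>2))) \<partial>subspace_lborel S)
      = (\<integral>\<^sup>+y. h y * ennreal (exp (- (pi * (norm y)\<^sup>2))) \<partial>distr coord_measure (restrict_space borel S) embed)"
    unfolding subspace_lborel_def Let_def B_def[symmetric] coord_measure_def embed_def ..
  also have "\<dots> = (\<integral>\<^sup>+c. h (embed c) * ennreal (exp (- (pi * (norm (embed c))\<^sup>2))) \<partial>coord_measure)"
  proof (rule nn_integral_distr[OF emb])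
    have "(\<lambda>y. ennreal (exp (- (pi * (norm y)\<^sup>2)))) \<in> borel_measurable (restrict_space borel S)"
      by (rule measurable_restrict_space1) simp
    with h have "(\<lambda>y. h y * ennreal (exp (- (pi * (norm y)\<^sup>2)))) \<in> borel_measurable (restrict_space borel S)"
      by (rule borel_measurable_times_ennreal)
    then show "(\<lambda>y. h y * ennreal (exp (- (pi * (norm y)\<^sup>2))))
        \<in> borel_measurable (distr coord_measure (restrict_space borel S) embed)"
      by simp
  qed
  also have "\<dots> = (\<integral>\<^sup>+x. h' (T x) \<partial>gauss)"
    using nn_integral_gauss_coisometry[OF T A h'] embed_in by (simp add: h'_eq)
  finally show ?thesis using T(2) by (simp add: h'_eq)
qed

section \<open>Reduction to a single space\<close>

text \<open>With the inclusion of \<open>S\<close> in the place of the linear map, the adjoint is the orthogonal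
  projection onto \<open>S\<close>.\<close>
definition proj_on :: "'a::euclidean_space set \<Rightarrow> 'a \<Rightarrow> 'a" where
  "proj_on S = adjoint_on S (\<lambda>z. z)"

lemma
  assumes "subspace S"
  shows proj_on_in: "proj_on S x \<in> S" and inner_proj_on: "z \<in> S \<Longrightarrow> z \<bullet> proj_on S x = z \<bullet> x"
proof -
  have "linear_map S UNIV (\<lambda>z. z)" by (simp add: linear_map_def)
  from adjoint_on_works[OF this assms, of x]
  show "proj_on S x \<in> S" "z \<in> S \<Longrightarrow> z \<bullet> proj_on S x = z \<bullet> x"
    by (auto simp: proj_on_def)
qed

lemma proj_on_eqI:
  assumes S: "subspace S" and y: "y \<in> S" "\<And>z. z \<in> S \<Longrightarrow> z \<bullet> y = z \<bullet> x"
  shows "proj_on S x = y"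
proof -
  have "proj_on S x - y \<in> S" using proj_on_in[OF S] y S by (simp add: subspace_diff)
  then have "(proj_on S x - y) \<bullet> (proj_on S x - y) = 0"
    using inner_proj_on[OF S] y by (simp add: inner_diff_right)
  then show ?thesis by simp
qed

lemma proj_on_ident: "subspace S \<Longrightarrow> x \<in> S \<Longrightarrow> proj_on S x = x"
  by (intro proj_on_eqI) auto

lemma linear_proj_on:
  assumes S: "subspace S"
  shows "linear (proj_on S)"
proof (rule linearI)
  show "proj_on S (x + y) = proj_on S x + proj_on S y" for x y
    using S by (intro proj_on_eqI) (simp_all add: proj_on_in subspace_add inner_proj_on inner_add_right)
  show "proj_on S (r *\<^sub>R x) = r *\<^sub>R proj_on S x" for r x
    using S by (intro proj_on_eqI) (simp_all add: proj_on_in subspace_scale inner_proj_on)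
qed

locale coisometry_on =
  fixes S :: "'a::euclidean_space set" and W :: "'b::euclidean_space set" and T :: "'a \<Rightarrow> 'b"
  assumes S: "subspace S" and W: "subspace W" and T: "linear_map S W T"
    and coisometry: "y \<in> W \<Longrightarrow> T (adjoint_on S T y) = y"
begin

text \<open>\<open>S\<close> may be a proper subspace, whereas \<open>gauss\<close> lives on the
  whole type. Precomposing with the orthogonal projection gives a coisometry of the whole type whose
  adjoint is that of \<open>T\<close>.\<close>

definition ext :: "'a \<Rightarrow> 'b" where
  "ext x = T (proj_on S x)"

text \<open>The orthogonal projection onto the range of the adjoint of \<open>T\<close>; it forgets
  exactly what \<open>ext\<close> forgets.\<close>

definition proj_range :: "'a \<Rightarrow> 'a" where
  "proj_range x = adjoint_on S T (ext x)"

lemma ext_in: "ext x \<in> W"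
  using T proj_on_in[OF S] unfolding ext_def linear_map_def by blast

lemma ext_eq: "x \<in> S \<Longrightarrow> ext x = T x"
  unfolding ext_def using proj_on_ident[OF S] by simp

lemma linear_ext: "linear ext"
proof (rule linearI)
  have lin: "linear (proj_on S)" by (rule linear_proj_on[OF S])
  show "ext (x + y) = ext x + ext y" for x y
    using T proj_on_in[OF S] unfolding ext_def linear_map_def by (simp add: linear_add[OF lin])
  show "ext (r *\<^sub>R x) = r *\<^sub>R ext x" for r x
    using T proj_on_in[OF S] unfolding ext_def linear_map_def by (simp add: linear_cmul[OF lin])
qed

lemma ext_inner: "ext x \<bullet> y = x \<bullet> adjoint_on S T y"
proof -
  have "ext x \<bullet> y = adjoint_on S T y \<bullet> proj_on S x"
    using adjoint_on_works[OF T S, of y] proj_on_in[OF S] unfolding ext_def by (simp add: inner_commute)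
  also have "\<dots> = adjoint_on S T y \<bullet> x"
    using adjoint_on_works[OF T S, of y] by (intro inner_proj_on[OF S]) blast
  finally show ?thesis by (simp add: inner_commute)
qed

lemma ext_adjoint: "y \<in> W \<Longrightarrow> ext (adjoint_on S T y) = y"
  using adjoint_on_works[OF T S, of y] coisometry by (simp add: ext_eq)

lemma inner_proj_range: "z \<bullet> proj_range x = ext z \<bullet> ext x"
  unfolding proj_range_def by (simp add: ext_inner)

lemma linear_proj_range: "linear proj_range"
proof (rule linearI)
  show "proj_range (x + y) = proj_range x + proj_range y" for x y
    by (subst vector_eq_ldot[symmetric])
      (simp add: inner_proj_range inner_add_right linear_add[OF linear_ext])
  show "proj_range (r *\<^sub>R x) = r *\<^sub>R proj_range x" for r x
    by (subst vector_eq_ldot[symmetric])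
      (simp add: inner_proj_range linear_cmul[OF linear_ext])
qed

lemma ext_proj_range: "ext (proj_range x) = ext x"
  unfolding proj_range_def by (rule ext_adjoint[OF ext_in])

lemma norm_proj_range: "norm (proj_range x) = norm (ext x)"
  unfolding norm_eq_sqrt_inner inner_proj_range ext_proj_range ..

lemma proj_range_adj: "proj_range x \<bullet> y = x \<bullet> proj_range y"
  by (metis inner_commute inner_proj_range)

lemma proj_range_le: "norm (proj_range x) \<le> norm x"
proof -
  have "(norm (proj_range x))\<^sup>2 = x \<bullet> proj_range x"
    by (simp add: power2_norm_eq_inner inner_proj_range ext_proj_range)
  also have "\<dots> \<le> norm x * norm (proj_range x)" by (rule norm_cauchy_schwarz)
  finally show ?thesis
    by (cases "norm (proj_range x) = 0") (auto simp: power2_eq_square)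
qed

lemma invariant_ext: "invariant proj_range (\<lambda>x. h (ext x))"
  unfolding invariant_def by (simp add: linear_add[OF linear_ext] ext_proj_range)

lemma ext_measurable: "ext \<in> borel \<rightarrow>\<^sub>M restrict_space borel W"
proof (rule measurable_restrict_space2)
  show "ext \<in> borel_measurable borel"
    using linear_ext by (simp add: borel_measurable_continuous_onI linear_continuous_on linear_linear)
qed (use ext_in in auto)

lemma nn_integral_gauss_ext:
  assumes "h \<in> borel_measurable (restrict_space borel W)"
  shows "(\<integral>\<^sup>+x. h (ext x) \<partial>gauss) = (\<integral>\<^sup>+y. h y * ennreal (exp (- (pi * (norm y)\<^sup>2))) \<partial>subspace_lborel W)"
  using nn_integral_gauss_subspace_lborel[OF W linear_ext ext_in ext_inner ext_adjoint assms] by blast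

text \<open>The image of \<open>gauss\<close> under \<open>ext\<close> has a density with respect to
  \<open>subspace_lborel W\<close>, so null sets pull back to null sets. This transports the
  equality with a Borel version.\<close>

lemma AE_gauss_ext:
  assumes "AE y in subspace_lborel W. P y"
  shows "AE x in gauss. P (ext x)"
proof -
  obtain N where N: "{y \<in> W. \<not> P y} \<subseteq> N" "N \<in> sets (subspace_lborel W)" "emeasure (subspace_lborel W) N = 0"
    using AE_E[OF assms] by (metis space_subspace_lborel)
  then have [measurable]: "N \<in> sets (restrict_space borel W)" by simp
  have "(\<integral>\<^sup>+x. indicator N (ext x) \<partial>gauss) = (\<integral>\<^sup>+y. indicator N y * ennreal (exp (- (pi * (norm y)\<^sup>2))) \<partial>subspace_lborel W)"
    by (rule nn_integral_gauss_ext) measurable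
  also have "\<dots> = 0"
  proof -
    have "AE y in subspace_lborel W. y \<notin> N" using N by (intro AE_not_in) auto
    then have "(\<integral>\<^sup>+y. indicator N y * ennreal (exp (- (pi * (norm y)\<^sup>2))) \<partial>subspace_lborel W)
        = (\<integral>\<^sup>+y. 0 \<partial>subspace_lborel W)"
      by (intro nn_integral_cong_AE) (auto simp: indicator_def)
    then show ?thesis by simp
  qed
  finally have "AE x in gauss. indicator N (ext x) = (0::ennreal)"
    using measurable_compose[OF ext_measurable, of "indicator N :: 'b \<Rightarrow> ennreal" borel]
    by (subst (asm) nn_integral_0_iff_AE) (simp_all add: measurable_cong_sets[OF sets_gauss refl])
  then show ?thesis
  proof eventually_elim
    case (elim x)
    then show ?case using N(1) ext_in[of x] by (auto simp: indicator_def split: if_splits)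
  qed
qed

text \<open>The Gaussian argument works with Borel functions, so \<open>f\<close> is exchanged for a
  Borel version before it is pulled back. The agreement holds only almost everywhere, which is why
  the product inequality is assumed only almost everywhere in the Gaussian form.\<close>

lemma lebesgue_lift:
  assumes f: "f \<in> borel_measurable (subspace_lebesgue W)" and f0: "\<And>y. y \<in> W \<Longrightarrow> (0::real) \<le> f y"
  shows "\<exists>\<rho>. \<rho> \<in> borel_measurable borel \<and> (\<forall>x. 0 \<le> \<rho> x) \<and> invariant proj_range \<rho> \<and>
    (AE x in gauss. \<rho> x = f (ext x) * exp (pi * (norm (ext x))\<^sup>2)) \<and>
    (\<integral>\<^sup>+x. ennreal (\<rho> x) \<partial>gauss) = (\<integral>\<^sup>+y. ennreal (f y) \<partial>subspace_lebesgue W)"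
proof -
  obtain f' where f': "f' \<in> borel_measurable (subspace_lborel W)" "AE y in subspace_lborel W. f y = f' y"
    using completion_ex_borel_measurable_real f unfolding subspace_lebesgue_def by blast
  have f'_meas [measurable]: "f' \<in> borel_measurable (restrict_space borel W)"
    using f'(1) by (simp add: measurable_cong_sets[OF sets_subspace_lborel refl])
  \<comment> \<open>\<open>f'\<close> may be negative where it differs from \<open>f\<close>, hence
    the \<open>max\<close>. The exponential cancels the Gaussian density.\<close>
  define r where "r y = max 0 (f' y) * exp (pi * (norm y)\<^sup>2)" for y
  have norm_meas [measurable]: "norm \<in> borel_measurable (restrict_space borel W)"
    by (rule measurable_restrict_space1) simp
  have r_meas [measurable]: "r \<in> borel_measurable (restrict_space borel W)"
    unfolding r_def by measurable
  have "(\<lambda>x. r (ext x)) \<in> borel_measurable borel"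
    using measurable_compose[OF ext_measurable r_meas] .
  moreover have "0 \<le> r (ext x)" for x unfolding r_def by simp
  moreover have "AE x in gauss. r (ext x) = f (ext x) * exp (pi * (norm (ext x))\<^sup>2)"
    using AE_gauss_ext[OF f'(2)]
  proof eventually_elim
    case (elim x)
    then show ?case using f0[OF ext_in, of x] by (simp add: r_def)
  qed
  moreover have "(\<integral>\<^sup>+x. ennreal (r (ext x)) \<partial>gauss) = (\<integral>\<^sup>+y. ennreal (f y) \<partial>subspace_lebesgue W)"
  proof -
    have "(\<integral>\<^sup>+x. ennreal (r (ext x)) \<partial>gauss)
        = (\<integral>\<^sup>+y. ennreal (r y) * ennreal (exp (- (pi * (norm y)\<^sup>2))) \<partial>subspace_lborel W)"
      by (rule nn_integral_gauss_ext) measurable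
    also have "\<dots> = (\<integral>\<^sup>+y. ennreal (f y) \<partial>subspace_lborel W)"
    proof (rule nn_integral_cong_AE)
      show "AE y in subspace_lborel W. ennreal (r y) * ennreal (exp (- (pi * (norm y)\<^sup>2))) = ennreal (f y)"
        using f'(2)
      proof (rule AE_mp, intro AE_I2 impI)
        fix y assume "y \<in> space (subspace_lborel W)" "f y = f' y"
        then have "0 \<le> f' y" "f y = f' y" using f0[of y] by auto
        then show "ennreal (r y) * ennreal (exp (- (pi * (norm y)\<^sup>2))) = ennreal (f y)"
          by (simp add: r_def ennreal_mult[symmetric] mult.assoc exp_add[symmetric])
      qed
    qed
    finally show ?thesis unfolding subspace_lebesgue_def nn_integral_completion .
  qed
  ultimately show ?thesis using invariant_ext[of r] by blast
qed

end

text \<open>The Gaussian weights separate from the functions as one exponential. Its exponent is the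
  quadratic form that the frame identity equates on the two sides.\<close>

lemma prod_powr_mult_exp:
  fixes u :: "'i \<Rightarrow> real"
  assumes "finite I" "\<And>i. i \<in> I \<Longrightarrow> 0 \<le> u i"
  shows "(\<Prod>i\<in>I. (u i * exp (pi * n i)) powr c i) = (\<Prod>i\<in>I. u i powr c i) * exp (pi * (\<Sum>i\<in>I. c i * n i))"
proof -
  have "(\<Prod>i\<in>I. (u i * exp (pi * n i)) powr c i) = (\<Prod>i\<in>I. u i powr c i * exp (pi * (c i * n i)))"
  proof (intro prod.cong refl)
    fix i assume "i \<in> I"
    then have "(u i * exp (pi * n i)) powr c i = u i powr c i * exp (pi * n i) powr c i"
      by (simp add: powr_mult)
    also have "exp (pi * n i) powr c i = exp (pi * (c i * n i))" by (simp add: powr_def)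
    finally show "(u i * exp (pi * n i)) powr c i = u i powr c i * exp (pi * (c i * n i))" .
  qed
  then show ?thesis by (simp add: prod.distrib exp_sum[OF assms(1)] sum_distrib_left)
qed

theorem corollary1p19:
  fixes k m :: nat
    and E :: "nat \<Rightarrow> 'a::euclidean_space set"
    and E0 :: "'a set"
    and F :: "nat \<Rightarrow> 'b::euclidean_space set"
    and c d :: "nat \<Rightarrow> real"
    and U :: "nat \<Rightarrow> 'a \<Rightarrow> 'a"
    and V :: "nat \<Rightarrow> 'a \<Rightarrow> 'b"
    and f :: "nat \<Rightarrow> 'a \<Rightarrow> real"
    and g :: "nat \<Rightarrow> 'b \<Rightarrow> real"
  assumes E_subspace: "\<And>i. i \<in> {1..k} \<Longrightarrow> subspace (E i)"
    and E_orthogonal: "\<And>i j x y. i \<in> {1..k} \<Longrightarrow> j \<in> {1..k} \<Longrightarrow> i \<noteq> j \<Longrightarrow>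
      x \<in> E i \<Longrightarrow> y \<in> E j \<Longrightarrow> orthogonal x y"
    and E0_direct_sum: "E0 = span (\<Union>i\<in>{1..k}. E i)"
    and F_subspace: "\<And>j. j \<in> {1..m} \<Longrightarrow> subspace (F j)"
    and c_pos: "\<And>i. i \<in> {1..k} \<Longrightarrow> 0 < c i"
    and d_pos: "\<And>j. j \<in> {1..m} \<Longrightarrow> 0 < d j"
    and U_linear: "\<And>i. i \<in> {1..k} \<Longrightarrow> linear_map E0 (E i) (U i)"
    and V_linear: "\<And>j. j \<in> {1..m} \<Longrightarrow> linear_map E0 (F j) (V j)"
    and U_coisometry: "\<And>i y. i \<in> {1..k} \<Longrightarrow> y \<in> E i \<Longrightarrow> U i (adjoint_on E0 (U i) y) = y"
    and V_coisometry: "\<And>j y. j \<in> {1..m} \<Longrightarrow> y \<in> F j \<Longrightarrow> V j (adjoint_on E0 (V j) y) = y"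
    and U_bij: "bij_betw (\<lambda>x. \<Sum>i=1..k. U i x) E0 E0"
    and frame: "\<And>x. x \<in> E0 \<Longrightarrow>
      (\<Sum>i=1..k. c i *\<^sub>R adjoint_on E0 (U i) (U i x)) =
      (\<Sum>j=1..m. d j *\<^sub>R adjoint_on E0 (V j) (V j x))"
    and f_measurable: "\<And>i. i \<in> {1..k} \<Longrightarrow> f i \<in> borel_measurable (subspace_lebesgue (E i))"
    and f_nonneg: "\<And>i x. i \<in> {1..k} \<Longrightarrow> x \<in> E i \<Longrightarrow> 0 \<le> f i x"
    and g_measurable: "\<And>j. j \<in> {1..m} \<Longrightarrow> g j \<in> borel_measurable (subspace_lebesgue (F j))"
    and g_nonneg: "\<And>j y. j \<in> {1..m} \<Longrightarrow> y \<in> F j \<Longrightarrow> 0 \<le> g j y"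
    and pointwise: "\<And>x. x \<in> E0 \<Longrightarrow>
      (\<Prod>i=1..k. f i (U i x) powr c i) \<le> (\<Prod>j=1..m. g j (V j x) powr d j)"
  shows "(\<Prod>i=1..k. ennreal_powr (\<integral>\<^sup>+x. ennreal (f i x) \<partial>subspace_lebesgue (E i)) (c i)) \<le>
         (\<Prod>j=1..m. ennreal_powr (\<integral>\<^sup>+y. ennreal (g j y) \<partial>subspace_lebesgue (F j)) (d j))"
proof -
  have E0: "subspace E0" unfolding E0_direct_sum by (rule subspace_span)
  have E_sub: "E i \<subseteq> E0" if "i \<in> {1..k}" for i
    unfolding E0_direct_sum using that by (intro subsetI span_base) blast
  have coU: "coisometry_on E0 (E i) (U i)" if "i \<in> {1..k}" for i
    using that by unfold_locales (use E0 E_subspace U_linear U_coisometry in auto)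
  have coV: "coisometry_on E0 (F j) (V j)" if "j \<in> {1..m}" for j
    using that by unfold_locales (use E0 F_subspace V_linear V_coisometry in auto)
  define P where "P = proj_on E0"
  define U' where "U' i = coisometry_on.ext E0 (U i)" for i
  define V' where "V' j = coisometry_on.ext E0 (V j)" for j
  define Q where "Q i = coisometry_on.proj_range E0 (U i)" for i
  define R where "R j = coisometry_on.proj_range E0 (V j)" for j
  have P_in: "P x \<in> E0" for x unfolding P_def by (rule proj_on_in[OF E0])
  have U'_eq: "U' i x = U i (P x)" if "i \<in> {1..k}" for i x
    unfolding U'_def P_def using coisometry_on.ext_def[OF coU[OF that]] .
  have V'_eq: "V' j x = V j (P x)" if "j \<in> {1..m}" for j x
    unfolding V'_def P_def using coisometry_on.ext_def[OF coV[OF that]] .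
  have Q_eq: "Q i x = adjoint_on E0 (U i) (U' i x)" if "i \<in> {1..k}" for i x
    unfolding Q_def U'_def using coisometry_on.proj_range_def[OF coU[OF that]] .
  have R_eq: "R j x = adjoint_on E0 (V j) (V' j x)" if "j \<in> {1..m}" for j x
    unfolding R_def V'_def using coisometry_on.proj_range_def[OF coV[OF that]] .
  have norm_Q: "norm (Q i x) = norm (U' i x)" "x \<bullet> Q i x = (norm (U' i x))\<^sup>2" if "i \<in> {1..k}" for i x
    using coisometry_on.norm_proj_range[OF coU[OF that]] coisometry_on.inner_proj_range[OF coU[OF that]]
    unfolding Q_def U'_def by (auto simp: power2_norm_eq_inner)
  have norm_R: "norm (R j x) = norm (V' j x)" "x \<bullet> R j x = (norm (V' j x))\<^sup>2" if "j \<in> {1..m}" for j x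
    using coisometry_on.norm_proj_range[OF coV[OF that]] coisometry_on.inner_proj_range[OF coV[OF that]]
    unfolding R_def V'_def by (auto simp: power2_norm_eq_inner)
  \<comment> \<open>Pairing the operator identity with \<open>x\<close> turns it into an identity of
    quadratic forms; evaluating it at \<open>P x\<close> extends it from \<open>E0\<close> to the
    whole type.\<close>
  have frame_norm: "(\<Sum>i=1..k. c i * (norm (U' i x))\<^sup>2) = (\<Sum>j=1..m. d j * (norm (V' j x))\<^sup>2)" for x
  proof -
    have "(\<Sum>i=1..k. c i *\<^sub>R Q i x) = (\<Sum>j=1..m. d j *\<^sub>R R j x)"
      using frame[OF P_in, of x] by (simp add: Q_eq R_eq U'_eq V'_eq)
    then have "x \<bullet> (\<Sum>i=1..k. c i *\<^sub>R Q i x) = x \<bullet> (\<Sum>j=1..m. d j *\<^sub>R R j x)" by simp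
    then show ?thesis by (simp add: inner_sum_right norm_Q norm_R)
  qed
  have surj: "\<exists>w. \<forall>i\<in>{1..k}. Q i w = Q i (u i)" for u
  proof -
    have U'_in: "U' i (u i) \<in> E i" if "i \<in> {1..k}" for i
      unfolding U'_def by (rule coisometry_on.ext_in[OF coU[OF that]])
    have "(\<Sum>i=1..k. U' i (u i)) \<in> E0"
      using U'_in E_sub by (intro subspace_sum[OF E0]) blast
    then obtain w where w: "w \<in> E0" "(\<Sum>i=1..k. U i w) = (\<Sum>i=1..k. U' i (u i))"
      using bij_betw_imp_surj_on[OF U_bij] by (metis (no_types, lifting) imageE)
    \<comment> \<open>The bijection only matches the sums over \<open>i\<close>. The differences
      \<open>t i\<close> lie in mutually orthogonal subspaces and add up to 0, so each of them
      vanishes.\<close>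
    define t where "t i = U i w - U' i (u i)" for i
    have t_in: "t i \<in> E i" if "i \<in> {1..k}" for i
      unfolding t_def using U_linear[OF that] w(1) U'_in[OF that] E_subspace[OF that]
      by (auto simp: linear_map_def intro: subspace_diff)
    have t0: "(\<Sum>i=1..k. t i) = 0" unfolding t_def sum_subtractf using w(2) by simp
    have "Q i w = Q i (u i)" if i: "i \<in> {1..k}" for i
    proof -
      have "0 = t i \<bullet> (\<Sum>j=1..k. t j)" using t0 by simp
      also have "\<dots> = (\<Sum>j=1..k. if j = i then t i \<bullet> t i else 0)"
        unfolding inner_sum_right using E_orthogonal[OF i _ _ t_in[OF i] t_in]
        by (intro sum.cong) (auto simp: orthogonal_def)
      also have "\<dots> = t i \<bullet> t i" using i by simp
      finally have "U i w = U' i (u i)" unfolding t_def by simp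
      moreover have "U' i w = U i w"
        unfolding U'_def by (rule coisometry_on.ext_eq[OF coU[OF i] w(1)])
      ultimately show ?thesis by (simp add: Q_eq[OF i])
    qed
    then show ?thesis by blast
  qed
  interpret projection_datum "{1..k}" "{1..m}" c d Q R
  proof (rule projection_datum.intro)
    show "linear (Q i)" if "i \<in> {1..k}" for i
      unfolding Q_def by (rule coisometry_on.linear_proj_range[OF coU[OF that]])
    show "norm (Q i x) \<le> norm x" if "i \<in> {1..k}" for i x
      unfolding Q_def by (rule coisometry_on.proj_range_le[OF coU[OF that]])
    show "Q i x \<bullet> y = x \<bullet> Q i y" if "i \<in> {1..k}" for i x y
      unfolding Q_def by (rule coisometry_on.proj_range_adj[OF coU[OF that]])
    show "linear (R j)" if "j \<in> {1..m}" for j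
      unfolding R_def by (rule coisometry_on.linear_proj_range[OF coV[OF that]])
    show "(\<Sum>i=1..k. c i * (norm (Q i x))\<^sup>2) = (\<Sum>j=1..m. d j * (norm (R j x))\<^sup>2)" for x
      using frame_norm[of x] by (simp add: norm_Q norm_R)
  qed (use c_pos d_pos surj in auto)
  let ?lift = "\<lambda>i r. r \<in> borel_measurable borel \<and> (\<forall>x. 0 \<le> r x) \<and> invariant (Q i) r \<and>
    (AE x in gauss. r x = f i (U' i x) * exp (pi * (norm (U' i x))\<^sup>2)) \<and>
    (\<integral>\<^sup>+x. ennreal (r x) \<partial>gauss) = (\<integral>\<^sup>+x. ennreal (f i x) \<partial>subspace_lebesgue (E i))"
  have "\<forall>i\<in>{1..k}. \<exists>r. ?lift i r"
  proof
    fix i assume i: "i \<in> {1..k}"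
    show "\<exists>r. ?lift i r"
      unfolding Q_def U'_def by (rule coisometry_on.lebesgue_lift[OF coU[OF i] f_measurable[OF i] f_nonneg[OF i]])
  qed
  then obtain \<rho> where \<rho>_lift: "\<forall>i\<in>{1..k}. ?lift i (\<rho> i)"
    by (rule bchoice[THEN exE])
  have \<rho>: "\<And>i. i \<in> {1..k} \<Longrightarrow> \<rho> i \<in> borel_measurable borel" "\<And>i x. i \<in> {1..k} \<Longrightarrow> 0 \<le> \<rho> i x"
    "\<And>i. i \<in> {1..k} \<Longrightarrow> invariant (Q i) (\<rho> i)"
    "\<And>i. i \<in> {1..k} \<Longrightarrow> AE x in gauss. \<rho> i x = f i (U' i x) * exp (pi * (norm (U' i x))\<^sup>2)"
    "\<And>i. i \<in> {1..k} \<Longrightarrow> (\<integral>\<^sup>+x. ennreal (\<rho> i x) \<partial>gauss) = (\<integral>\<^sup>+x. ennreal (f i x) \<partial>subspace_lebesgue (E i))"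
    using \<rho>_lift by blast+
  let ?lift = "\<lambda>j r. r \<in> borel_measurable borel \<and> (\<forall>x. 0 \<le> r x) \<and> invariant (R j) r \<and>
    (AE x in gauss. r x = g j (V' j x) * exp (pi * (norm (V' j x))\<^sup>2)) \<and>
    (\<integral>\<^sup>+x. ennreal (r x) \<partial>gauss) = (\<integral>\<^sup>+y. ennreal (g j y) \<partial>subspace_lebesgue (F j))"
  have "\<forall>j\<in>{1..m}. \<exists>r. ?lift j r"
  proof
    fix j assume j: "j \<in> {1..m}"
    show "\<exists>r. ?lift j r"
      unfolding R_def V'_def by (rule coisometry_on.lebesgue_lift[OF coV[OF j] g_measurable[OF j] g_nonneg[OF j]])
  qed
  then obtain \<sigma> where \<sigma>_lift: "\<forall>j\<in>{1..m}. ?lift j (\<sigma> j)"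
    by (rule bchoice[THEN exE])
  have \<sigma>: "\<And>j. j \<in> {1..m} \<Longrightarrow> \<sigma> j \<in> borel_measurable borel" "\<And>j x. j \<in> {1..m} \<Longrightarrow> 0 \<le> \<sigma> j x"
    "\<And>j. j \<in> {1..m} \<Longrightarrow> invariant (R j) (\<sigma> j)"
    "\<And>j. j \<in> {1..m} \<Longrightarrow> AE x in gauss. \<sigma> j x = g j (V' j x) * exp (pi * (norm (V' j x))\<^sup>2)"
    "\<And>j. j \<in> {1..m} \<Longrightarrow> (\<integral>\<^sup>+x. ennreal (\<sigma> j x) \<partial>gauss) = (\<integral>\<^sup>+y. ennreal (g j y) \<partial>subspace_lebesgue (F j))"
    using \<sigma>_lift by blast+
  have "AE x in gauss. \<forall>i\<in>{1..k}. \<rho> i x = f i (U' i x) * exp (pi * (norm (U' i x))\<^sup>2)"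
    using \<rho>(4) by (intro AE_finite_allI) auto
  moreover have "AE x in gauss. \<forall>j\<in>{1..m}. \<sigma> j x = g j (V' j x) * exp (pi * (norm (V' j x))\<^sup>2)"
    using \<sigma>(4) by (intro AE_finite_allI) auto
  ultimately have "AE x in gauss. (\<Prod>i=1..k. \<rho> i x powr c i) \<le> (\<Prod>j=1..m. \<sigma> j x powr d j)"
  proof eventually_elim
    case (elim x)
    have f0: "0 \<le> f i (U' i x)" if "i \<in> {1..k}" for i
      unfolding U'_def by (rule f_nonneg[OF that coisometry_on.ext_in[OF coU[OF that]]])
    have g0: "0 \<le> g j (V' j x)" if "j \<in> {1..m}" for j
      unfolding V'_def by (rule g_nonneg[OF that coisometry_on.ext_in[OF coV[OF that]]])
    have "(\<Prod>i=1..k. \<rho> i x powr c i) = (\<Prod>i=1..k. f i (U' i x) powr c i) * exp (pi * (\<Sum>i=1..k. c i * (norm (U' i x))\<^sup>2))"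
      using elim(1) f0 by (subst prod_powr_mult_exp[symmetric]) simp_all
    also have "\<dots> \<le> (\<Prod>j=1..m. g j (V' j x) powr d j) * exp (pi * (\<Sum>i=1..k. c i * (norm (U' i x))\<^sup>2))"
      using pointwise[OF P_in, of x] by (intro mult_right_mono) (simp_all add: U'_eq V'_eq)
    \<comment> \<open>By \<open>frame_norm\<close> the weight collected on the left is exactly the
      one carried by the functions on the right.\<close>
    also have "\<dots> = (\<Prod>j=1..m. \<sigma> j x powr d j)"
      unfolding frame_norm using elim(2) g0 by (subst prod_powr_mult_exp[symmetric]) simp_all
    finally show ?case .
  qed
  from gaussian_inequality[OF \<rho>(1-3) \<sigma>(1-3) this]
  show ?thesis using \<rho>(5) \<sigma>(5) by simp
qed

end
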